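(* Let $G$ be a unimodular locally compact second countable group with Haar measure $m_G$, and let $(\mathcal G,\nu)$ be the transverse measured groupoid of an integrable transverse $G$-system $(X,\mu,Y)$. If $G$ is amenable, then $(\mathcal G,\nu)$ is boundedly acyclic, i.e. $\mathrm{H}_{\mathrm{mb}}^k((\mathcal G,\nu);\underline{\mathbb R})=0$ for all $k>0$.
   Context: Let $G$ act by a probability measure preserving Borel action on a standard Borel probability space $(X,\mu)$. For a Borel set $Y\subset X$ and $x\in X$ put $Y_x=\{g\in G: gx\in Y\}$. $Y$ is a cross section if $GY=X$ and each $Y_x$ is locally finite ($|Y_x\cap L|<\infty$ for all compact $L\subset G$); then $(X,\mu,Y)$ is a transverse $G$-system. It is integrable if $\int_X |Y_x\cap L|\,d\mu(x)<\infty$ for every compact $L\subset G$. The transverse measure $\nu$ is the unique $\sigma$-finite Borel measure on $Y$ with $\int_Y f\,d\nu=\int_X\sum_{g\in Y_x}f(gx)w(g)\,d\mu(x)$ for all Borel $f:Y\to[0,\infty]$ and all Borel $w:G\to[0,\infty]$ with $\int_G w\,dm_G=1$ (it is finite if and only if the system is integrable). Transverse measured groupoid $(\mathcal G,\nu)$: objects $\mathcal G^{(0)}=Y$, morphisms $\mathcal G^{(1)}=\{(g,y)\in G\times Y: gy\in Y\}$, $s(g,y)=y$, $t(g,y)=gy$, $(g,hy)(h,y)=(gh,y)$, $(g,y)^{-1}=(g^{-1},gy)$. The fibers $\mathcal G^y=t^{-1}(y)$ are countable and carry counting measure; $\nu$ is invariant. Measurable bounded cohomology: let $\mathcal G^{[n]}=\{(\gamma_0,\dots,\gamma_{n-1})\in(\mathcal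 G^{(1)})^n: t(\gamma_0)=\dots=t(\gamma_{n-1})\}$ with the measure obtained by integrating the counting measures on $(\mathcal G^y)^n$ against $\nu$. $\mathrm L^\infty(\mathcal G^{[n]})^{\mathcal G}$ is the space of classes $[f]\in \mathrm L^\infty(\mathcal G^{[n]})$ such that for almost all $(\gamma_0,\dots,\gamma_{n-1})$ and all $\gamma\in\mathcal G^{(1)}$ with $t(\gamma)=t(\gamma_0)$ one has $f(\gamma^{-1}\gamma_0,\dots,\gamma^{-1}\gamma_{n-1})=f(\gamma_0,\dots,\gamma_{n-1})$. With the homogeneous differential $d^nf(\gamma_0,\dots,\gamma_{n+1})=\sum_j(-1)^jf(\gamma_0,\dots,\widehat{\gamma_j},\dots,\gamma_{n+1})$, $\mathrm{H}_{\mathrm{mb}}^k((\mathcal G,\nu);\underline{\mathbb R})$ is the $k$-th cohomology of $0\to \mathrm L^\infty(\mathcal G^{[1]})^{\mathcal G}\to \mathrm L^\infty(\mathcal G^{[2]})^{\mathcal G}\to\cdots$, with the quotient seminorm of the essential supremum norm. *)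

theory Defs
  imports "HOL-Probability.Probability"
begin

section \<open>Locally compact groups\<close>

text \<open>
  Topological groups are types of class \<^class>\<open>topological_group_add\<close>. The group law is written
  \<open>+\<close> with unit \<open>0\<close>, but it is not assumed to be commutative.
\<close>

definition haar_measure :: "'g::topological_group_add measure \<Rightarrow> bool" where
  "haar_measure m \<longleftrightarrow>
     sets m = sets borel \<and>
     (\<forall>g. distr m borel (\<lambda>x. g + x) = m) \<and>
     (\<forall>K. compact K \<longrightarrow> emeasure m K < \<infinity>) \<and>
     emeasure m UNIV \<noteq> 0"

definition unimodular :: "'g::topological_group_add measure \<Rightarrow> bool" where
  "unimodular m \<longleftrightarrow> (\<forall>g. distr m borel (\<lambda>x. x + g) = m)"

definition ess_bounded :: "'a measure \<Rightarrow> ('a \<Rightarrow> real) set" where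
  "ess_bounded M = {f \<in> borel_measurable M. \<exists>C. AE x in M. \<bar>f x\<bar> \<le> C}"

text \<open>
  Amenability is the existence of a left invariant mean on \<open>L\<^sup>\<infinity>\<close> of the group. A mean is given on
  representatives; positivity almost everywhere makes it descend to almost everywhere classes.
\<close>

definition amenable :: "'g::topological_group_add measure \<Rightarrow> bool" where
  "amenable m \<longleftrightarrow>
     (\<exists>\<Lambda> :: ('g \<Rightarrow> real) \<Rightarrow> real.
        (\<forall>f \<in> ess_bounded m. \<forall>h \<in> ess_bounded m. \<Lambda> (\<lambda>x. f x + h x) = \<Lambda> f + \<Lambda> h) \<and>
        (\<forall>c. \<forall>f \<in> ess_bounded m. \<Lambda> (\<lambda>x. c * f x) = c * \<Lambda> f) \<and>
        (\<forall>f \<in> ess_bounded m. (AE x in m. 0 \<le> f x) \<longrightarrow> 0 \<le> \<Lambda> f) \<and>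
        \<Lambda> (\<lambda>_. 1) = 1 \<and>
        (\<forall>g. \<forall>f \<in> ess_bounded m. \<Lambda> (\<lambda>x. f (g + x)) = \<Lambda> f))"

section \<open>Transverse systems\<close>

definition standard_borel :: "'x measure \<Rightarrow> bool" where
  "standard_borel M \<longleftrightarrow>
     (\<exists>T. completely_metrizable_space T \<and> second_countable T \<and> space M = topspace T \<and>
          sets M = sigma_sets (topspace T) {U. openin T U})"

locale pmp_action = prob_space M
  for M :: "'x measure" and act :: "'g::topological_group_add \<Rightarrow> 'x \<Rightarrow> 'x" +
  assumes standard_borel: "standard_borel M"
    and act_zero: "x \<in> space M \<Longrightarrow> act 0 x = x"
    and act_add: "x \<in> space M \<Longrightarrow> act (g + h) x = act g (act h x)"
    and act_measurable: "(\<lambda>(g, x). act g x) \<in> borel \<Otimes>\<^sub>M M \<rightarrow>\<^sub>M M"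
    and act_preserving: "distr M M (act g) = M"

definition hitting_set :: "('g \<Rightarrow> 'x \<Rightarrow> 'x) \<Rightarrow> 'x set \<Rightarrow> 'x \<Rightarrow> 'g set" where
  "hitting_set act Y x = {g. act g x \<in> Y}"

locale transverse_system = pmp_action M act
  for M :: "'x measure" and act :: "'g::topological_group_add \<Rightarrow> 'x \<Rightarrow> 'x" +
  fixes Y :: "'x set"
  assumes cross_section_borel: "Y \<in> sets M"
    and cross_section_full: "(\<Union>g. act g ` Y) = space M"
    and cross_section_locally_finite:
      "x \<in> space M \<Longrightarrow> compact L \<Longrightarrow> finite (hitting_set act Y x \<inter> L)"

definition integrable_system ::
    "'x measure \<Rightarrow> ('g::topological_group_add \<Rightarrow> 'x \<Rightarrow> 'x) \<Rightarrow> 'x set \<Rightarrow> bool" where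
  "integrable_system M act Y \<longleftrightarrow>
     (\<forall>L. compact L \<longrightarrow> (\<integral>\<^sup>+ x. of_nat (card (hitting_set act Y x \<inter> L)) \<partial>M) < \<infinity>)"

definition transverse_measure ::
    "'g::topological_group_add measure \<Rightarrow> 'x measure \<Rightarrow> ('g \<Rightarrow> 'x \<Rightarrow> 'x) \<Rightarrow> 'x set \<Rightarrow>
     'x measure \<Rightarrow> bool" where
  "transverse_measure m M act Y \<nu> \<longleftrightarrow>
     sets \<nu> = sets (restrict_space M Y) \<and>
     sigma_finite_measure \<nu> \<and>
     (\<forall>f \<in> borel_measurable (restrict_space M Y). \<forall>w \<in> borel_measurable borel.
        (\<integral>\<^sup>+ g. w g \<partial>m) = 1 \<longrightarrow>
        (\<integral>\<^sup>+ y. f y \<partial>\<nu>) =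
        (\<integral>\<^sup>+ x. (\<integral>\<^sup>+ g. f (act g x) * w g \<partial>count_space (hitting_set act Y x)) \<partial>M))"

section \<open>Measurable bounded cohomology of measured groupoids\<close>

text \<open>
  Only the underlying measurable space of \<open>arrows\<close> is relevant; the measure of \<open>objects\<close> is the
  measure of the groupoid. The record carries the structure only, not the groupoid axioms.
\<close>

record ('o, 'a) measured_groupoid =
  objects :: "'o measure"
  arrows :: "'a measure"
  src :: "'a \<Rightarrow> 'o"
  tgt :: "'a \<Rightarrow> 'o"
  comp :: "'a \<Rightarrow> 'a \<Rightarrow> 'a"
  ginv :: "'a \<Rightarrow> 'a"

definition fibre :: "('o, 'a) measured_groupoid \<Rightarrow> 'o \<Rightarrow> 'a set" where
  "fibre G y = {\<gamma> \<in> space (arrows G). tgt G \<gamma> = y}"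

definition tuples :: "('o, 'a) measured_groupoid \<Rightarrow> nat \<Rightarrow> (nat \<Rightarrow> 'a) set" where
  "tuples G n = {\<gamma> \<in> {..<n} \<rightarrow>\<^sub>E space (arrows G). \<forall>i<n. tgt G (\<gamma> i) = tgt G (\<gamma> 0)}"

text \<open>
  \<open>tuple_measure G n\<close> integrates the counting measures on the \<open>n\<close>-fold powers of the fibres.
  It is meant for \<open>n \<ge> 1\<close> and for groupoids with countable fibres over a standard Borel space, where
  the integrand is measurable, so that the given set function is a measure.
\<close>

definition tuple_measure :: "('o, 'a) measured_groupoid \<Rightarrow> nat \<Rightarrow> (nat \<Rightarrow> 'a) measure" where
  "tuple_measure G n =
     measure_of (tuples G n)
       (sets (restrict_space (PiM {..<n} (\<lambda>_. arrows G)) (tuples G n)))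
       (\<lambda>A. \<integral>\<^sup>+ y. emeasure (count_space ({..<n} \<rightarrow>\<^sub>E fibre G y)) (A \<inter> ({..<n} \<rightarrow>\<^sub>E fibre G y))
            \<partial>objects G)"

text \<open>
  \<open>cochains G k\<close> consists of the representatives of the classes in degree \<open>k\<close>, which are functions
  of \<open>k + 1\<close> arrows. Functions equal almost everywhere are identified in \<open>cohomology\<close> below, since
  \<open>coboundaries\<close> contains all null functions.
\<close>

definition cochains :: "('o, 'a) measured_groupoid \<Rightarrow> nat \<Rightarrow> ((nat \<Rightarrow> 'a) \<Rightarrow> real) set" where
  "cochains G k =
     {f \<in> ess_bounded (tuple_measure G (Suc k)).
        AE \<gamma>s in tuple_measure G (Suc k).
          \<forall>\<gamma> \<in> space (arrows G). tgt G \<gamma> = tgt G (\<gamma>s 0) \<longrightarrow>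
            f (\<lambda>i\<in>{..<Suc k}. comp G (ginv G \<gamma>) (\<gamma>s i)) = f \<gamma>s}"

definition omit :: "nat \<Rightarrow> nat \<Rightarrow> (nat \<Rightarrow> 'a) \<Rightarrow> nat \<Rightarrow> 'a" where
  "omit n j \<gamma> = (\<lambda>i\<in>{..<n}. \<gamma> (if i < j then i else Suc i))"

definition differential :: "nat \<Rightarrow> ((nat \<Rightarrow> 'a) \<Rightarrow> real) \<Rightarrow> (nat \<Rightarrow> 'a) \<Rightarrow> real" where
  "differential k f \<gamma> = (\<Sum>j\<le>Suc k. (- 1) ^ j * f (omit (Suc k) j \<gamma>))"

definition cocycles :: "('o, 'a) measured_groupoid \<Rightarrow> nat \<Rightarrow> ((nat \<Rightarrow> 'a) \<Rightarrow> real) set" where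
  "cocycles G k =
     {f \<in> cochains G k. AE \<gamma> in tuple_measure G (Suc (Suc k)). differential k f \<gamma> = 0}"

fun coboundaries :: "('o, 'a) measured_groupoid \<Rightarrow> nat \<Rightarrow> ((nat \<Rightarrow> 'a) \<Rightarrow> real) set" where
  "coboundaries G 0 = {f \<in> cochains G 0. AE \<gamma> in tuple_measure G (Suc 0). f \<gamma> = 0}"
| "coboundaries G (Suc k) =
     {f \<in> cochains G (Suc k). \<exists>h \<in> cochains G k.
        AE \<gamma> in tuple_measure G (Suc (Suc k)). f \<gamma> = differential k h \<gamma>}"

definition cohomologous ::
    "('o, 'a) measured_groupoid \<Rightarrow> nat \<Rightarrow> (((nat \<Rightarrow> 'a) \<Rightarrow> real) \<times> ((nat \<Rightarrow> 'a) \<Rightarrow> real)) set" where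
  "cohomologous G k =
     {(f, f'). f \<in> cocycles G k \<and> f' \<in> cocycles G k \<and> (\<lambda>\<gamma>. f \<gamma> - f' \<gamma>) \<in> coboundaries G k}"

definition cohomology :: "('o, 'a) measured_groupoid \<Rightarrow> nat \<Rightarrow> ((nat \<Rightarrow> 'a) \<Rightarrow> real) set set" where
  "cohomology G k = cocycles G k // cohomologous G k"

definition boundedly_acyclic :: "('o, 'a) measured_groupoid \<Rightarrow> bool" where
  "boundedly_acyclic G \<longleftrightarrow> (\<forall>k>0. cohomology G k = {cohomologous G k `` {\<lambda>_. 0}})"

section \<open>The transverse groupoid\<close>

definition transverse_groupoid ::
    "'x measure \<Rightarrow> ('g::topological_group_add \<Rightarrow> 'x \<Rightarrow> 'x) \<Rightarrow> 'x set \<Rightarrow> 'x measure \<Rightarrow>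
     ('x, 'g \<times> 'x) measured_groupoid" where
  "transverse_groupoid M act Y \<nu> =
     \<lparr>objects = \<nu>,
      arrows = restrict_space (borel \<Otimes>\<^sub>M M) {(g, y). y \<in> Y \<and> act g y \<in> Y},
      src = snd,
      tgt = (\<lambda>(g, y). act g y),
      comp = (\<lambda>(g, z) (h, y). (g + h, y)),
      ginv = (\<lambda>(g, y). (- g, act g y))\<rparr>"

section \<open>The cohomology relation\<close>

lemma ess_bounded_lincomb:
  assumes "f \<in> ess_bounded M" "h \<in> ess_bounded M"
  shows "(\<lambda>x. f x + c * h x) \<in> ess_bounded M"
proof -
  obtain A where A: "AE x in M. \<bar>f x\<bar> \<le> A" using assms(1) by (auto simp: ess_bounded_def)
  obtain B where B: "AE x in M. \<bar>h x\<bar> \<le> B" using assms(2) by (auto simp: ess_bounded_def)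
  have "AE x in M. \<bar>f x + c * h x\<bar> \<le> A + \<bar>c\<bar> * B"
    using A B
  proof eventually_elim
    case (elim x)
    have "\<bar>f x + c * h x\<bar> \<le> \<bar>f x\<bar> + \<bar>c\<bar> * \<bar>h x\<bar>"
      by (metis abs_mult abs_triangle_ineq)
    also have "\<dots> \<le> A + \<bar>c\<bar> * B"
      by (intro add_mono mult_left_mono elim) auto
    finally show ?case .
  qed
  moreover have "(\<lambda>x. f x + c * h x) \<in> borel_measurable M"
    using assms by (auto simp: ess_bounded_def)
  ultimately show ?thesis by (auto simp: ess_bounded_def)
qed

lemma cochains_lincomb:
  assumes "f \<in> cochains G k" "h \<in> cochains G k"
  shows "(\<lambda>\<gamma>. f \<gamma> + c * h \<gamma>) \<in> cochains G k"
proof -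
  have "AE \<gamma>s in tuple_measure G (Suc k).
          \<forall>\<gamma> \<in> space (arrows G). tgt G \<gamma> = tgt G (\<gamma>s 0) \<longrightarrow>
            f (\<lambda>i\<in>{..<Suc k}. comp G (ginv G \<gamma>) (\<gamma>s i)) = f \<gamma>s"
       "AE \<gamma>s in tuple_measure G (Suc k).
          \<forall>\<gamma> \<in> space (arrows G). tgt G \<gamma> = tgt G (\<gamma>s 0) \<longrightarrow>
            h (\<lambda>i\<in>{..<Suc k}. comp G (ginv G \<gamma>) (\<gamma>s i)) = h \<gamma>s"
    using assms by (auto simp: cochains_def)
  then have "AE \<gamma>s in tuple_measure G (Suc k).
          \<forall>\<gamma> \<in> space (arrows G). tgt G \<gamma> = tgt G (\<gamma>s 0) \<longrightarrow>
            f (\<lambda>i\<in>{..<Suc k}. comp G (ginv G \<gamma>) (\<gamma>s i)) +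
            c * h (\<lambda>i\<in>{..<Suc k}. comp G (ginv G \<gamma>) (\<gamma>s i)) = f \<gamma>s + c * h \<gamma>s"
    by eventually_elim metis
  then show ?thesis
    using assms ess_bounded_lincomb unfolding cochains_def by blast
qed

lemma zero_in_cochains: "(\<lambda>_. 0) \<in> cochains G k"
  by (auto simp: cochains_def ess_bounded_def)

lemma differential_lincomb:
  "differential k (\<lambda>\<gamma>. f \<gamma> + c * h \<gamma>) \<gamma> = differential k f \<gamma> + c * differential k h \<gamma>"
  by (simp only: differential_def sum_distrib_left flip: sum.distrib)
     (simp add: algebra_simps)

lemma differential_zero: "differential k (\<lambda>_. 0) \<gamma> = 0"
  by (simp add: differential_def)

lemma zero_in_cocycles: "(\<lambda>_. 0) \<in> cocycles G k"
  by (simp add: cocycles_def zero_in_cochains differential_zero)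

lemma null_in_coboundaries:
  assumes "f \<in> cochains G k" "AE \<gamma> in tuple_measure G (Suc k). f \<gamma> = 0"
  shows "f \<in> coboundaries G k"
proof (cases k)
  case 0
  then show ?thesis using assms unfolding 0 by simp
next
  case (Suc m)
  then show ?thesis
    using assms zero_in_cochains[of G m]
    by (auto intro!: bexI[of _ "\<lambda>_. 0"] simp: differential_zero)
qed

lemma coboundaries_lincomb:
  assumes "f \<in> coboundaries G k" "h \<in> coboundaries G k"
  shows "(\<lambda>\<gamma>. f \<gamma> + c * h \<gamma>) \<in> coboundaries G k"
proof (cases k)
  case 0
  have "AE \<gamma> in tuple_measure G (Suc 0). f \<gamma> = 0" "AE \<gamma> in tuple_measure G (Suc 0). h \<gamma> = 0"
    using assms 0 by auto
  then have "AE \<gamma> in tuple_measure G (Suc 0). f \<gamma> + c * h \<gamma> = 0"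
    by eventually_elim simp
  then show ?thesis using assms 0 by (simp add: cochains_lincomb)
next
  case (Suc m)
  obtain a b where a: "a \<in> cochains G m"
      "AE \<gamma> in tuple_measure G (Suc (Suc m)). f \<gamma> = differential m a \<gamma>"
    and b: "b \<in> cochains G m"
      "AE \<gamma> in tuple_measure G (Suc (Suc m)). h \<gamma> = differential m b \<gamma>"
    using assms Suc by auto
  have "AE \<gamma> in tuple_measure G (Suc (Suc m)).
          f \<gamma> + c * h \<gamma> = differential m (\<lambda>\<gamma>. a \<gamma> + c * b \<gamma>) \<gamma>"
    using a(2) b(2) by eventually_elim (simp add: differential_lincomb)
  then show ?thesis
    using assms Suc cochains_lincomb[OF a(1) b(1), of c] by (auto simp: cochains_lincomb)
qed

lemma equiv_cohomologous: "equiv (cocycles G k) (cohomologous G k)"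
proof (rule equivI)
  show "cohomologous G k \<subseteq> cocycles G k \<times> cocycles G k"
    by (auto simp: cohomologous_def)
  show "refl_on (cocycles G k) (cohomologous G k)"
    by (auto simp: refl_on_def cohomologous_def intro!: null_in_coboundaries zero_in_cochains)
  have 0: "(\<lambda>_. 0) \<in> coboundaries G k"
    by (simp add: null_in_coboundaries zero_in_cochains)
  show "sym (cohomologous G k)"
  proof (rule symI)
    fix f f' assume "(f, f') \<in> cohomologous G k"
    then show "(f', f) \<in> cohomologous G k"
      using coboundaries_lincomb[OF 0, of "\<lambda>\<gamma>. f \<gamma> - f' \<gamma>" "-1"]
      by (auto simp: cohomologous_def)
  qed
  show "trans (cohomologous G k)"
  proof (rule transI)
    fix f f' f'' assume "(f, f') \<in> cohomologous G k" "(f', f'') \<in> cohomologous G k"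
    then show "(f, f'') \<in> cohomologous G k"
      using coboundaries_lincomb[of "\<lambda>\<gamma>. f \<gamma> - f' \<gamma>" G k "\<lambda>\<gamma>. f' \<gamma> - f'' \<gamma>" 1]
      by (auto simp: cohomologous_def)
  qed
qed

lemma cohomology_zero_iff:
  "cohomology G k = {cohomologous G k `` {\<lambda>_. 0}} \<longleftrightarrow> cocycles G k \<subseteq> coboundaries G k"
proof
  assume eq: "cohomology G k = {cohomologous G k `` {\<lambda>_. 0}}"
  show "cocycles G k \<subseteq> coboundaries G k"
  proof
    fix f assume f: "f \<in> cocycles G k"
    have "cohomologous G k `` {f} = cohomologous G k `` {\<lambda>_. 0}"
      using quotientI[OF f, of "cohomologous G k"] unfolding cohomology_def[symmetric] eq
      by (rule singletonD)
    then have "(f, \<lambda>_. 0) \<in> cohomologous G k"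
      using f zero_in_cocycles eq_equiv_class_iff[OF equiv_cohomologous] by blast
    then show "f \<in> coboundaries G k" by (simp add: cohomologous_def)
  qed
next
  assume sub: "cocycles G k \<subseteq> coboundaries G k"
  have "cohomologous G k `` {f} = cohomologous G k `` {\<lambda>_. 0}" if "f \<in> cocycles G k" for f
    using that sub zero_in_cocycles
    by (intro equiv_class_eq[OF equiv_cohomologous]) (auto simp: cohomologous_def)
  then show "cohomology G k = {cohomologous G k `` {\<lambda>_. 0}}"
    using zero_in_cocycles[of G k] unfolding cohomology_def quotient_def by blast
qed

end

theory Submission
  imports Defs
begin

text \<open>
  A tuple of arrows with common target \<open>y\<close> is the same as a tuple \<open>h\<close> of elements of the hitting
  set of \<open>y\<close>, so an invariant cochain \<open>f\<close> extends canonically to a function \<open>F x h\<close> of all points \<open>x\<close> of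
  the ambient space and all tuples \<open>h\<close> in the hitting set of \<open>x\<close>, invariant under the whole group. Let
  \<open>s x\<close> be a measurable choice of an element of the hitting set of \<open>x\<close>. Then \<open>s (-g x) - g\<close> lies in the
  hitting set of \<open>x\<close> for every \<open>g\<close>, and averaging \<open>F x (s (-g x) - g, h)\<close> over \<open>g\<close> with the invariant
  mean is a contracting homotopy. The mean is not countably additive, so the average is taken weakly:
  it is the Radon-Nikodym derivative of the measure that maps \<open>B\<close> to the mean of the integrals over \<open>B\<close>.
  On the ambient space each single group element moves the variable \<open>x\<close>, so that left invariance of the
  mean suffices, and Fubini upgrades the almost sure invariance to strict invariance. On the cross
  section itself the translating element would depend on the point, and one would need a
  topologically invariant mean.

  Sections of measurable sets over the cross section are handled with the measurable projection
  theorem up to null sets (Choquet capacitability), which yields a measurable enumeration of the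
  hitting sets almost everywhere.
\<close>

section \<open>Elementary sets and the Suslin operation\<close>

text \<open>If \<open>u\<close> is in the hitting set of \<open>x\<close>, the cocycle relation on
  the tuple with \<open>u\<close> in front of \<open>h\<close> writes \<open>F x h\<close> as the
  alternating sum of \<open>F x\<close> at \<open>u\<close> followed by \<open>h\<close> with entry
  \<open>j\<close> omitted. The left side does not contain \<open>u\<close>, so averaging over any
  family of such \<open>u\<close> keeps it. The family u(g, x) = s (-g x) - g satisfies u(a + g, a
  x) = u(g, x) - a: moving \<open>x\<close> by \<open>a\<close> shifts the tuple by \<open>a\<close>
  and translates \<open>g\<close> on the left, which the mean does not notice.

  The obstacle is the quantifier over tuples. A hitting set is countable, but it moves with
  \<open>x\<close>, and all group elements together give uncountably many tuples, so an almost
  everywhere statement for each fixed tuple would be worthless. A measurable enumeration replaces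
  tuples by countably many multi-indices, each of which carries a function of \<open>x\<close>
  alone; their exceptional null sets can then be united.

  A second use of translations is on the right: a strictly invariant version of the average looks
  along the orbit of \<open>x\<close>, and passing to another point of the orbit is a right
  translation of the parameter.\<close>

inductive_set elementary :: "'x measure \<Rightarrow> ('g::topological_space \<times> 'x) set set" for M where
  rect: "compact C \<Longrightarrow> E \<in> sets M \<Longrightarrow> C \<times> E \<in> elementary M"
| Un: "A \<in> elementary M \<Longrightarrow> B \<in> elementary M \<Longrightarrow> A \<union> B \<in> elementary M"

lemma elementary_empty: "{} \<in> elementary M"
  using elementary.rect[of "{}" "{}" M] by simp

lemma elementary_Int:
  fixes A :: "('g::t2_space \<times> 'x) set"
  assumes "A \<in> elementary M" "B \<in> elementary M"
  shows "A \<inter> B \<in> elementary M"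
  using assms
proof (induction A)
  case (rect C E)
  from rect(3) show ?case
  proof (induction B)
    case (rect C' E')
    have "(C \<times> E) \<inter> (C' \<times> E') = (C \<inter> C') \<times> (E \<inter> E')" by auto
    then show ?case
      using rect \<open>compact C\<close> \<open>E \<in> sets M\<close> by (auto intro!: elementary.rect compact_Int)
  next
    case (Un A B)
    then show ?case by (simp add: Int_Un_distrib elementary.Un)
  qed
next
  case (Un A B)
  then show ?case by (simp add: Int_Un_distrib2 elementary.Un)
qed

lemma elementary_UN: "finite I \<Longrightarrow> (\<And>i. i \<in> I \<Longrightarrow> A i \<in> elementary M) \<Longrightarrow> (\<Union>i\<in>I. A i) \<in> elementary M"
  by (induction I rule: finite_induct) (auto intro: elementary_empty elementary.Un)

lemma elementary_INT:
  fixes A :: "'i \<Rightarrow> ('g::t2_space \<times> 'x) set"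
  shows "finite I \<Longrightarrow> I \<noteq> {} \<Longrightarrow> (\<And>i. i \<in> I \<Longrightarrow> A i \<in> elementary M) \<Longrightarrow> (\<Inter>i\<in>I. A i) \<in> elementary M"
  by (induction I rule: finite_ne_induct) (auto intro: elementary_Int)

lemma elementary_section: "A \<in> elementary M \<Longrightarrow> compact {g. (g, x) \<in> A}"
proof (induction rule: elementary.induct)
  case (rect C E)
  then show ?case by (cases "x \<in> E") auto
next
  case (Un A B)
  have "{g. (g, x) \<in> A \<union> B} = {g. (g, x) \<in> A} \<union> {g. (g, x) \<in> B}" by auto
  then show ?case using Un by (simp add: compact_Un)
qed

lemma elementary_snd_image: "A \<in> elementary M \<Longrightarrow> snd ` A \<in> sets M"
proof (induction rule: elementary.induct)
  case (rect C E)
  then show ?case by (cases "C = {}") auto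
qed (simp add: image_Un)

text \<open>For fixed \<open>x\<close> the sections form a decreasing sequence of nonempty compact
  sets and hence share a point. This is the reason for the compact factor in the rectangles:
  projections of arbitrary decreasing intersections can be smaller.\<close>

lemma snd_image_INT_elementary:
  fixes A :: "nat \<Rightarrow> ('g::t2_space \<times> 'x) set"
  assumes "\<And>n. A n \<in> elementary M" "decseq A"
  shows "snd ` (\<Inter>n. A n) = (\<Inter>n. snd ` A n)"
proof (intro antisym subsetI)
  fix x assume x: "x \<in> (\<Inter>n. snd ` A n)"
  define S where "S n = {g. (g, x) \<in> A n}" for n
  have compact: "compact (S n)" for n unfolding S_def by (rule elementary_section[OF assms(1)])
  have "S n \<noteq> {}" for n using x by (force simp: S_def)
  have anti: "S n \<subseteq> S m" if "m \<le> n" for m n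
    using decseqD[OF assms(2) that] by (auto simp: S_def)
  have "S 0 \<inter> (\<Inter>n\<in>UNIV. S n) \<noteq> {}"
  proof (rule compact_imp_fip_image)
    show "compact (S 0)" "closed (S n)" for n
      using compact compact_imp_closed by auto
    fix I :: "nat set" assume I: "finite I"
    have "S (Max (insert 0 I)) \<subseteq> S n" if "n \<in> insert 0 I" for n
      using anti[of n "Max (insert 0 I)"] I that by simp
    then have "S (Max (insert 0 I)) \<subseteq> S 0 \<inter> (\<Inter>n\<in>I. S n)"
      by (simp add: INT_greatest)
    then show "S 0 \<inter> (\<Inter>n\<in>I. S n) \<noteq> {}"
      using \<open>\<And>n. S n \<noteq> {}\<close> by blast
  qed
  then obtain g where "\<And>n. (g, x) \<in> A n" by (auto simp: S_def)
  then show "x \<in> snd ` (\<Inter>n. A n)" by force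
qed auto

text \<open>\<open>E\<close> is a Suslin scheme on finite sequences, and a point belongs to the
  result if it stays in the scheme along some infinite branch. The scheme need not decrease along
  branches; the capacity argument intersects over initial segments instead.\<close>

definition suslin :: "'a set set \<Rightarrow> 'a set set" where
  "suslin \<E> = {A. \<exists>E :: nat list \<Rightarrow> 'a set. (\<forall>s. E s \<in> \<E>) \<and>
     A = {p. \<exists>\<sigma>. \<forall>n. p \<in> E (map \<sigma> [0..<n])}}"

lemma suslinI:
  fixes E :: "nat list \<Rightarrow> 'a set"
  shows "(\<And>s. E s \<in> \<E>) \<Longrightarrow> (\<And>p. p \<in> A \<longleftrightarrow> (\<exists>\<sigma>. \<forall>n. p \<in> E (map \<sigma> [0..<n]))) \<Longrightarrow> A \<in> suslin \<E>"
  unfolding suslin_def by (intro CollectI exI[of _ E] conjI set_eqI) simp_all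

lemma suslin_base: "A \<in> \<E> \<Longrightarrow> A \<in> suslin \<E>"
  by (rule suslinI[of "\<lambda>_. A"]) auto

text \<open>The first entry of a branch selects a member of the union, and the rest is a branch of
  its scheme. At the empty sequence nothing is selected yet, which is why an upper bound
  \<open>T\<close> inside the family is required.\<close>

lemma suslin_UN:
  fixes A :: "nat \<Rightarrow> 'a set"
  assumes "\<And>i. A i \<in> suslin \<E>" "T \<in> \<E>" "\<And>E. E \<in> \<E> \<Longrightarrow> E \<subseteq> T"
  shows "(\<Union>i. A i) \<in> suslin \<E>"
proof -
  have "\<exists>E :: nat list \<Rightarrow> 'a set. (\<forall>s. E s \<in> \<E>) \<and> A i = {p. \<exists>\<sigma>. \<forall>n. p \<in> E (map \<sigma> [0..<n])}" for i
    using assms(1)[of i] unfolding suslin_def by (rule CollectD)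
  from choice[OF allI[OF this]] obtain E :: "nat \<Rightarrow> nat list \<Rightarrow> 'a set" where
    "\<forall>i. (\<forall>s. E i s \<in> \<E>) \<and> A i = {p. \<exists>\<sigma>. \<forall>n. p \<in> E i (map \<sigma> [0..<n])}"
    by (rule exE)
  then have E: "\<And>i s. E i s \<in> \<E>" "\<And>i. A i = {p. \<exists>\<sigma>. \<forall>n. p \<in> E i (map \<sigma> [0..<n])}"
    by simp_all
  show ?thesis
  proof (rule suslinI[of "\<lambda>s. case s of [] \<Rightarrow> T | i # s \<Rightarrow> E i s"])
    show "(case s of [] \<Rightarrow> T | i # s \<Rightarrow> E i s) \<in> \<E>" for s
      using assms(2) E(1) by (cases s) auto
    fix p
    have map: "map \<sigma> [0..<Suc n] = \<sigma> 0 # map (\<lambda>k. \<sigma> (Suc k)) [0..<n]" for \<sigma> :: "nat \<Rightarrow> nat" and n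
      by (simp add: upt_conv_Cons map_Suc_upt[symmetric] del: upt_Suc)
    show "p \<in> (\<Union>i. A i) \<longleftrightarrow>
      (\<exists>\<sigma>. \<forall>n. p \<in> (case map \<sigma> [0..<n] of [] \<Rightarrow> T | i # s \<Rightarrow> E i s))" (is "_ \<longleftrightarrow> ?R")
    proof
      assume "p \<in> (\<Union>i. A i)"
      then obtain i \<sigma> where *: "\<And>n. p \<in> E i (map \<sigma> [0..<n])" using E(2) by auto
      have "p \<in> (case map (case_nat i \<sigma>) [0..<n] of [] \<Rightarrow> T | i # s \<Rightarrow> E i s)" for n
      proof (cases n)
        case 0
        then show ?thesis using * E(1) assms(3) by force
      next
        case (Suc k)
        then show ?thesis using *[of k] by (simp add: map del: upt_Suc)
      qed
      then show ?R by blast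
    next
      assume ?R
      then obtain \<sigma> where *: "\<And>n. p \<in> (case map \<sigma> [0..<n] of [] \<Rightarrow> T | i # s \<Rightarrow> E i s)" by blast
      have "p \<in> E (\<sigma> 0) (map (\<lambda>k. \<sigma> (Suc k)) [0..<n])" for n
        using *[of "Suc n"] by (simp add: map del: upt_Suc)
      then show "p \<in> (\<Union>i. A i)" using E(2) by auto
    qed
  qed
qed

text \<open>One branch codes a sequence of branches: its entry at \<open>prod_encode (j, i)\<close>
  is entry \<open>j\<close> of branch \<open>i\<close>. At length \<open>prod_encode (n, i)\<close>
  the first \<open>n\<close> entries of branch \<open>i\<close> are already known, because the
  pairing function increases strictly in its first argument.\<close>

lemma suslin_INT:
  fixes A :: "nat \<Rightarrow> 'a set"
  assumes "\<And>i. A i \<in> suslin \<E>"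
  shows "(\<Inter>i. A i) \<in> suslin \<E>"
proof -
  have "\<exists>E :: nat list \<Rightarrow> 'a set. (\<forall>s. E s \<in> \<E>) \<and> A i = {p. \<exists>\<sigma>. \<forall>n. p \<in> E (map \<sigma> [0..<n])}" for i
    using assms(1)[of i] unfolding suslin_def by (rule CollectD)
  from choice[OF allI[OF this]] obtain E :: "nat \<Rightarrow> nat list \<Rightarrow> 'a set" where
    "\<forall>i. (\<forall>s. E i s \<in> \<E>) \<and> A i = {p. \<exists>\<sigma>. \<forall>n. p \<in> E i (map \<sigma> [0..<n])}"
    by (rule exE)
  then have E: "\<And>i s. E i s \<in> \<E>" "\<And>i. A i = {p. \<exists>\<sigma>. \<forall>n. p \<in> E i (map \<sigma> [0..<n])}"
    by simp_all
  define E' where "E' s = (case prod_decode (length s) of (n, i) \<Rightarrow>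
      E i (map (\<lambda>j. s ! prod_encode (j, i)) [0..<n]))" for s
  have mono: "prod_encode (j, i) < prod_encode (n, i)" if "j < n" for i j n
  proof -
    have "triangle (j + i) \<le> triangle (n + i)"
      unfolding triangle_def using that by (intro div_le_mono mult_le_mono) auto
    then show ?thesis using that by (simp add: prod_encode_def)
  qed
  have E': "E' (map \<sigma> [0..<prod_encode (n, i)]) = E i (map (\<lambda>j. \<sigma> (prod_encode (j, i))) [0..<n])"
    for \<sigma> n i
    unfolding E'_def by (auto simp: mono intro!: arg_cong[where f = "E i"])
  show ?thesis
  proof (rule suslinI[of E'])
    show "E' s \<in> \<E>" for s using E(1) by (simp add: E'_def split: prod.split)
    fix p
    show "p \<in> (\<Inter>i. A i) \<longleftrightarrow> (\<exists>\<sigma>. \<forall>n. p \<in> E' (map \<sigma> [0..<n]))" (is "_ \<longleftrightarrow> ?R")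
    proof
      assume "p \<in> (\<Inter>i. A i)"
      then have "\<forall>i. \<exists>\<sigma>. \<forall>n. p \<in> E i (map \<sigma> [0..<n])" using E(2) by auto
      then obtain \<sigma> where \<sigma>: "\<And>i n. p \<in> E i (map (\<sigma> i) [0..<n])" by metis
      define \<tau> where "\<tau> k = (case prod_decode k of (j, i) \<Rightarrow> \<sigma> i j)" for k
      have "p \<in> E' (map \<tau> [0..<k])" for k
      proof -
        obtain n i where k: "k = prod_encode (n, i)" by (metis prod_decode_inverse surj_pair)
        show ?thesis using \<sigma>[of i n] unfolding k E' by (simp add: \<tau>_def)
      qed
      then show ?R by blast
    next
      assume ?R
      then obtain \<sigma> where "\<And>n. p \<in> E' (map \<sigma> [0..<n])" by blast
      then have "p \<in> E i (map (\<lambda>j. \<sigma> (prod_encode (j, i))) [0..<n])" for n i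
        by (metis E')
      then show "p \<in> (\<Inter>i. A i)" using E(2) by auto
    qed
  qed
qed

text \<open>Koenig's lemma. A sequence is \<open>good\<close> if it has admissible extensions of
  every length. The bound \<open>b\<close> leaves finitely many values for the next entry; if all of
  them failed, they would fail together at the largest of the levels \<open>k i\<close>,
  contradicting that the sequence is good.\<close>

lemma bounded_tree_branch:
  fixes P :: "nat list \<Rightarrow> bool" and b :: "nat \<Rightarrow> nat"
  assumes ex: "\<And>k. \<exists>\<sigma>. (\<forall>i<k. \<sigma> i \<le> b i) \<and> (\<forall>n\<le>k. P (map \<sigma> [0..<n]))"
  shows "\<exists>\<sigma>. \<forall>n. P (map \<sigma> [0..<n])"
proof -
  define good where "good s \<longleftrightarrow> (\<forall>k\<ge>length s. \<exists>\<sigma>. map \<sigma> [0..<length s] = s \<and>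
    (\<forall>i<k. \<sigma> i \<le> b i) \<and> (\<forall>n\<le>k. P (map \<sigma> [0..<n])))" for s
  have "good []" using ex by (simp add: good_def)
  have step: "\<exists>i. good (s @ [i])" if "good s" for s
  proof (rule ccontr)
    assume "\<not> ?thesis"
    then have "\<forall>i. \<exists>k\<ge>Suc (length s). \<not> (\<exists>\<sigma>. map \<sigma> [0..<Suc (length s)] = s @ [i] \<and>
      (\<forall>i<k. \<sigma> i \<le> b i) \<and> (\<forall>n\<le>k. P (map \<sigma> [0..<n])))"
      unfolding good_def by (simp del: upt_Suc)
    then obtain k where k: "\<And>i. k i \<ge> Suc (length s)"
      "\<And>i. \<not> (\<exists>\<sigma>. map \<sigma> [0..<Suc (length s)] = s @ [i] \<and>
      (\<forall>j<k i. \<sigma> j \<le> b j) \<and> (\<forall>n\<le>k i. P (map \<sigma> [0..<n])))" by metis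
    define K where "K = Max (k ` {..b (length s)})"
    have K: "k i \<le> K" if "i \<le> b (length s)" for i using that by (auto simp: K_def)
    have "K \<ge> Suc (length s)" using k(1)[of 0] K[of 0] by simp
    then obtain \<sigma> where \<sigma>: "map \<sigma> [0..<length s] = s" "\<And>i. i < K \<Longrightarrow> \<sigma> i \<le> b i"
      "\<And>n. n \<le> K \<Longrightarrow> P (map \<sigma> [0..<n])"
      using \<open>good s\<close> unfolding good_def by (meson Suc_leD)
    let ?i = "\<sigma> (length s)"
    have "?i \<le> b (length s)" using \<sigma>(2) \<open>K \<ge> _\<close> by simp
    then have "k ?i \<le> K" by (rule K)
    then have "map \<sigma> [0..<Suc (length s)] = s @ [?i] \<and>
        (\<forall>j<k ?i. \<sigma> j \<le> b j) \<and> (\<forall>n\<le>k ?i. P (map \<sigma> [0..<n]))"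
      using \<sigma> by simp
    then show False using k(2)[of ?i] by blast
  qed
  define s where "s = rec_nat [] (\<lambda>_ s. s @ [SOME i. good (s @ [i])])"
  have s: "s 0 = []" "\<And>n. s (Suc n) = s n @ [SOME i. good (s n @ [i])]" by (auto simp: s_def)
  have good: "good (s n)" for n
    by (induction n) (auto simp: s \<open>good []\<close> intro!: someI_ex step)
  have len: "length (s n) = n" for n by (induction n) (auto simp: s)
  define \<sigma> where "\<sigma> n = s (Suc n) ! n" for n
  have "map \<sigma> [0..<n] = s n" for n
  proof (induction n)
    case (Suc n)
    then show ?case by (simp add: \<sigma>_def s nth_append len)
  qed (simp add: s)
  moreover have "P (s n)" for n
  proof -
    obtain \<tau> where "map \<tau> [0..<n] = s n" "P (map \<tau> [0..<n])"
      using good[of n] unfolding good_def len by blast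
    then show ?thesis by simp
  qed
  ultimately show ?thesis by metis
qed

section \<open>Measurable projections up to null sets\<close>

text \<open>
  Choquet's capacitability argument: bounding the branches one coordinate at a time costs arbitrarily
  little outer measure, and the projection commutes with the decreasing intersection of the elementary
  sets that approximate the bounded branches.
\<close>

lemma elementary_capacity:
  fixes A :: "('g::t2_space \<times> 'x) set"
  assumes "finite_measure M" and A: "A \<in> suslin (elementary M)"
    and t: "t < outer_measure_of M (snd ` A)"
  shows "\<exists>Q\<in>sets M. Q \<subseteq> snd ` A \<and> t \<le> emeasure M Q"
proof -
  interpret finite_measure M by fact
  obtain E :: "nat list \<Rightarrow> ('g \<times> 'x) set" where E: "\<And>s. E s \<in> elementary M"
    and A_eq: "A = {p. \<exists>\<sigma>. \<forall>n. p \<in> E (map \<sigma> [0..<n])}"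
    using A unfolding suslin_def mem_Collect_eq by blast
  \<comment> \<open>Only the first \<open>k\<close> entries of the branch are bounded, so
    \<open>B b 0\<close> is all of \<open>A\<close>, and each further bound is imposed by one
    step.\<close>
  define B where "B b k = {p. \<exists>\<sigma>. (\<forall>i<k. \<sigma> i \<le> b i) \<and> (\<forall>n. p \<in> E (map \<sigma> [0..<n]))}"
    for b :: "nat \<Rightarrow> nat" and k
  have E_space: "snd ` E s \<subseteq> space M" for s
    using elementary_snd_image[OF E] sets.sets_into_space by blast
  have B_space: "snd ` B b k \<subseteq> space M" for b k
  proof -
    have "B b k \<subseteq> E []" by (auto simp: B_def dest: spec[of _ 0])
    then show ?thesis using E_space[of "[]"] by blast
  qed
  have step: "\<exists>b'. t < outer_measure_of M (snd ` B b' (Suc k)) \<and> (\<forall>i<k. b' i = b i)"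
    if "t < outer_measure_of M (snd ` B b k)" for b k
  proof -
    let ?b = "\<lambda>j. b(k := j)"
    have "snd ` B b k = (\<Union>j. snd ` B (?b j) (Suc k))"
    proof -
      have "B b k = (\<Union>j. B (?b j) (Suc k))"
        by (auto simp: B_def less_Suc_eq)
      then show ?thesis by (simp add: image_UN)
    qed
    moreover have "incseq (\<lambda>j. snd ` B (?b j) (Suc k))"
      unfolding B_def by (intro monoI image_mono Collect_mono impI ex_mono conj_mono) (auto simp: less_Suc_eq)
    \<comment> \<open>Outer measure is continuous along increasing sequences of arbitrary sets, so a
      large enough bound \<open>j\<close> for entry \<open>k\<close> keeps it above
      \<open>t\<close>, although the projections are not known to be measurable.\<close>
    ultimately have "t < (SUP j. outer_measure_of M (snd ` B (?b j) (Suc k)))"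
      using that SUP_outer_measure_of_incseq[of "\<lambda>j. snd ` B (?b j) (Suc k)" M] B_space by simp
    then obtain j where "t < outer_measure_of M (snd ` B (?b j) (Suc k))"
      unfolding less_SUP_iff by blast
    then show ?thesis by (intro exI[of _ "?b j"]) simp
  qed
  have "\<exists>f. \<forall>n. t < outer_measure_of M (snd ` B (f n) n) \<and> (\<forall>i<n. f (Suc n) i = f n i)"
  proof (rule dependent_nat_choice)
    have "B b 0 = A" for b by (simp add: B_def A_eq)
    then show "\<exists>b. t < outer_measure_of M (snd ` B b 0)" using t by simp
  qed (use step in blast)
  then obtain f where f: "\<And>n. t < outer_measure_of M (snd ` B (f n) n)"
    "\<And>n i. i < n \<Longrightarrow> f (Suc n) i = f n i" by blast
  \<comment> \<open>The diagonal of the successive bounds; later bounds do not change earlier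
    entries, so \<open>b\<close> agrees with \<open>f n\<close> below \<open>n\<close>.\<close>
  define b where "b i = f (Suc i) i" for i
  have b: "f n i = b i" if "i < n" for n i
    using that
  proof (induction n)
    case (Suc n)
    then show ?case by (cases "i = n") (auto simp: b_def f(2))
  qed simp
  \<comment> \<open>Only the bounded values below \<open>k\<close> matter, so this is a finite union
    of finite intersections and therefore elementary. It contains \<open>B (f k) k\<close>, whose
    projection has outer measure above \<open>t\<close>.\<close>
  define K where "K k = (\<Union>\<sigma>\<in>PiE {..<k} (\<lambda>i. {..b i}). \<Inter>n\<in>{..k}. E (map \<sigma> [0..<n]))" for k
  have K_iff: "p \<in> K k \<longleftrightarrow> (\<exists>\<sigma>. (\<forall>i<k. \<sigma> i \<le> b i) \<and> (\<forall>n\<le>k. p \<in> E (map \<sigma> [0..<n])))" (is "_ \<longleftrightarrow> ?R")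
    for p k
  proof
    assume "p \<in> K k"
    then show ?R by (auto simp: K_def)
  next
    assume ?R
    then obtain \<sigma> where \<sigma>: "\<And>i. i < k \<Longrightarrow> \<sigma> i \<le> b i" "\<And>n. n \<le> k \<Longrightarrow> p \<in> E (map \<sigma> [0..<n])" by blast
    have "map (restrict \<sigma> {..<k}) [0..<n] = map \<sigma> [0..<n]" if "n \<le> k" for n
      using that by (intro map_cong) auto
    then have "p \<in> (\<Inter>n\<in>{..k}. E (map (restrict \<sigma> {..<k}) [0..<n]))"
      using \<sigma>(2) by (intro INT_I) (metis atMost_iff)
    then show "p \<in> K k"
      unfolding K_def using \<sigma>(1) by (intro UN_I[of "restrict \<sigma> {..<k}"]) simp_all
  qed
  have K: "K k \<in> elementary M" for k
    unfolding K_def by (intro elementary_UN elementary_INT finite_PiE E) auto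
  have decseq: "decseq K"
    unfolding decseq_def by (auto simp: K_iff) (meson le_trans less_le_trans)
  have "(\<Inter>k. K k) \<subseteq> A"
    using bounded_tree_branch[of b "\<lambda>s. _ \<in> E s"] by (auto simp: K_iff A_eq)
  then have "snd ` (\<Inter>k. K k) \<subseteq> snd ` A" by (rule image_mono)
  moreover have "snd ` (\<Inter>k. K k) = (\<Inter>k. snd ` K k)"
    by (rule snd_image_INT_elementary[OF K decseq])
  moreover have "t \<le> emeasure M (\<Inter>k. snd ` K k)"
  proof -
    have "t \<le> emeasure M (snd ` K k)" for k
    proof -
      have "B (f k) k \<subseteq> K k"
      proof
        fix p assume "p \<in> B (f k) k"
        then obtain \<sigma> where "\<forall>i<k. \<sigma> i \<le> b i" "\<forall>n. p \<in> E (map \<sigma> [0..<n])"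
          by (auto simp: B_def b)
        then show "p \<in> K k" unfolding K_iff by blast
      qed
      then have "outer_measure_of M (snd ` B (f k) k) \<le> outer_measure_of M (snd ` K k)"
        by (intro outer_measure_of_mono image_mono)
      then show ?thesis using f(1)[of k] elementary_snd_image[OF K] by simp
    qed
    then have "t \<le> (INF k. emeasure M (snd ` K k))" by (rule INF_greatest)
    also have "\<dots> = emeasure M (\<Inter>k. snd ` K k)"
      using elementary_snd_image[OF K] decseq
      by (intro INF_emeasure_decseq) (auto simp: decseq_def image_mono)
    finally show ?thesis .
  qed
  ultimately show ?thesis
    using elementary_snd_image[OF K]
    by (intro bexI[of _ "\<Inter>k. snd ` K k"] conjI sets.countable_INT') auto
qed

text \<open>The projection is squeezed between a measurable hull \<open>U\<close> of the same outer
  measure and measurable subsets \<open>Q n\<close> whose measures come within any margin of that of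
  \<open>U\<close>. Finiteness of the measure turns equality of measures into a null
  difference.\<close>

lemma suslin_elementary_snd_image:
  fixes A :: "('g::t2_space \<times> 'x) set"
  assumes "finite_measure M" and A: "A \<in> suslin (elementary M)"
  shows "\<exists>P\<in>sets M. AE x in M. x \<in> P \<longleftrightarrow> x \<in> snd ` A"
proof -
  interpret finite_measure M by fact
  obtain E :: "nat list \<Rightarrow> ('g \<times> 'x) set" where E: "\<And>s. E s \<in> elementary M"
    and A_eq: "A = {p. \<exists>\<sigma>. \<forall>n. p \<in> E (map \<sigma> [0..<n])}"
    using A unfolding suslin_def mem_Collect_eq by blast
  have "A \<subseteq> E []" unfolding A_eq by (auto dest: spec[of _ 0])
  then have "snd ` A \<subseteq> space M"
    using elementary_snd_image[OF E[of "[]"]] sets.sets_into_space by blast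
  then obtain U where U: "U \<in> sets M" "snd ` A \<subseteq> U" "outer_measure_of M (snd ` A) = emeasure M U"
    using outer_measure_of_attain by metis
  have "\<exists>Q\<in>sets M. Q \<subseteq> snd ` A \<and> emeasure M U \<le> emeasure M Q + ennreal (inverse (real (Suc n)))" for n
  proof (cases "emeasure M U = 0")
    case False
    have "emeasure M U - ennreal (inverse (real (Suc n))) < emeasure M U"
      using False emeasure_finite[of U]
      by (intro ennreal_between) (auto simp: less_top[symmetric] zero_less_iff_neq_zero)
    then obtain Q where "Q\<in>sets M" "Q \<subseteq> snd ` A" "emeasure M U - ennreal (inverse (real (Suc n))) \<le> emeasure M Q"
      using elementary_capacity[OF assms] U(3) by metis
    then show ?thesis by (intro bexI[of _ Q]) (auto simp: ennreal_minus_le_iff add.commute)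
  qed (auto intro!: bexI[of _ "{}"])
  then obtain Q where Q: "\<And>n. Q n \<in> sets M" "\<And>n. Q n \<subseteq> snd ` A"
    "\<And>n. emeasure M U \<le> emeasure M (Q n) + ennreal (inverse (real (Suc n)))" by metis
  define P where "P = (\<Union>n. Q n)"
  have P: "P \<in> sets M" "P \<subseteq> snd ` A" using Q by (auto simp: P_def)
  have "emeasure M U \<le> emeasure M P + ennreal (inverse (real (Suc n)))" for n
    by (rule order_trans[OF Q(3)[of n]]) (auto simp: P_def Q(1) intro!: emeasure_mono)
  note le = this
  have "emeasure M U \<le> emeasure M P"
  proof (rule ennreal_le_epsilon)
    fix e :: real assume "0 < e"
    then obtain n where "inverse (real (Suc n)) < e" using reals_Archimedean by blast
    then have "emeasure M P + ennreal (inverse (real (Suc n))) \<le> emeasure M P + ennreal e"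
      by (intro add_left_mono ennreal_leI) simp
    with le[of n] show "emeasure M U \<le> emeasure M P + ennreal e" by (rule order_trans)
  qed
  moreover have "emeasure M (U - P) = emeasure M U - emeasure M P"
    using P U by (intro emeasure_Diff) auto
  ultimately have "emeasure M (U - P) = 0"
    by (simp add: diff_eq_0_iff_ennreal less_top[symmetric])
  then have "AE x in M. x \<notin> U - P" using U P by (intro AE_not_in) (auto simp: null_sets_def)
  then have "AE x in M. x \<in> P \<longleftrightarrow> x \<in> snd ` A"
    by eventually_elim (use U P in auto)
  with P show ?thesis by blast
qed


section \<open>Compact exhaustions and Suslin representations of measurable sets in the
  product\<close>

lemma locally_compact_nbhd:
  fixes x :: "'g::t2_space"
  assumes "locally_compact_space (euclidean :: 'g topology)" "open U" "x \<in> U"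
  shows "\<exists>V K. open V \<and> compact K \<and> x \<in> V \<and> V \<subseteq> K \<and> K \<subseteq> U"
proof -
  have "Hausdorff_space (euclidean :: 'g topology)"
    by (simp add: Hausdorff_space_def disjnt_def) (metis separation_t2)
  then have "neighbourhood_base_of (compactin (euclidean :: 'g topology)) euclidean"
    using assms(1) locally_compact_space_neighbourhood_base by blast
  then show ?thesis
    using assms(2,3) unfolding neighbourhood_base_of by simp
qed

text \<open>The basic sets that have a compact superset inside \<open>U\<close> are countably many,
  and by local compactness they already cover \<open>U\<close>.\<close>

lemma locally_compact_open_sigma_compact:
  fixes U :: "'g::{t2_space, second_countable_topology} set"
  assumes lc: "locally_compact_space (euclidean :: 'g topology)" and "open U"
  shows "\<exists>K :: nat \<Rightarrow> 'g set. (\<forall>n. compact (K n)) \<and> U = (\<Union>n. K n)"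
proof -
  obtain B :: "'g set set" where B: "countable B" "topological_basis B"
    using ex_countable_basis by blast
  define C where "C = {b \<in> B. \<exists>K. compact K \<and> b \<subseteq> K \<and> K \<subseteq> U}"
  have "\<forall>b\<in>C. \<exists>K. compact K \<and> b \<subseteq> K \<and> K \<subseteq> U" by (simp add: C_def)
  from bchoice[OF this] obtain K where "\<forall>b\<in>C. compact (K b) \<and> b \<subseteq> K b \<and> K b \<subseteq> U"
    by (rule exE)
  then have K: "\<And>b. b \<in> C \<Longrightarrow> compact (K b) \<and> b \<subseteq> K b \<and> K b \<subseteq> U" by simp
  have "U \<subseteq> (\<Union>b\<in>C. K b)"
  proof
    fix x assume "x \<in> U"
    then obtain V L where V: "open V" "compact L" "x \<in> V" "V \<subseteq> L" "L \<subseteq> U"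
      using locally_compact_nbhd[OF lc \<open>open U\<close> \<open>x \<in> U\<close>] by metis
    obtain b where b: "b \<in> B" "x \<in> b" "b \<subseteq> V"
      using topological_basisE[OF B(2) V(1,3)] by blast
    have "b \<subseteq> L" using b V by (meson subset_trans)
    then have "b \<in> C" using V b(1) unfolding C_def by blast
    with K[OF this] b(2) show "x \<in> (\<Union>b\<in>C. K b)" by (meson UN_I subsetD)
  qed
  then have U: "U = (\<Union>b\<in>C. K b)" using K by blast
  have "countable C" using B(1) by (simp add: C_def)
  show ?thesis
  proof (cases "C = {}")
    case True
    then show ?thesis using U by (intro exI[of _ "\<lambda>_. {}"]) simp
  next
    case False
    then have "U = (\<Union>n. K (from_nat_into C n))"
      using range_from_nat_into[OF False \<open>countable C\<close>] U by (metis image_image)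
    then show ?thesis
      using K False by (intro exI[of _ "\<lambda>n. K (from_nat_into C n)"]) (simp add: from_nat_into)
  qed
qed

text \<open>Suslin sets are not closed under complements, so \<open>\<S>\<close> requires the Suslin
  property of the trace on the box \<open>T\<close> and of its complement in \<open>T\<close> at
  once; it is then a \<sigma>-algebra. Open cylinders belong to it since an open set is a countable
  union of compact sets and \<open>K - U\<close> is compact. Working over a compact \<open>K\<close>
  makes \<open>T\<close> the largest elementary set in play, as the union lemma demands.\<close>

lemma suslin_pair_measure:
  fixes A :: "('g::{t2_space, second_countable_topology} \<times> 'x) set"
  assumes lc: "locally_compact_space (euclidean :: 'g topology)"
    and K: "compact K" and A: "A \<in> sets (borel \<Otimes>\<^sub>M M)"
  shows "A \<inter> K \<times> space M \<in> suslin (elementary M)"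
proof -
  define T where "T = K \<times> space M"
  define \<E> where "\<E> = {E \<in> elementary M. E \<subseteq> T}"
  define \<S> where "\<S> = {A. A \<inter> T \<in> suslin \<E> \<and> T - A \<in> suslin \<E>}"
  have T: "T \<in> \<E>" using K by (auto simp: T_def \<E>_def intro: elementary.rect)
  have \<E>: "E \<subseteq> T" if "E \<in> \<E>" for E using that by (simp add: \<E>_def)
  have compl: "- A \<in> \<S>" if "A \<in> \<S>" for A
  proof -
    have "- A \<inter> T = T - A" "T - - A = A \<inter> T" by auto
    with that show ?thesis by (simp add: \<S>_def)
  qed
  have UN: "(\<Union>i. A i) \<in> \<S>" if "\<And>i. A i \<in> \<S>" for A :: "nat \<Rightarrow> _"
  proof -
    have "(\<Union>i. A i) \<inter> T = (\<Union>i. A i \<inter> T)" "T - (\<Union>i. A i) = (\<Inter>i. T - A i)" by auto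
    then show ?thesis
      using that suslin_UN[of "\<lambda>i. A i \<inter> T" \<E> T] suslin_INT[of "\<lambda>i. T - A i" \<E>] T \<E>
      by (simp add: \<S>_def)
  qed
  have Un: "A \<union> B \<in> \<S>" if "A \<in> \<S>" "B \<in> \<S>" for A B
  proof -
    have "A \<union> B = (\<Union>i. case_nat A (\<lambda>_. B) i)" by (auto split: nat.splits)
    then show ?thesis using UN[of "case_nat A (\<lambda>_. B)"] that by (simp split: nat.split)
  qed
  have open_rect: "(U \<inter> K) \<times> E \<in> suslin \<E>" if U: "open U" and E: "E \<in> sets M" for U E
  proof -
    obtain L :: "nat \<Rightarrow> 'g set" where L: "\<And>n. compact (L n)" "U = (\<Union>n. L n)"
      using locally_compact_open_sigma_compact[OF lc U] by blast
    have "(L n \<inter> K) \<times> E \<in> \<E>" for n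
      using L K E sets.sets_into_space[OF E]
      by (auto simp: \<E>_def T_def intro!: elementary.rect compact_Int)
    then have "(\<Union>n. (L n \<inter> K) \<times> E) \<in> suslin \<E>"
      using T \<E> by (intro suslin_UN suslin_base)
    moreover have "(\<Union>n. (L n \<inter> K) \<times> E) = (U \<inter> K) \<times> E" using L by auto
    ultimately show ?thesis by simp
  qed
  have cyl: "UNIV \<times> E \<in> \<S>" if E: "E \<in> sets M" for E
  proof -
    have "(UNIV \<times> E) \<inter> T = (UNIV \<inter> K) \<times> E" "T - UNIV \<times> E = (UNIV \<inter> K) \<times> (space M - E)"
      using sets.sets_into_space[OF E] by (auto simp: T_def)
    then show ?thesis using open_rect[OF open_UNIV] E by (simp add: \<S>_def)
  qed
  have ocyl: "U \<times> UNIV \<in> \<S>" if "open U" for U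
  proof -
    have "(U \<times> UNIV) \<inter> T = (U \<inter> K) \<times> space M" by (auto simp: T_def)
    moreover have "T - U \<times> UNIV = (K - U) \<times> space M" by (auto simp: T_def)
    moreover have "(K - U) \<times> space M \<in> \<E>"
      using K that by (auto simp: \<E>_def T_def intro!: elementary.rect compact_diff)
    ultimately show ?thesis using open_rect[OF that, of "space M"] suslin_base by (simp add: \<S>_def)
  qed
  have bcyl: "C \<times> UNIV \<in> \<S>" if "C \<in> sets borel" for C
  proof -
    have "sets borel = sigma_sets UNIV {S :: 'g set. open S}"
      unfolding borel_def by (rule sets_measure_of) simp
    with that have "C \<in> sigma_sets UNIV {S. open S}" by simp
    then show ?thesis
    proof (induction rule: sigma_sets.induct)
      case (Basic U)
      then show ?case using ocyl by simp
    next
      case Empty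
      show ?case using ocyl[of "{}"] by simp
    next
      case (Compl C)
      have "(UNIV - C) \<times> (UNIV :: 'x set) = - (C \<times> UNIV)" by auto
      then show ?case using compl[OF Compl.IH] by (simp only:)
    next
      case (Union C)
      have "(\<Union>i. C i) \<times> (UNIV :: 'x set) = (\<Union>i. C i \<times> UNIV)" by auto
      then show ?case using UN[OF Union.IH] by simp
    qed
  qed
  have rect: "C \<times> E \<in> \<S>" if "C \<in> sets borel" "E \<in> sets M" for C E
  proof -
    have "C \<times> E = - (- (C \<times> UNIV) \<union> - (UNIV \<times> E))" by auto
    then show ?thesis using compl Un bcyl cyl that by metis
  qed
  have "A \<in> \<S>"
    using A unfolding sets_pair_measure
  proof (induction rule: sigma_sets.induct)
    case (Compl A)
    have "(space borel \<times> space M - A) = - (A \<union> - (UNIV \<times> space M))" by auto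
    then show ?case using compl Un cyl Compl.IH by (metis sets.top)
  next
    case Empty
    show ?case using rect[of "{}" "{}"] by simp
  qed (use rect UN in auto)
  then have "A \<inter> T \<in> suslin \<E>" by (simp add: \<S>_def)
  then obtain E :: "nat list \<Rightarrow> _" where "\<And>s. E s \<in> \<E>" "A \<inter> T = {p. \<exists>\<sigma>. \<forall>n. p \<in> E (map \<sigma> [0..<n])}"
    unfolding suslin_def by blast
  then show ?thesis
    unfolding T_def by (intro suslinI[of E]) (auto simp: \<E>_def)
qed

text \<open>Suslin representations are available over compact pieces of the group only, so the
  projection is assembled from a compact exhaustion.\<close>

proposition measurable_projection_AE:
  fixes A :: "('g::{t2_space, second_countable_topology} \<times> 'x) set"
  assumes lc: "locally_compact_space (euclidean :: 'g topology)"
    and "finite_measure M" and A: "A \<in> sets (borel \<Otimes>\<^sub>M M)"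
  shows "\<exists>P\<in>sets M. AE x in M. x \<in> P \<longleftrightarrow> (\<exists>g. (g, x) \<in> A)"
proof -
  obtain K :: "nat \<Rightarrow> 'g set" where K: "\<And>n. compact (K n)" "(UNIV :: 'g set) = (\<Union>n. K n)"
    using locally_compact_open_sigma_compact[OF lc open_UNIV] by blast
  have "\<exists>P\<in>sets M. AE x in M. x \<in> P \<longleftrightarrow> x \<in> snd ` (A \<inter> K n \<times> space M)" for n
    by (intro suslin_elementary_snd_image suslin_pair_measure assms K)
  then obtain P where P: "\<And>n. P n \<in> sets M"
    "\<And>n. AE x in M. x \<in> P n \<longleftrightarrow> x \<in> snd ` (A \<inter> K n \<times> space M)" by metis
  have "AE x in M. \<forall>n. x \<in> P n \<longleftrightarrow> x \<in> snd ` (A \<inter> K n \<times> space M)"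
    using P(2) by (simp add: AE_all_countable)
  then have "AE x in M. x \<in> (\<Union>n. P n) \<longleftrightarrow> (\<exists>g. (g, x) \<in> A)"
    using AE_space
  proof eventually_elim
    case (elim x)
    have "x \<in> snd ` (A \<inter> K n \<times> space M) \<longleftrightarrow> (\<exists>g\<in>K n. (g, x) \<in> A)" for n
      using elim(2) by (auto simp: image_iff Bex_def)
    moreover have "(\<exists>g. (g, x) \<in> A) \<longleftrightarrow> (\<exists>n. \<exists>g\<in>K n. (g, x) \<in> A)"
      using K(2) by (metis UNIV_I UN_iff)
    ultimately show ?case using elim(1) by simp
  qed
  then show ?thesis using P(1) by (intro bexI[of _ "\<Union>n. P n"]) auto
qed

section \<open>Measurable enumeration of locally finite sections\<close>

text \<open>Capacitability is a finite measure argument, while the transverse measure is given as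
  \<sigma>-finite. The projection theorem sees only null sets, so a measure with the same null sets
  serves.\<close>

lemma (in sigma_finite_measure) ex_equivalent_finite_measure:
  "\<exists>N. finite_measure N \<and> sets N = sets M \<and> (\<forall>P. (AE x in N. P x) \<longleftrightarrow> (AE x in M. P x))"
proof -
  obtain h where h: "h \<in> borel_measurable M" "(\<integral>\<^sup>+ x. h x \<partial>M) \<noteq> \<infinity>"
    "\<And>x. x \<in> space M \<Longrightarrow> 0 < h x"
    using Ex_finite_integrable_function by auto
  have "finite_measure (density M h)"
    using h by (intro finite_measureI) (auto simp: emeasure_density cong: nn_integral_cong)
  moreover have "(AE x in density M h. P x) \<longleftrightarrow> (AE x in M. P x)" for P
    unfolding AE_density[OF h(1)] by (intro AE_cong) (simp add: h(3))
  ultimately show ?thesis by (intro exI[of _ "density M h"]) simp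
qed

proposition measurable_projection_AE_sigma_finite:
  fixes A :: "('g::{t2_space, second_countable_topology} \<times> 'x) set"
  assumes lc: "locally_compact_space (euclidean :: 'g topology)"
    and "sigma_finite_measure M" and A: "A \<in> sets (borel \<Otimes>\<^sub>M M)"
  shows "\<exists>P\<in>sets M. AE x in M. x \<in> P \<longleftrightarrow> (\<exists>g. (g, x) \<in> A)"
proof -
  interpret sigma_finite_measure M by fact
  obtain N where "finite_measure N" "sets N = sets M"
    "\<And>P. (AE x in N. P x) \<longleftrightarrow> (AE x in M. P x)"
    using ex_equivalent_finite_measure by blast
  moreover have "A \<in> sets (borel \<Otimes>\<^sub>M N)"
    using A \<open>sets N = sets M\<close> by (simp cong: sets_pair_measure_cong)
  ultimately show ?thesis using measurable_projection_AE[OF lc, of N A] by simp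
qed

text \<open>
  By local finiteness every point of a section is isolated by a basic open set. The set of all \<open>x\<close> whose
  section meets a given basic open set in exactly one point is measurable up to a null set by the
  projection theorem, and so is this point as a function of \<open>x\<close>.
\<close>

proposition locally_finite_enumeration:
  fixes A :: "('g::{t2_space, second_countable_topology} \<times> 'x) set"
  assumes lc: "locally_compact_space (euclidean :: 'g topology)"
    and M: "sigma_finite_measure M" and A: "A \<in> sets (borel \<Otimes>\<^sub>M M)"
    and fin: "\<And>x L. x \<in> space M \<Longrightarrow> compact L \<Longrightarrow> finite ({g. (g, x) \<in> A} \<inter> L)"
  obtains c :: "nat \<Rightarrow> 'x \<Rightarrow> 'g" and D :: "nat \<Rightarrow> 'x set"
  where "\<And>i. c i \<in> borel_measurable M" "\<And>i. D i \<in> sets M"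
    "\<And>i x. x \<in> D i \<Longrightarrow> (c i x, x) \<in> A"
    "AE x in M. bij_betw (\<lambda>i. c i x) {i. x \<in> D i} {g. (g, x) \<in> A}"
proof -
  obtain B :: "'g set set" where B: "countable B" "topological_basis B"
    using ex_countable_basis by blast
  define U where "U = from_nat_into (insert {} B)"
  have range_U: "range U = insert {} B"
    unfolding U_def by (intro range_from_nat_into) (auto simp: B)
  have open_U: "open (U n)" for n
    using range_U topological_basis_open[OF B(2)] by (metis insert_iff open_empty rangeI)
  have basis: "\<exists>n. g \<in> U n \<and> U n \<subseteq> S" if "open S" "g \<in> S" for S g
    using topological_basisE[OF B(2) that] range_U by (metis insertCI rangeE)
  have "\<exists>P. P \<in> sets M \<and> (AE x in M. x \<in> P \<longleftrightarrow> (\<exists>g. (g, x) \<in> A \<inter> U n \<times> space M))" for n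
  proof -
    have "A \<inter> U n \<times> space M \<in> sets (borel \<Otimes>\<^sub>M M)"
      using open_U by (intro sets.Int A pair_measureI) auto
    from measurable_projection_AE_sigma_finite[OF lc M this] show ?thesis by blast
  qed
  from choice[OF allI[OF this]] obtain P where
    "\<forall>n. P n \<in> sets M \<and> (AE x in M. x \<in> P n \<longleftrightarrow> (\<exists>g. (g, x) \<in> A \<inter> U n \<times> space M))"
    by (rule exE)
  then have P: "P n \<in> sets M" "AE x in M. x \<in> P n \<longleftrightarrow> (\<exists>g. (g, x) \<in> A \<inter> U n \<times> space M)" for n
    by simp_all
  have "AE x in M. \<forall>n. x \<in> P n \<longleftrightarrow> (\<exists>g. (g, x) \<in> A \<inter> U n \<times> space M)"
    using P(2) by (simp add: AE_all_countable)
  then obtain N where N: "N \<in> null_sets M"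
    "{x \<in> space M. \<not> (\<forall>n. x \<in> P n \<longleftrightarrow> (\<exists>g. (g, x) \<in> A \<inter> U n \<times> space M))} \<subseteq> N"
    unfolding eventually_ae_filter by blast
  \<comment> \<open>On this set of full measure all the countably many projections are exact, so
    from here on the argument is pointwise.\<close>
  define X0 where "X0 = space M - N"
  have X0: "X0 \<in> sets M" using N by (auto simp: X0_def)
  have X0_iff: "x \<in> P n \<longleftrightarrow> (\<exists>g\<in>U n. (g, x) \<in> A)" if "x \<in> X0" for x n
    using that N(2) by (auto simp: X0_def)
  \<comment> \<open>The section has two points in \<open>U n\<close> exactly if two disjoint basic
    subsets of \<open>U n\<close> both meet it, by the Hausdorff property. This expresses uniqueness
    through countably many projections.\<close>
  define E where "E n = X0 \<inter> (P n - (\<Union>(i, j)\<in>{(i, j). U i \<inter> U j = {} \<and> U i \<subseteq> U n \<and> U j \<subseteq> U n}. P i \<inter> P j))" for n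
  have E: "E n \<in> sets M" for n
    unfolding E_def by (intro sets.Int sets.Diff X0 P sets.countable_UN'') (auto intro: P sets.Int)
  have E_iff: "x \<in> E n \<longleftrightarrow> (\<exists>!g. g \<in> U n \<and> (g, x) \<in> A)" if x: "x \<in> X0" for x n
  proof
    assume "x \<in> E n"
    then obtain g where g: "g \<in> U n" "(g, x) \<in> A" using X0_iff[OF x, of n] by (auto simp: E_def)
    show "\<exists>!g. g \<in> U n \<and> (g, x) \<in> A"
    proof (rule ex1I)
      fix g' assume g': "g' \<in> U n \<and> (g', x) \<in> A"
      show "g' = g"
      proof (rule ccontr)
        assume "g' \<noteq> g"
        then obtain V W where V: "open V" "open W" "g' \<in> V" "g \<in> W" "V \<inter> W = {}"
          using hausdorff[OF \<open>g' \<noteq> g\<close>] by metis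
        have "open (V \<inter> U n)" "g' \<in> V \<inter> U n" "open (W \<inter> U n)" "g \<in> W \<inter> U n"
          using V g g' open_U by auto
        then obtain i j where i: "g' \<in> U i" "U i \<subseteq> V \<inter> U n"
          and j: "g \<in> U j" "U j \<subseteq> W \<inter> U n"
          using basis by metis
        have "x \<in> P i \<inter> P j" using X0_iff[OF x, of i] X0_iff[OF x, of j] i(1) j(1) g g' by blast
        moreover have "U i \<inter> U j = {} \<and> U i \<subseteq> U n \<and> U j \<subseteq> U n" using i j V by blast
        ultimately show False using \<open>x \<in> E n\<close> by (auto simp: E_def)
      qed
    qed (use g in simp)
  next
    assume ex1: "\<exists>!g. g \<in> U n \<and> (g, x) \<in> A"
    then have "x \<in> P n" using X0_iff[OF x, of n] by blast
    moreover have "x \<notin> P i \<inter> P j" if "U i \<inter> U j = {}" "U i \<subseteq> U n" "U j \<subseteq> U n" for i j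
    proof
      assume "x \<in> P i \<inter> P j"
      then obtain g h where "g \<in> U i" "(g, x) \<in> A" "h \<in> U j" "(h, x) \<in> A"
        using X0_iff[OF x, of i] X0_iff[OF x, of j] by blast
      moreover from this that ex1 have "g = h" by blast
      ultimately show False using that(1) by blast
    qed
    ultimately show "x \<in> E n" using x by (auto simp: E_def)
  qed
  define c where "c n x = (if x \<in> E n then THE g. g \<in> U n \<and> (g, x) \<in> A else undefined)" for n x
  have c: "c n x \<in> U n \<and> (c n x, x) \<in> A" "\<And>g. g \<in> U n \<Longrightarrow> (g, x) \<in> A \<Longrightarrow> g = c n x"
    if "x \<in> E n" for n x
  proof -
    have "x \<in> X0" using that by (simp add: E_def)
    with that have "\<exists>!g. g \<in> U n \<and> (g, x) \<in> A" using E_iff by blast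
    from theI'[OF this] this show "c n x \<in> U n \<and> (c n x, x) \<in> A"
      "\<And>g. g \<in> U n \<Longrightarrow> (g, x) \<in> A \<Longrightarrow> g = c n x"
      using that by (auto simp: c_def)
  qed
  have c_meas: "c n \<in> borel_measurable M" for n
  proof (rule borel_measurableI)
    fix S :: "'g set" assume S: "open S"
    have "c n -` S \<inter> space M = (E n \<inter> (\<Union>i\<in>{i. U i \<subseteq> U n \<inter> S}. P i)) \<union>
        (if undefined \<in> S then space M - E n else {})"
    proof -
      \<comment> \<open>The isolated point lies in an open set \<open>S\<close> exactly if the
        section meets a basic set inside \<open>U n\<close> and \<open>S\<close>; this reduces
        measurability of the point to that of the projections.\<close>
      have "c n x \<in> S \<longleftrightarrow> (\<exists>i. U i \<subseteq> U n \<inter> S \<and> x \<in> P i)" if x: "x \<in> E n" for x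
      proof
        assume "c n x \<in> S"
        then have "open (U n \<inter> S)" "c n x \<in> U n \<inter> S" using c(1)[OF x] S open_U by auto
        then obtain i where i: "c n x \<in> U i" "U i \<subseteq> U n \<inter> S" using basis by metis
        have "x \<in> X0" using x by (simp add: E_def)
        then have "x \<in> P i" using X0_iff[of x i] c(1)[OF x] i(1) by blast
        with i(2) show "\<exists>i. U i \<subseteq> U n \<inter> S \<and> x \<in> P i" by blast
      next
        assume "\<exists>i. U i \<subseteq> U n \<inter> S \<and> x \<in> P i"
        then obtain i where i: "U i \<subseteq> U n \<inter> S" "x \<in> P i" by blast
        have "x \<in> X0" using x by (simp add: E_def)
        then obtain g where "g \<in> U i" "(g, x) \<in> A" using X0_iff[of x i] i(2) by blast
        then show "c n x \<in> S" using c(2)[OF x, of g] i(1) by blast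
      qed
      moreover have "E n \<subseteq> space M" using E sets.sets_into_space by blast
      moreover have "c n x = undefined" if "x \<notin> E n" for x using that by (simp add: c_def)
      ultimately show ?thesis
        by (intro set_eqI, case_tac "x \<in> E n") auto
    qed
    then show "c n -` S \<inter> space M \<in> sets M"
      using E P by (auto intro!: sets.Un sets.Int sets.countable_UN'')
  qed
  \<comment> \<open>One point is isolated by many basic sets. Keeping only the first index that
    yields it makes the enumeration injective.\<close>
  define D where "D n = E n - (\<Union>i<n. E i \<inter> {x \<in> space M. c i x = c n x})" for n
  have D: "D n \<in> sets M" for n
    unfolding D_def using E c_meas by (intro sets.Diff sets.finite_UN sets.Int measurable_equality_set) auto
  have "bij_betw (\<lambda>i. c i x) {i. x \<in> D i} {g. (g, x) \<in> A}" if x: "x \<in> X0" for x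
  proof (rule bij_betw_imageI)
    have "x \<in> space M" using x by (simp add: X0_def)
    have *: "c i x \<noteq> c j x" if "x \<in> D i" "x \<in> D j" "i < j" for i j
      using that \<open>x \<in> space M\<close> by (auto simp: D_def)
    show "inj_on (\<lambda>i. c i x) {i. x \<in> D i}"
      by (rule inj_onI) (metis (no_types, lifting) * mem_Collect_eq nat_neq_iff)
    have "\<exists>i. x \<in> D i \<and> c i x = g" if g: "(g, x) \<in> A" for g
    proof -
      obtain V K where V: "open V" "compact K" "g \<in> V" "V \<subseteq> K"
        using locally_compact_nbhd[OF lc open_UNIV, of g] by auto
      \<comment> \<open>The other points of the section near \<open>g\<close> are finitely many by
        local finiteness, so removing them leaves an open neighbourhood, and a basic set inside it
        isolates \<open>g\<close>.\<close>
      define F where "F = {g. (g, x) \<in> A} \<inter> K - {g}"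
      have "finite F" using fin[OF \<open>x \<in> space M\<close> V(2)] by (simp add: F_def)
      then obtain n where n: "g \<in> U n" "U n \<subseteq> V - F"
        using basis[of "V - F" g] V by (auto simp: F_def finite_imp_closed open_Diff)
      have "\<exists>!g. g \<in> U n \<and> (g, x) \<in> A"
        using n g V by (intro ex1I[of _ g]) (auto simp: F_def)
      then have "x \<in> E n" using E_iff x by blast
      then have ex: "\<exists>n. x \<in> E n \<and> c n x = g" using c(2)[of x n g] n g by blast
      define i where "i = (LEAST n. x \<in> E n \<and> c n x = g)"
      have i: "x \<in> E i" "c i x = g" using LeastI_ex[OF ex] by (auto simp: i_def)
      have "x \<notin> E j \<or> c j x \<noteq> g" if "j < i" for j
        using not_less_Least that unfolding i_def by blast
      then have "x \<in> D i" using i by (auto simp: D_def)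
      then show ?thesis using i by blast
    qed
    moreover have "(c i x, x) \<in> A" if "x \<in> D i" for i using that c(1)[of x i] by (auto simp: D_def)
    ultimately show "(\<lambda>i. c i x) ` {i. x \<in> D i} = {g. (g, x) \<in> A}" by force
  qed
  moreover have "AE x in M. x \<in> X0" using AE_not_in[OF N(1)] AE_space by eventually_elim (simp add: X0_def)
  ultimately have "AE x in M. bij_betw (\<lambda>i. c i x) {i. x \<in> D i} {g. (g, x) \<in> A}"
    by (auto elim: eventually_mono)
  moreover have "(c i x, x) \<in> A" if "x \<in> D i" for i x using that c(1)[of x i] by (auto simp: D_def)
  ultimately show thesis using that[of c D] c_meas D by blast
qed

section \<open>Conditional means\<close>

definition invariant_mean :: "'g::topological_group_add measure \<Rightarrow> (('g \<Rightarrow> real) \<Rightarrow> real) \<Rightarrow> bool" where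
  "invariant_mean m \<Lambda> \<longleftrightarrow>
     (\<forall>f \<in> ess_bounded m. \<forall>h \<in> ess_bounded m. \<Lambda> (\<lambda>x. f x + h x) = \<Lambda> f + \<Lambda> h) \<and>
     (\<forall>c. \<forall>f \<in> ess_bounded m. \<Lambda> (\<lambda>x. c * f x) = c * \<Lambda> f) \<and>
     (\<forall>f \<in> ess_bounded m. (AE x in m. 0 \<le> f x) \<longrightarrow> 0 \<le> \<Lambda> f) \<and>
     \<Lambda> (\<lambda>_. 1) = 1 \<and>
     (\<forall>g. \<forall>f \<in> ess_bounded m. \<Lambda> (\<lambda>x. f (g + x)) = \<Lambda> f)"

locale mean_action = pmp_action M act
  for M :: "'x measure"
    and act :: "'g::{topological_group_add, t2_space, second_countable_topology} \<Rightarrow> 'x \<Rightarrow> 'x" +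
  fixes m :: "'g measure" and \<Lambda> :: "('g \<Rightarrow> real) \<Rightarrow> real"
  assumes haar: "haar_measure m"
    and mean: "invariant_mean m \<Lambda>"
begin

lemma sets_m: "sets m = sets borel"
  using haar by (simp add: haar_measure_def)

lemma space_m: "space m = UNIV"
  using sets_eq_imp_space_eq[OF sets_m] by simp

lemma
  assumes "f \<in> ess_bounded m" "h \<in> ess_bounded m"
  shows mean_add: "\<Lambda> (\<lambda>x. f x + h x) = \<Lambda> f + \<Lambda> h"
    and mean_cmult: "\<Lambda> (\<lambda>x. c * f x) = c * \<Lambda> f"
    and mean_translate: "\<Lambda> (\<lambda>x. f (g + x)) = \<Lambda> f"
  using mean assms unfolding invariant_mean_def by blast+

lemma ess_boundedI:
  assumes "f \<in> borel_measurable borel" "\<And>x. \<bar>f x\<bar> \<le> C"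
  shows "f \<in> ess_bounded m"
  using assms measurable_cong_sets[OF sets_m refl] by (auto simp: ess_bounded_def)

lemma ess_bounded_const: "(\<lambda>_. c) \<in> ess_bounded m"
  by (rule ess_boundedI[of _ "\<bar>c\<bar>"]) auto

lemma mean_const: "\<Lambda> (\<lambda>_. c) = c"
proof -
  have "\<Lambda> (\<lambda>_. 1) = 1" using mean by (simp add: invariant_mean_def)
  then show ?thesis using mean_cmult[OF ess_bounded_const[of 1] ess_bounded_const, of c] by simp
qed

lemma mean_nonneg: "f \<in> ess_bounded m \<Longrightarrow> (\<And>x. 0 \<le> f x) \<Longrightarrow> 0 \<le> \<Lambda> f"
  using mean unfolding invariant_mean_def by auto

lemma mean_le:
  assumes f: "f \<in> ess_bounded m" and "\<And>x. f x \<le> c"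
  shows "\<Lambda> f \<le> c"
proof -
  have "0 \<le> \<Lambda> (\<lambda>x. c + (-1) * f x)"
    using assms ess_bounded_lincomb[OF ess_bounded_const f, of c "-1"] by (intro mean_nonneg) auto
  also have "\<dots> = c + (-1) * \<Lambda> f"
    using f ess_bounded_lincomb[OF ess_bounded_const[of 0] f, of "-1"] mean_cmult[OF f f, of "-1"]
    by (subst mean_add) (auto simp: ess_bounded_const mean_const)
  finally show ?thesis by simp
qed

definition bounded_kernel :: "('g \<Rightarrow> 'x \<Rightarrow> real) \<Rightarrow> bool" where
  "bounded_kernel \<Psi> \<longleftrightarrow>
     (\<lambda>(g, x). \<Psi> g x) \<in> borel_measurable (borel \<Otimes>\<^sub>M M) \<and> (\<exists>C. \<forall>g x. \<bar>\<Psi> g x\<bar> \<le> C)"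

definition kernel_integral :: "('g \<Rightarrow> 'x \<Rightarrow> real) \<Rightarrow> 'x set \<Rightarrow> 'g \<Rightarrow> real" where
  "kernel_integral \<Psi> B g = (\<integral>x. indicator B x * \<Psi> g x \<partial>M)"

lemma bounded_kernel_section:
  assumes "bounded_kernel \<Psi>"
  shows "\<Psi> g \<in> borel_measurable M"
  using assms measurable_compose[OF measurable_Pair1'[of g borel M], of "\<lambda>(g, x). \<Psi> g x"]
  by (auto simp: bounded_kernel_def)

lemma integrable_indicator_bounded:
  assumes "f \<in> borel_measurable M" "\<And>x. \<bar>f x\<bar> \<le> C" "B \<in> sets M"
  shows "integrable M (\<lambda>x. indicator B x * f x :: real)"
proof (rule integrable_const_bound[of _ C])
  show "AE x in M. norm (indicator B x * f x) \<le> C"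
    using assms(2) by (auto simp: indicator_def intro: order_trans[OF abs_ge_zero])
qed (use assms in measurable)

lemma integrable_indicator_event: "B \<in> sets M \<Longrightarrow> integrable M (indicator B :: 'x \<Rightarrow> real)"
  by (rule integrable_real_indicator) (auto simp: emeasure_eq_measure)

lemma integrable_kernel:
  assumes "bounded_kernel \<Psi>" "B \<in> sets M"
  shows "integrable M (\<lambda>x. indicator B x * \<Psi> g x)"
proof -
  obtain C where "\<And>g x. \<bar>\<Psi> g x\<bar> \<le> C" using assms by (auto simp: bounded_kernel_def)
  then show ?thesis using integrable_indicator_bounded[OF bounded_kernel_section[OF assms(1)] _ assms(2)] by blast
qed

lemma kernel_integral_ess_bounded:
  assumes "bounded_kernel \<Psi>" and [measurable]: "B \<in> sets M"
  shows "kernel_integral \<Psi> B \<in> ess_bounded m"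
proof -
  obtain C where C: "\<And>g x. \<bar>\<Psi> g x\<bar> \<le> C" using assms by (auto simp: bounded_kernel_def)
  have [measurable]: "(\<lambda>(g, x). \<Psi> g x) \<in> borel_measurable (borel \<Otimes>\<^sub>M M)"
    using assms by (simp add: bounded_kernel_def)
  show ?thesis
  proof (rule ess_boundedI)
    show "kernel_integral \<Psi> B \<in> borel_measurable borel"
      unfolding kernel_integral_def by measurable
    fix g
    have "\<bar>kernel_integral \<Psi> B g\<bar> \<le> (\<integral>x. \<bar>indicator B x * \<Psi> g x\<bar> \<partial>M)"
      unfolding kernel_integral_def by (rule integral_abs_bound)
    also have "\<dots> \<le> (\<integral>x. C \<partial>M)"
      using C order_trans[OF abs_ge_zero C] integrable_kernel[OF assms]
      by (intro integral_mono integrable_abs) (auto simp: indicator_def)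
    finally show "\<bar>kernel_integral \<Psi> B g\<bar> \<le> C" by (simp add: prob_space)
  qed
qed

text \<open>A weak integral against the mean. Applying \<open>\<Lambda>\<close> for each fixed
  \<open>x\<close> could give a function of \<open>x\<close> that is not measurable; here
  \<open>\<Lambda>\<close> is applied only after integration over \<open>B\<close>, and
  \<open>\<psi>\<close> is determined up to null sets.\<close>

definition cond_mean :: "('g \<Rightarrow> 'x \<Rightarrow> real) \<Rightarrow> ('x \<Rightarrow> real) \<Rightarrow> bool" where
  "cond_mean \<Psi> \<psi> \<longleftrightarrow> \<psi> \<in> borel_measurable M \<and> (\<exists>C. \<forall>x. \<bar>\<psi> x\<bar> \<le> C) \<and>
     (\<forall>B\<in>sets M. (\<integral>x. indicator B x * \<psi> x \<partial>M) = \<Lambda> (kernel_integral \<Psi> B))"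

text \<open>
  The mean of the integrals over \<open>B\<close> is only finitely additive in \<open>B\<close> by construction, but it is dominated
  by a multiple of \<open>M\<close>, hence countably additive.
\<close>

lemma ex_cond_mean:
  assumes \<Psi>: "bounded_kernel \<Psi>" and C: "\<And>g x. \<bar>\<Psi> g x\<bar> \<le> C"
  shows "\<exists>\<psi>. cond_mean \<Psi> \<psi> \<and> (\<forall>x. \<bar>\<psi> x\<bar> \<le> C)"
proof -
  have "0 \<le> C" using order_trans[OF abs_ge_zero C] .
  \<comment> \<open>Adding \<open>C\<close> makes the kernel nonnegative, so that its means over
    sets can form a measure; the range becomes 0 to \<open>2 * C\<close>.\<close>
  define \<Phi> where "\<Phi> g x = \<Psi> g x + C" for g x
  have \<Phi>_bounds: "0 \<le> \<Phi> g x" "\<Phi> g x \<le> 2 * C" for g x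
    using C[of g x] by (auto simp: \<Phi>_def)
  have \<Phi>: "bounded_kernel \<Phi>"
    unfolding bounded_kernel_def
  proof
    have "(\<lambda>(g, x). \<Phi> g x) = (\<lambda>p. (\<lambda>(g, x). \<Psi> g x) p + C)" by (auto simp: \<Phi>_def)
    then show "(\<lambda>(g, x). \<Phi> g x) \<in> borel_measurable (borel \<Otimes>\<^sub>M M)"
      using \<Psi> by (simp only: bounded_kernel_def) (intro borel_measurable_add borel_measurable_const; simp)
    show "\<exists>C. \<forall>g x. \<bar>\<Phi> g x\<bar> \<le> C" using \<Phi>_bounds by (intro exI[of _ "2 * C"]) simp
  qed
  have \<Phi>_int: "kernel_integral \<Phi> B g = kernel_integral \<Psi> B g + C * measure M B"
    if "B \<in> sets M" for B g
  proof -
    have "kernel_integral \<Phi> B g = (\<integral>x. indicator B x * \<Psi> g x + C * indicator B x \<partial>M)"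
      unfolding kernel_integral_def \<Phi>_def by (intro Bochner_Integration.integral_cong) (auto simp: algebra_simps)
    also have "\<dots> = kernel_integral \<Psi> B g + C * measure M B"
      using integrable_kernel[OF \<Psi> that] integrable_indicator_event[OF that] that
      by (subst Bochner_Integration.integral_add) (auto simp: kernel_integral_def)
    finally show ?thesis .
  qed
  have \<Phi>_nonneg: "0 \<le> kernel_integral \<Phi> B g" for B g
    unfolding kernel_integral_def using \<Phi>_bounds by (intro integral_nonneg_AE) auto
  have \<Phi>_le: "kernel_integral \<Phi> B g \<le> 2 * C * measure M B" if "B \<in> sets M" for B g
  proof -
    have "kernel_integral \<Phi> B g \<le> (\<integral>x. 2 * C * indicator B x \<partial>M)"
      unfolding kernel_integral_def
    proof (rule integral_mono)
      show "integrable M (\<lambda>x. 2 * C * indicator B x)"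
        using integrable_indicator_event[OF that] by simp
      show "indicator B x * \<Phi> g x \<le> 2 * C * indicator B x" for x
        using \<Phi>_bounds by (simp add: indicator_def)
    qed (rule integrable_kernel[OF \<Phi> that])
    then show ?thesis using that by simp
  qed
  define \<theta> where "\<theta> B = ennreal (\<Lambda> (kernel_integral \<Phi> B))" for B
  have \<theta>_nonneg: "0 \<le> \<Lambda> (kernel_integral \<Phi> B)" and \<theta>_le: "\<Lambda> (kernel_integral \<Phi> B) \<le> 2 * C * measure M B"
    if "B \<in> sets M" for B
    using mean_nonneg[OF kernel_integral_ess_bounded[OF \<Phi> that] \<Phi>_nonneg]
      mean_le[OF kernel_integral_ess_bounded[OF \<Phi> that] \<Phi>_le[OF that]] by auto
  have \<theta>_empty: "\<theta> {} = 0"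
    using \<theta>_le[of "{}"] \<theta>_nonneg[of "{}"] by (simp add: \<theta>_def ennreal_eq_0_iff)
  have "countably_additive (sets M) \<theta>"
  proof (rule sets.empty_continuous_imp_countably_additive)
    show "positive (sets M) \<theta>" using \<theta>_empty by (simp add: positive_def)
    show "additive (sets M) \<theta>"
      unfolding additive_def
    proof (intro ballI impI)
      fix A B assume AB: "A \<in> sets M" "B \<in> sets M" "A \<inter> B = {}"
      have "kernel_integral \<Phi> (A \<union> B) g = kernel_integral \<Phi> A g + kernel_integral \<Phi> B g" for g
      proof -
        have "kernel_integral \<Phi> (A \<union> B) g = (\<integral>x. indicator A x * \<Phi> g x + indicator B x * \<Phi> g x \<partial>M)"
          unfolding kernel_integral_def
          using AB(3) by (intro Bochner_Integration.integral_cong) (auto simp: indicator_def)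
        then show ?thesis
          using integrable_kernel[OF \<Phi>] AB by (simp add: kernel_integral_def)
      qed
      then have "kernel_integral \<Phi> (A \<union> B) = (\<lambda>g. kernel_integral \<Phi> A g + kernel_integral \<Phi> B g)"
        by auto
      then show "\<theta> (A \<union> B) = \<theta> A + \<theta> B"
        using mean_add[OF kernel_integral_ess_bounded[OF \<Phi>] kernel_integral_ess_bounded[OF \<Phi>], of A B] AB
          \<theta>_nonneg by (simp add: \<theta>_def ennreal_plus)
    qed
    fix A :: "nat \<Rightarrow> 'x set" assume A: "range A \<subseteq> sets M" "decseq A" "(\<Inter>i. A i) = {}"
    have "(\<lambda>i. measure M (A i)) \<longlonglongrightarrow> 0"
      using finite_Lim_measure_decseq[OF A(1,2)] A(3) by simp
    then have lim: "(\<lambda>i. ennreal (2 * C * measure M (A i))) \<longlonglongrightarrow> 0"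
      using tendsto_mult_right_zero[of _ _ "2 * C"] tendsto_ennrealI by force
    show "(\<lambda>i. \<theta> (A i)) \<longlonglongrightarrow> 0"
      by (rule tendsto_sandwich[OF _ _ tendsto_const lim])
        (use A \<theta>_le in \<open>auto simp: \<theta>_def intro!: always_eventually ennreal_leI\<close>)
  qed (simp add: \<theta>_def)
  moreover define N where "N = measure_of (space M) (sets M) \<theta>"
  ultimately have N: "sets N = sets M" "\<And>B. B \<in> sets M \<Longrightarrow> emeasure N B = \<theta> B"
    using \<theta>_empty by (auto simp: positive_def intro!: emeasure_measure_of_sigma sets.sigma_algebra_axioms)
  have "absolutely_continuous M N"
    unfolding absolutely_continuous_def
  proof
    fix B assume "B \<in> null_sets M"
    then have B: "B \<in> sets M" "measure M B = 0" by (auto simp: null_sets_def measure_def)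
    then show "B \<in> null_sets N"
      using N \<theta>_le[of B] by (auto simp: null_sets_def \<theta>_def ennreal_eq_0_iff)
  qed
  then obtain f where f[measurable]: "f \<in> borel_measurable M" and "density M f = N"
    using Radon_Nikodym[of N] N(1) by blast
  have f_int: "(\<integral>\<^sup>+ x. f x * indicator B x \<partial>M) = \<theta> B" if "B \<in> sets M" for B
    using N(2)[OF that] emeasure_density[OF f that] \<open>density M f = N\<close> by simp
  \<comment> \<open>Where the density exceeds \<open>2 * C\<close> it would give more mass than
    \<open>\<theta>_le\<close> permits, so this set is null.\<close>
  define B where "B = {x \<in> space M. f x > ennreal (2 * C)}"
  have B[measurable]: "B \<in> sets M" by (simp add: B_def)
  have "(\<integral>\<^sup>+ x. f x * indicator B x - ennreal (2 * C) * indicator B x \<partial>M) =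
      (\<integral>\<^sup>+ x. f x * indicator B x \<partial>M) - (\<integral>\<^sup>+ x. ennreal (2 * C) * indicator B x \<partial>M)"
  proof (rule nn_integral_diff)
    show "(\<integral>\<^sup>+ x. ennreal (2 * C) * indicator B x \<partial>M) \<noteq> \<infinity>"
      by (simp add: nn_integral_cmult_indicator emeasure_eq_measure ennreal_mult_eq_top_iff)
    show "AE x in M. ennreal (2 * C) * indicator B x \<le> f x * indicator B x"
      by (intro AE_I2) (auto simp: B_def indicator_def)
  qed measurable
  also have "\<dots> = \<theta> B - ennreal (2 * C * measure M B)"
    using \<open>0 \<le> C\<close> by (simp add: f_int nn_integral_cmult_indicator emeasure_eq_measure ennreal_mult)
  also have "\<dots> = 0"
    using ennreal_leI[OF \<theta>_le[OF B]] by (intro diff_eq_0_ennreal) (auto simp: \<theta>_def)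
  finally have "AE x in M. f x * indicator B x - ennreal (2 * C) * indicator B x = 0"
    by (subst (asm) nn_integral_0_iff_AE) auto
  then have f_le: "AE x in M. f x \<le> ennreal (2 * C)"
    using AE_space
  proof eventually_elim
    case (elim x)
    then show ?case
      by (cases "x \<in> B") (auto simp: B_def diff_eq_0_iff_ennreal not_less)
  qed
  \<comment> \<open>Subtracting \<open>C\<close> undoes the shift. The truncation changes the
    function on a null set only and makes the bound hold at every point.\<close>
  define \<psi> where "\<psi> x = max (- C) (min C (enn2real (f x) - C))" for x
  have \<psi>[measurable]: "\<psi> \<in> borel_measurable M" unfolding \<psi>_def by measurable
  have \<psi>_le: "\<bar>\<psi> x\<bar> \<le> C" for x
    using \<open>0 \<le> C\<close> enn2real_nonneg[of "f x"] by (auto simp: \<psi>_def abs_le_iff min_def max_def)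
  have \<psi>_ge: "0 \<le> \<psi> x + C" for x using \<psi>_le[of x] by linarith
  have "(\<integral>x. indicator B x * \<psi> x \<partial>M) = \<Lambda> (kernel_integral \<Psi> B)" if B[measurable]: "B \<in> sets M" for B
  proof -
    have eq: "AE x in M. ennreal (\<psi> x + C) = f x"
      using f_le
    proof eventually_elim
      case (elim x)
      then have "enn2real (f x) \<le> 2 * C" using \<open>0 \<le> C\<close> by (simp add: enn2real_leI)
      then have "\<psi> x + C = enn2real (f x)" using enn2real_nonneg[of "f x"] by (simp add: \<psi>_def)
      moreover have "f x < top" using elim by (simp add: le_less_trans)
      ultimately show ?case by simp
    qed
    have "(\<integral>x. indicator B x * (\<psi> x + C) \<partial>M) = enn2real (\<integral>\<^sup>+ x. ennreal (indicator B x * (\<psi> x + C)) \<partial>M)"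
      using \<psi>_ge by (intro integral_eq_nn_integral AE_I2 mult_nonneg_nonneg) auto
    also have "(\<integral>\<^sup>+ x. ennreal (indicator B x * (\<psi> x + C)) \<partial>M) = (\<integral>\<^sup>+ x. f x * indicator B x \<partial>M)"
      using eq by (intro nn_integral_cong_AE) (auto elim!: eventually_mono simp: indicator_def)
    also have "enn2real \<dots> = \<Lambda> (kernel_integral \<Phi> B)"
      using \<theta>_nonneg[OF B] by (simp add: f_int \<theta>_def)
    also have "kernel_integral \<Phi> B = (\<lambda>g. kernel_integral \<Psi> B g + C * measure M B)"
      using \<Phi>_int[OF B] by auto
    also have "\<Lambda> \<dots> = \<Lambda> (kernel_integral \<Psi> B) + C * measure M B"
      using kernel_integral_ess_bounded[OF \<Psi> B] by (simp add: mean_add ess_bounded_const mean_const)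
    finally have "(\<integral>x. indicator B x * (\<psi> x + C) \<partial>M) = \<Lambda> (kernel_integral \<Psi> B) + C * measure M B" .
    moreover have "(\<integral>x. indicator B x * (\<psi> x + C) \<partial>M) = (\<integral>x. indicator B x * \<psi> x + C * indicator B x \<partial>M)"
      by (intro Bochner_Integration.integral_cong) (auto simp: algebra_simps)
    moreover have "\<dots> = (\<integral>x. indicator B x * \<psi> x \<partial>M) + C * measure M B"
      using integrable_indicator_bounded[OF \<psi> \<psi>_le B] integrable_indicator_event[OF B] B
      by (subst Bochner_Integration.integral_add) auto
    ultimately show ?thesis by simp
  qed
  then have "cond_mean \<Psi> \<psi>" using \<psi>_le unfolding cond_mean_def by auto
  then show ?thesis using \<psi>_le by blast
qed

text \<open>
  The conditional mean is local in \<open>x\<close>, so pointwise linear relations between kernels on a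
  measurable set pass to the conditional means almost everywhere on this set.
\<close>

lemma cond_mean_sum_AE:
  assumes J: "finite J" and \<Psi>: "\<And>j. j \<in> J \<Longrightarrow> bounded_kernel (\<Psi> j)"
    and \<psi>: "\<And>j. j \<in> J \<Longrightarrow> cond_mean (\<Psi> j) (\<psi> j)"
    and D: "D \<in> sets M" and \<phi>: "\<phi> \<in> borel_measurable M" "\<And>x. \<bar>\<phi> x\<bar> \<le> C"
    and eq: "\<And>g. AE x in M. x \<in> D \<longrightarrow> (\<Sum>j\<in>J. a j * \<Psi> j g x) = \<phi> x"
  shows "AE x in M. x \<in> D \<longrightarrow> (\<Sum>j\<in>J. a j * \<psi> j x) = \<phi> x"
proof -
  have sum: "(\<lambda>g. \<Sum>j\<in>I. a j * kernel_integral (\<Psi> j) B g) \<in> ess_bounded m \<and>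
    \<Lambda> (\<lambda>g. \<Sum>j\<in>I. a j * kernel_integral (\<Psi> j) B g) = (\<Sum>j\<in>I. a j * \<Lambda> (kernel_integral (\<Psi> j) B))"
    if "I \<subseteq> J" and B: "B \<in> sets M" for I B
    using finite_subset[OF that(1) J] that(1)
  proof (induction I rule: finite_induct)
    case empty
    then show ?case by (simp add: ess_bounded_const mean_const)
  next
    case (insert j I)
    have j: "kernel_integral (\<Psi> j) B \<in> ess_bounded m"
      using insert.prems by (intro kernel_integral_ess_bounded \<Psi> B) auto
    have aj: "(\<lambda>g. a j * kernel_integral (\<Psi> j) B g) \<in> ess_bounded m"
      using ess_bounded_lincomb[OF ess_bounded_const[of 0] j, of "a j"] by simp
    have I: "(\<lambda>g. \<Sum>j\<in>I. a j * kernel_integral (\<Psi> j) B g) \<in> ess_bounded m"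
      using insert by simp
    show ?case
      using insert mean_add[OF aj I] mean_cmult[OF j j] ess_bounded_lincomb[OF aj I, of 1] by simp
  qed
  have \<psi>_meas: "\<psi> j \<in> borel_measurable M" if "j \<in> J" for j
    using \<psi>[OF that] by (simp add: cond_mean_def)
  have \<psi>_int: "integrable M (\<lambda>x. indicator B x * \<psi> j x)"
    if j: "j \<in> J" and B: "B \<in> sets M" for j B
  proof -
    obtain C where "\<And>x. \<bar>\<psi> j x\<bar> \<le> C" using \<psi>[OF j] by (auto simp: cond_mean_def)
    then show ?thesis by (rule integrable_indicator_bounded[OF \<psi>_meas[OF j] _ B])
  qed
  have \<phi>_int: "integrable M (\<lambda>x. indicator B x * \<phi> x)" if "B \<in> sets M" for B
    by (rule integrable_indicator_bounded[OF \<phi> that])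
  have sum_eq: "(\<integral>x. indicator B x * (\<Sum>j\<in>J. a j * \<psi> j x) \<partial>M) = (\<integral>x. indicator B x * \<phi> x \<partial>M)"
    if B: "B \<in> sets M" "B \<subseteq> D" for B
  proof -
    have "(\<integral>x. indicator B x * (\<Sum>j\<in>J. a j * \<psi> j x) \<partial>M) =
        (\<integral>x. (\<Sum>j\<in>J. a j * (indicator B x * \<psi> j x)) \<partial>M)"
      by (simp add: sum_distrib_left algebra_simps)
    also have "\<dots> = (\<Sum>j\<in>J. a j * (\<integral>x. indicator B x * \<psi> j x \<partial>M))"
      using \<psi>_int B by (subst Bochner_Integration.integral_sum) auto
    also have "\<dots> = (\<Sum>j\<in>J. a j * \<Lambda> (kernel_integral (\<Psi> j) B))"
      using \<psi> B by (intro sum.cong) (auto simp: cond_mean_def)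
    also have "\<dots> = \<Lambda> (\<lambda>g. \<Sum>j\<in>J. a j * kernel_integral (\<Psi> j) B g)"
      using sum[OF order_refl B(1)] by simp
    \<comment> \<open>The combined kernel integral does not depend on \<open>g\<close>, and the mean
      of a constant is that constant. As only integrals over \<open>B\<close> enter, the exceptional
      null set in the hypothesis may vary with \<open>g\<close>.\<close>
    also have "(\<lambda>g. \<Sum>j\<in>J. a j * kernel_integral (\<Psi> j) B g) = (\<lambda>g. \<integral>x. indicator B x * \<phi> x \<partial>M)"
    proof
      fix g
      have "(\<Sum>j\<in>J. a j * kernel_integral (\<Psi> j) B g) =
          (\<integral>x. (\<Sum>j\<in>J. a j * (indicator B x * \<Psi> j g x)) \<partial>M)"
        unfolding kernel_integral_def
        using integrable_kernel[OF \<Psi> B(1)] by (subst Bochner_Integration.integral_sum) auto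
      also have "\<dots> = (\<integral>x. indicator B x * \<phi> x \<partial>M)"
      proof (rule integral_cong_AE)
        show "AE x in M. (\<Sum>j\<in>J. a j * (indicator B x * \<Psi> j g x)) = indicator B x * \<phi> x"
          using eq[of g] by eventually_elim (use B(2) in \<open>auto simp: indicator_def\<close>)
      qed (use B \<phi> bounded_kernel_section[OF \<Psi>] in \<open>auto intro!: borel_measurable_sum\<close>)
      finally show "(\<Sum>j\<in>J. a j * kernel_integral (\<Psi> j) B g) = (\<integral>x. indicator B x * \<phi> x \<partial>M)" .
    qed
    finally show ?thesis by (simp add: mean_const)
  qed
  have "AE x in M. indicator D x * ((\<Sum>j\<in>J. a j * \<psi> j x) - \<phi> x) = 0"
  proof (rule density_zero)
    have int: "integrable M (\<lambda>x. indicator B x * (\<Sum>j\<in>J. a j * \<psi> j x))" if "B \<in> sets M" for B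
    proof -
      have "(\<lambda>x. indicator B x * (\<Sum>j\<in>J. a j * \<psi> j x)) = (\<lambda>x. \<Sum>j\<in>J. a j * (indicator B x * \<psi> j x))"
        by (auto simp: sum_distrib_left algebra_simps)
      then show ?thesis using \<psi>_int[OF _ that] by auto
    qed
    show "integrable M (\<lambda>x. indicator D x * ((\<Sum>j\<in>J. a j * \<psi> j x) - \<phi> x))"
      using int[OF D] \<phi>_int[OF D] by (simp add: right_diff_distrib)
    fix B assume B: "B \<in> sets M"
    have "set_lebesgue_integral M B (\<lambda>x. indicator D x * ((\<Sum>j\<in>J. a j * \<psi> j x) - \<phi> x)) =
        (\<integral>x. indicator (B \<inter> D) x * (\<Sum>j\<in>J. a j * \<psi> j x) - indicator (B \<inter> D) x * \<phi> x \<partial>M)"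
      unfolding set_lebesgue_integral_def
      by (intro Bochner_Integration.integral_cong) (auto simp: indicator_def)
    also have "\<dots> = 0"
      using int[of "B \<inter> D"] \<phi>_int[of "B \<inter> D"] sum_eq[of "B \<inter> D"] B D
      by (subst Bochner_Integration.integral_diff) auto
    finally show "set_lebesgue_integral M B (\<lambda>x. indicator D x * ((\<Sum>j\<in>J. a j * \<psi> j x) - \<phi> x)) = 0" .
  qed
  then show ?thesis by eventually_elim (auto simp: indicator_def)
qed

section \<open>Translating kernels and conditional means\<close>

lemma act_measurable1 [measurable]: "act a \<in> M \<rightarrow>\<^sub>M M"
  using measurable_compose[OF measurable_Pair1'[of a borel M] act_measurable] by simp

lemma act_space: "x \<in> space M \<Longrightarrow> act a x \<in> space M"
  using measurable_space[OF act_measurable1] .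

lemma act_uminus: "x \<in> space M \<Longrightarrow> act (- a) (act a x) = x"
  using act_add[of x "- a" a] act_zero by simp

lemma AE_act: "AE x in M. P x \<Longrightarrow> AE x in M. P (act a x)"
  by (rule AE_distrD[OF act_measurable1]) (simp only: act_preserving)

lemma bounded_kernel_translate:
  assumes "bounded_kernel \<Psi>"
  shows "bounded_kernel (\<lambda>g x. \<Psi> (a + g) (act a x))"
proof -
  have [measurable]: "(\<lambda>(g, x). \<Psi> g x) \<in> borel_measurable (borel \<Otimes>\<^sub>M M)"
    using assms by (simp add: bounded_kernel_def)
  have "(\<lambda>(g, x). \<Psi> (a + g) (act a x)) = (\<lambda>(g, x). \<Psi> g x) \<circ> (\<lambda>p. (a + fst p, act a (snd p)))"
    by auto
  moreover have "\<dots> \<in> borel_measurable (borel \<Otimes>\<^sub>M M)" by measurable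
  ultimately show ?thesis using assms by (auto simp: bounded_kernel_def)
qed

text \<open>Invariance of \<open>M\<close> moves the translation from the point to the set
  \<open>B\<close>; what remains is a kernel integral with argument \<open>a + g\<close>, and left
  invariance of the mean removes \<open>a\<close>.\<close>

lemma cond_mean_translate:
  assumes \<Psi>: "bounded_kernel \<Psi>" and \<psi>: "cond_mean \<Psi> \<psi>"
  shows "cond_mean (\<lambda>g x. \<Psi> (a + g) (act a x)) (\<lambda>x. \<psi> (act a x))"
proof -
  have \<psi>_meas[measurable]: "\<psi> \<in> borel_measurable M" using \<psi> by (simp add: cond_mean_def)
  have "(\<integral>x. indicator B x * \<psi> (act a x) \<partial>M) =
      \<Lambda> (kernel_integral (\<lambda>g x. \<Psi> (a + g) (act a x)) B)" if B[measurable]: "B \<in> sets M" for B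
  proof -
    \<comment> \<open>The image of \<open>B\<close> under \<open>act a\<close>, written as a
      preimage so that it is measurable.\<close>
    define B' where "B' = act (- a) -` B \<inter> space M"
    have B'[measurable]: "B' \<in> sets M" unfolding B'_def by measurable
    have ind: "indicator B x = (indicator B' (act a x) :: real)" if "x \<in> space M" for x
      using that by (simp add: B'_def indicator_def act_uminus act_space)
    have shift: "(\<integral>x. indicator B x * f (act a x) \<partial>M) = (\<integral>x. indicator B' x * f x \<partial>M)"
      if [measurable]: "f \<in> borel_measurable M" for f :: "'x \<Rightarrow> real"
    proof -
      have "(\<integral>x. indicator B x * f (act a x) \<partial>M) = (\<integral>x. indicator B' (act a x) * f (act a x) \<partial>M)"
        by (intro Bochner_Integration.integral_cong) (auto simp: ind)
      also have "\<dots> = (\<integral>x. indicator B' x * f x \<partial>distr M M (act a))"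
        by (rule integral_distr[symmetric]) measurable
      finally show ?thesis by (simp add: act_preserving)
    qed
    have "kernel_integral (\<lambda>g x. \<Psi> (a + g) (act a x)) B = (\<lambda>g. kernel_integral \<Psi> B' (a + g))"
      unfolding kernel_integral_def by (intro ext shift bounded_kernel_section[OF \<Psi>])
    then have "\<Lambda> (kernel_integral (\<lambda>g x. \<Psi> (a + g) (act a x)) B) = \<Lambda> (kernel_integral \<Psi> B')"
      using kernel_integral_ess_bounded[OF \<Psi> B'] mean_translate by metis
    then show ?thesis using shift[OF \<psi>_meas] \<psi> B' by (simp add: cond_mean_def)
  qed
  then show ?thesis using \<psi> by (auto simp: cond_mean_def)
qed

end

section \<open>The tuple measures of the transverse groupoid\<close>

lemma borel_measurable_uminus_group:
  fixes f :: "'a \<Rightarrow> 'g::{topological_group_add, second_countable_topology}"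
  shows "f \<in> borel_measurable N \<Longrightarrow> (\<lambda>x. - f x) \<in> borel_measurable N"
  by (rule measurable_compose[OF _ borel_measurable_continuous_onI[of uminus]])
    (auto intro!: continuous_intros)

lemma borel_measurable_diff_group:
  fixes f :: "'a \<Rightarrow> 'g::{topological_group_add, second_countable_topology}"
  assumes "f \<in> borel_measurable N" "h \<in> borel_measurable N"
  shows "(\<lambda>x. f x - h x) \<in> borel_measurable N"
  using borel_measurable_add[OF assms(1) borel_measurable_uminus_group[OF assms(2)]] by simp

locale amenable_transverse = transverse_system M act Y + mean_action M act m \<Lambda>
  for M :: "'x measure"
    and act :: "'g::{topological_group_add, t2_space, second_countable_topology} \<Rightarrow> 'x \<Rightarrow> 'x"
    and Y :: "'x set" and m :: "'g measure" and \<Lambda> :: "('g \<Rightarrow> real) \<Rightarrow> real" +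
  fixes \<nu> :: "'x measure"
  assumes lc: "locally_compact_space (euclidean :: 'g topology)"
    and unimod: "unimodular m"
    and transverse: "transverse_measure m M act Y \<nu>"
begin

abbreviation "\<G> \<equiv> transverse_groupoid M act Y \<nu>"
abbreviation "hit \<equiv> hitting_set act Y"

definition hits :: "nat \<Rightarrow> 'x \<Rightarrow> (nat \<Rightarrow> 'g) set" where
  "hits n x = {..<n} \<rightarrow>\<^sub>E hit x"

text \<open>Inverting the arrows turns a tuple with common target \<open>x\<close> into a tuple in the hitting set of \<open>x\<close>.\<close>

definition tup :: "nat \<Rightarrow> 'x \<Rightarrow> (nat \<Rightarrow> 'g) \<Rightarrow> nat \<Rightarrow> 'g \<times> 'x" where
  "tup n x h = (\<lambda>i\<in>{..<n}. (- h i, act (h i) x))"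

lemma hit_iff: "g \<in> hit x \<longleftrightarrow> act g x \<in> Y"
  by (simp add: hitting_set_def)

lemma Y_space: "y \<in> Y \<Longrightarrow> y \<in> space M"
  using cross_section_borel sets.sets_into_space by blast

lemma sets_\<nu>: "sets \<nu> = sets (restrict_space M Y)"
  using transverse by (simp add: transverse_measure_def)

lemma space_\<nu>: "space \<nu> = Y"
  using sets_eq_imp_space_eq[OF sets_\<nu>] Y_space by (auto simp: space_restrict_space)

lemma measurable_\<nu>: "f \<in> M \<rightarrow>\<^sub>M N \<Longrightarrow> f \<in> \<nu> \<rightarrow>\<^sub>M N"
  using measurable_restrict_space1[of f M N Y] measurable_cong_sets[OF sets_\<nu> refl] by blast

lemma sigma_finite_\<nu>: "sigma_finite_measure \<nu>"
  using transverse by (simp add: transverse_measure_def)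

lemma groupoid_simps [simp]:
  "objects \<G> = \<nu>"
  "arrows \<G> = restrict_space (borel \<Otimes>\<^sub>M M) {(g, y). y \<in> Y \<and> act g y \<in> Y}"
  "tgt \<G> (g, y) = act g y"
  "comp \<G> (g, z) (h, y) = (g + h, y)"
  "ginv \<G> (g, y) = (- g, act g y)"
  by (simp_all add: transverse_groupoid_def)

lemma space_arrows: "space (arrows \<G>) = {(g, y). y \<in> Y \<and> act g y \<in> Y}"
  using Y_space by (auto simp: space_restrict_space space_pair_measure)

lemma arrows_sets: "{(g, x) \<in> space (borel \<Otimes>\<^sub>M M). act g x \<in> Y} \<in> sets (borel \<Otimes>\<^sub>M M)"
proof -
  have "{(g, x) \<in> space (borel \<Otimes>\<^sub>M M). act g x \<in> Y} =
      (\<lambda>(g, x). act g x) -` Y \<inter> space (borel \<Otimes>\<^sub>M M)" by auto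
  then show ?thesis using measurable_sets[OF act_measurable cross_section_borel] by simp
qed

lemma fibre_eq: "y \<in> Y \<Longrightarrow> fibre \<G> y = (\<lambda>g. (- g, act g y)) ` hit y"
proof (intro set_eqI iffI)
  fix \<gamma> assume y: "y \<in> Y" and "\<gamma> \<in> fibre \<G> y"
  then obtain g z where \<gamma>: "\<gamma> = (g, z)" "z \<in> Y" "act g z = y"
    unfolding fibre_def space_arrows by auto
  then have "act (- g) y = z" using act_uminus Y_space by blast
  then show "\<gamma> \<in> (\<lambda>g. (- g, act g y)) ` hit y"
    using \<gamma> by (intro image_eqI[of _ _ "- g"]) (auto simp: hit_iff)
next
  fix \<gamma> assume y: "y \<in> Y" and "\<gamma> \<in> (\<lambda>g. (- g, act g y)) ` hit y"
  then show "\<gamma> \<in> fibre \<G> y"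
    unfolding fibre_def space_arrows using act_uminus[OF Y_space[OF y]] by (auto simp: hit_iff)
qed

lemma bij_betw_tup:
  assumes "y \<in> Y"
  shows "bij_betw (tup n y) (hits n y) ({..<n} \<rightarrow>\<^sub>E fibre \<G> y)"
proof -
  let ?a = "\<lambda>g. (- g, act g y)"
  have inj: "inj ?a" by (auto simp: inj_def)
  show ?thesis
  proof (rule bij_betw_imageI)
    show "inj_on (tup n y) (hits n y)"
    proof (rule inj_onI)
      fix h k assume hk: "h \<in> hits n y" "k \<in> hits n y" "tup n y h = tup n y k"
      show "h = k"
      proof (rule PiE_ext[of h "{..<n}" "\<lambda>_. hit y"])
        fix i assume "i \<in> {..<n}"
        then show "h i = k i" using fun_cong[OF hk(3), of i] by (simp add: tup_def)
      qed (use hk in \<open>auto simp: hits_def\<close>)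
    qed
    have "\<gamma> \<in> tup n y ` hits n y" if \<gamma>: "\<gamma> \<in> {..<n} \<rightarrow>\<^sub>E fibre \<G> y" for \<gamma>
    proof (rule image_eqI)
      have *: "\<exists>g\<in>hit y. \<gamma> i = ?a g" if "i < n" for i
        using \<gamma> that fibre_eq[OF assms] by (auto dest: PiE_mem)
      show "(\<lambda>i\<in>{..<n}. - fst (\<gamma> i)) \<in> hits n y"
        using * by (force simp: hits_def)
      show "\<gamma> = tup n y (\<lambda>i\<in>{..<n}. - fst (\<gamma> i))"
      proof
        fix i show "\<gamma> i = tup n y (\<lambda>i\<in>{..<n}. - fst (\<gamma> i)) i"
        proof (cases "i < n")
          case True
          then show ?thesis using *[of i] by (auto simp: tup_def)
        next
          case False
          then show ?thesis using \<gamma> by (auto simp: tup_def PiE_def extensional_def)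
        qed
      qed
    qed
    then show "tup n y ` hits n y = {..<n} \<rightarrow>\<^sub>E fibre \<G> y"
      using fibre_eq[OF assms] by (auto simp: tup_def hits_def PiE_iff)
  qed
qed

lemma tuples_eq: "0 < n \<Longrightarrow> tuples \<G> n = (\<Union>y\<in>Y. {..<n} \<rightarrow>\<^sub>E fibre \<G> y)"
proof (intro set_eqI iffI)
  fix \<gamma> assume n: "0 < n" and \<gamma>: "\<gamma> \<in> tuples \<G> n"
  then have "\<gamma> 0 \<in> space (arrows \<G>)" unfolding tuples_def by (blast dest: PiE_mem)
  then have "tgt \<G> (\<gamma> 0) \<in> Y"
    unfolding space_arrows by (cases "\<gamma> 0") auto
  moreover have "\<gamma> \<in> {..<n} \<rightarrow>\<^sub>E fibre \<G> (tgt \<G> (\<gamma> 0))"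
    using \<gamma> unfolding tuples_def fibre_def PiE_iff by blast
  ultimately show "\<gamma> \<in> (\<Union>y\<in>Y. {..<n} \<rightarrow>\<^sub>E fibre \<G> y)" by blast
next
  fix \<gamma> assume "0 < n" "\<gamma> \<in> (\<Union>y\<in>Y. {..<n} \<rightarrow>\<^sub>E fibre \<G> y)"
  then show "\<gamma> \<in> tuples \<G> n" by (auto simp: tuples_def fibre_def PiE_iff)
qed

lemma tup_in_tuples:
  assumes "0 < n" "y \<in> Y" "h \<in> hits n y"
  shows "tup n y h \<in> tuples \<G> n"
proof -
  have "tup n y h \<in> {..<n} \<rightarrow>\<^sub>E fibre \<G> y"
    using bij_betwE[OF bij_betw_tup[OF assms(2), of n]] assms(3) by (rule bspec)
  with assms(2) show ?thesis unfolding tuples_eq[OF assms(1)] by blast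
qed

lemma tuplesE:
  assumes "0 < n" "\<gamma> \<in> tuples \<G> n"
  obtains y h where "y \<in> Y" "h \<in> hits n y" "\<gamma> = tup n y h"
proof -
  obtain y where y: "y \<in> Y" "\<gamma> \<in> {..<n} \<rightarrow>\<^sub>E fibre \<G> y"
    using assms(2) unfolding tuples_eq[OF assms(1)] by (rule UN_E)
  from y(2) have "\<gamma> \<in> tup n y ` hits n y"
    unfolding bij_betw_imp_surj_on[OF bij_betw_tup[OF y(1)]] .
  then show thesis using that[OF y(1)] by (auto simp: image_iff)
qed

lemma space_PiM_tuples: "space (restrict_space (PiM {..<n} (\<lambda>_. arrows \<G>)) (tuples \<G> n)) = tuples \<G> n"
  by (auto simp: space_restrict_space space_PiM tuples_def)

lemma sets_tuple_measure:
  "sets (tuple_measure \<G> n) = sets (restrict_space (PiM {..<n} (\<lambda>_. arrows \<G>)) (tuples \<G> n))"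
proof -
  have "sigma_algebra (tuples \<G> n) (sets (restrict_space (PiM {..<n} (\<lambda>_. arrows \<G>)) (tuples \<G> n)))"
    using sets.sigma_algebra_axioms space_PiM_tuples by metis
  then show ?thesis
    unfolding tuple_measure_def by (simp add: sigma_algebra.sets_measure_of_eq)
qed

lemma space_tuple_measure: "space (tuple_measure \<G> n) = tuples \<G> n"
  using sets_eq_imp_space_eq[OF sets_tuple_measure] space_PiM_tuples by simp

text \<open>The function \<open>f\<close> lives on the trace \<sigma>-algebra of
  \<open>tuples\<close>, so a map can be composed with it only where it takes values there.
  Extending by zero from \<open>S\<close> gives a function on the whole space, and measurability of
  the map is checked entry by entry.\<close>

lemma measurable_pullback_tuples:
  fixes f :: "(nat \<Rightarrow> 'g \<times> 'x) \<Rightarrow> 'b::{topological_space, zero}"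
  assumes f: "f \<in> borel_measurable (tuple_measure \<G> n)" and S: "S \<in> sets N"
    and \<phi>: "\<And>i. i < n \<Longrightarrow> (\<lambda>p. \<phi> p i) \<in> N \<rightarrow>\<^sub>M borel \<Otimes>\<^sub>M M"
      "\<And>p. p \<in> S \<Longrightarrow> \<phi> p \<in> tuples \<G> n"
  shows "(\<lambda>p. if p \<in> S then f (\<phi> p) else 0) \<in> borel_measurable N"
proof -
  have S_eq: "S \<inter> space N = S" using sets.sets_into_space[OF S] by auto
  have \<phi>_PiE: "\<phi> p \<in> {..<n} \<rightarrow>\<^sub>E space (arrows \<G>)" if "p \<in> S" for p
    using \<phi>(2)[OF that] by (simp add: tuples_def)
  have "\<phi> \<in> restrict_space N S \<rightarrow>\<^sub>M restrict_space (PiM {..<n} (\<lambda>_. arrows \<G>)) (tuples \<G> n)"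
  proof (intro measurable_restrict_space2)
    show "\<phi> \<in> space (restrict_space N S) \<rightarrow> tuples \<G> n"
      using \<phi>(2) by (auto simp: space_restrict_space)
    have "(\<lambda>p. \<lambda>i\<in>{..<n}. \<phi> p i) \<in> restrict_space N S \<rightarrow>\<^sub>M PiM {..<n} (\<lambda>_. arrows \<G>)"
    proof (rule measurable_restrict)
      fix i assume "i \<in> {..<n}"
      moreover have "(\<lambda>p. \<phi> p i) \<in> space (restrict_space N S) \<rightarrow> {(g, y). y \<in> Y \<and> act g y \<in> Y}"
        using PiE_mem[OF \<phi>_PiE \<open>i \<in> {..<n}\<close>] unfolding space_arrows
        by (simp add: space_restrict_space Pi_iff)
      ultimately show "(\<lambda>p. \<phi> p i) \<in> restrict_space N S \<rightarrow>\<^sub>M arrows \<G>"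
        unfolding groupoid_simps by (intro measurable_restrict_space2 measurable_restrict_space1 \<phi>) auto
    qed
    then show "\<phi> \<in> restrict_space N S \<rightarrow>\<^sub>M PiM {..<n} (\<lambda>_. arrows \<G>)"
    proof (subst measurable_cong)
      fix p assume "p \<in> space (restrict_space N S)"
      then show "\<phi> p = (\<lambda>i\<in>{..<n}. \<phi> p i)"
        using \<phi>_PiE[of p] by (auto simp: space_restrict_space PiE_def extensional_restrict)
    qed
  qed
  moreover have "f \<in> borel_measurable (restrict_space (PiM {..<n} (\<lambda>_. arrows \<G>)) (tuples \<G> n))"
    using f measurable_cong_sets[OF sets_tuple_measure refl] by blast
  ultimately have "(\<lambda>p. f (\<phi> p)) \<in> borel_measurable (restrict_space N S)"
    by (rule measurable_compose)
  then show ?thesis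
  proof (subst measurable_If_restrict_space_iff)
    have "{p \<in> space N. p \<in> S} = S" using S_eq by blast
    then show "{p \<in> space N. p \<in> S} \<in> sets N" using S by simp
  qed simp
qed

section \<open>Enumerating the tuples in a hitting set\<close>

text \<open>The measure \<open>K\<close> is left open because the enumeration is needed both for
  \<open>M\<close> and for a measure supported on the cross section. Measurability refers to
  \<open>M\<close> in either case; only the null set where exhaustion may fail depends on
  \<open>K\<close>.\<close>

lemma ex_enumeration:
  assumes "finite_measure K" and K: "sets K = sets M"
  obtains c :: "nat \<Rightarrow> 'x \<Rightarrow> 'g" and D :: "nat \<Rightarrow> 'x set"
  where "\<And>i. c i \<in> borel_measurable M" "\<And>i. D i \<in> sets M"
    "\<And>i x. x \<in> D i \<Longrightarrow> c i x \<in> hit x"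
    "AE x in K. bij_betw (\<lambda>i. c i x) {i. x \<in> D i} (hit x)"
proof -
  interpret K: finite_measure K by fact
  have space: "space K = space M" using sets_eq_imp_space_eq[OF K] .
  define A where "A = {(g, x) \<in> space (borel \<Otimes>\<^sub>M M). act g x \<in> Y}"
  have A: "A \<in> sets (borel \<Otimes>\<^sub>M K)"
    using arrows_sets sets_pair_measure_cong[OF refl K] unfolding A_def by blast
  have A_section: "{g. (g, x) \<in> A} = hit x" if "x \<in> space M" for x
    using that by (auto simp: A_def space_pair_measure hit_iff)
  obtain c :: "nat \<Rightarrow> 'x \<Rightarrow> 'g" and D :: "nat \<Rightarrow> 'x set"
    where c: "\<And>i. c i \<in> borel_measurable K" "\<And>i. D i \<in> sets K"
    "\<And>i x. x \<in> D i \<Longrightarrow> (c i x, x) \<in> A"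
    "AE x in K. bij_betw (\<lambda>i. c i x) {i. x \<in> D i} {g. (g, x) \<in> A}"
  proof (rule locally_finite_enumeration[OF lc K.sigma_finite_measure_axioms A])
    show "finite ({g. (g, x) \<in> A} \<inter> L)" if "x \<in> space K" "compact L" for x L
      using cross_section_locally_finite[of x L] A_section[of x] that space by simp
  qed (rule that)
  show thesis
  proof (rule that)
    show "c i \<in> borel_measurable M" for i
      using c(1) measurable_cong_sets[OF K refl] by blast
    show "D i \<in> sets M" for i using c(2) K by simp
    show "c i x \<in> hit x" if "x \<in> D i" for i x
      using c(3)[OF that] by (auto simp: A_def hit_iff)
    show "AE x in K. bij_betw (\<lambda>i. c i x) {i. x \<in> D i} (hit x)"
      using c(4) AE_space by eventually_elim (simp add: A_section space)
  qed
qed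

text \<open>Extensional functions, so that multi-indices are countable in number and each tuple of
  hitting points has exactly one of them wherever the enumeration is bijective.\<close>

definition idx :: "nat \<Rightarrow> (nat \<Rightarrow> nat) set" where
  "idx n = {..<n} \<rightarrow>\<^sub>E UNIV"

definition pts :: "(nat \<Rightarrow> 'x \<Rightarrow> 'g) \<Rightarrow> nat \<Rightarrow> (nat \<Rightarrow> nat) \<Rightarrow> 'x \<Rightarrow> nat \<Rightarrow> 'g" where
  "pts c n i x = (\<lambda>l\<in>{..<n}. c (i l) x)"

definition doms :: "(nat \<Rightarrow> 'x set) \<Rightarrow> nat \<Rightarrow> (nat \<Rightarrow> nat) \<Rightarrow> 'x set" where
  "doms D n i = {x \<in> space M. \<forall>l<n. x \<in> D (i l)}"

lemma countable_idx: "countable (idx n)"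
  unfolding idx_def by (rule countable_PiE) auto

lemma doms_sets:
  assumes [measurable]: "\<And>i. D i \<in> sets M"
  shows "doms D n i \<in> sets M"
  unfolding doms_def by measurable

lemma pts_measurable: "(\<And>i. c i \<in> borel_measurable M) \<Longrightarrow> pts c n i \<in> M \<rightarrow>\<^sub>M PiM {..<n} (\<lambda>_. borel)"
  unfolding pts_def by (rule measurable_restrict) auto

lemma pts_in_hits: "(\<And>i x. x \<in> D i \<Longrightarrow> c i x \<in> hit x) \<Longrightarrow> x \<in> doms D n i \<Longrightarrow> pts c n i x \<in> hits n x"
  by (auto simp: hits_def pts_def doms_def)

lemma bij_betw_hits:
  assumes x: "x \<in> space M" and bij: "bij_betw (\<lambda>i. c i x) {i. x \<in> D i} (hit x)"
  shows "bij_betw (\<lambda>i. pts c n i x) {i \<in> idx n. x \<in> doms D n i} (hits n x)"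
proof (rule bij_betw_imageI)
  show "inj_on (\<lambda>i. pts c n i x) {i \<in> idx n. x \<in> doms D n i}"
  proof (rule inj_onI)
    fix i j assume ij: "i \<in> {i \<in> idx n. x \<in> doms D n i}" "j \<in> {i \<in> idx n. x \<in> doms D n i}"
      "pts c n i x = pts c n j x"
    show "i = j"
    proof (rule PiE_ext[of i "{..<n}" "\<lambda>_. UNIV"])
      fix l assume l: "l \<in> {..<n}"
      then have "c (i l) x = c (j l) x" using fun_cong[OF ij(3), of l] by (simp add: pts_def)
      then show "i l = j l"
        using inj_onD[OF bij_betw_imp_inj_on[OF bij]] ij l by (simp add: doms_def)
    qed (use ij in \<open>auto simp: idx_def\<close>)
  qed
  have "\<exists>i. i \<in> idx n \<and> x \<in> doms D n i \<and> pts c n i x = h" if h: "h \<in> hits n x" for h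
  proof -
    have "\<forall>l. \<exists>i. l < n \<longrightarrow> x \<in> D i \<and> c i x = h l"
    proof
      fix l show "\<exists>i. l < n \<longrightarrow> x \<in> D i \<and> c i x = h l"
      proof (cases "l < n")
        case True
        then have "h l \<in> (\<lambda>i. c i x) ` {i. x \<in> D i}"
          using h bij_betw_imp_surj_on[OF bij] by (auto simp: hits_def)
        then show ?thesis by force
      qed simp
    qed
    then obtain i where i: "\<And>l. l < n \<Longrightarrow> x \<in> D (i l) \<and> c (i l) x = h l" by metis
    have "h l = undefined" if "\<not> l < n" for l using h that by (auto simp: hits_def PiE_def extensional_def)
    then show ?thesis
      using i x by (intro exI[of _ "restrict i {..<n}"]) (auto simp: idx_def doms_def pts_def)
  qed
  moreover have "pts c n i x \<in> hits n x" if "x \<in> doms D n i" for i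
  proof -
    have "c (i l) x \<in> hit x" if "l < n" for l
      using bij_betwE[OF bij] \<open>x \<in> doms D n i\<close> that by (simp add: doms_def)
    then show ?thesis by (simp add: hits_def pts_def PiE_iff)
  qed
  ultimately show "(\<lambda>i. pts c n i x) ` {i \<in> idx n. x \<in> doms D n i} = hits n x"
    by blast
qed

text \<open>A finite measure equivalent to \<open>\<nu>\<close> is pushed forward along the
  inclusion of \<open>Y\<close>, which produces a measure on the \<sigma>-algebra of
  \<open>M\<close> that knows the null sets of \<open>\<nu>\<close>.\<close>

lemma ex_enumeration_\<nu>:
  obtains c :: "nat \<Rightarrow> 'x \<Rightarrow> 'g" and D :: "nat \<Rightarrow> 'x set"
  where "\<And>i. c i \<in> borel_measurable M" "\<And>i. D i \<in> sets M"
    "\<And>i x. x \<in> D i \<Longrightarrow> c i x \<in> hit x"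
    "AE x in \<nu>. bij_betw (\<lambda>i. c i x) {i. x \<in> D i} (hit x)"
proof -
  interpret \<nu>: sigma_finite_measure \<nu> by (rule sigma_finite_\<nu>)
  obtain N where N: "finite_measure N" "sets N = sets \<nu>"
    "\<And>P. (AE x in N. P x) \<longleftrightarrow> (AE x in \<nu>. P x)"
    using \<nu>.ex_equivalent_finite_measure by blast
  have id: "(\<lambda>x. x) \<in> N \<rightarrow>\<^sub>M M"
    using measurable_\<nu>[of "\<lambda>x. x" M] measurable_cong_sets[OF N(2) refl] by auto
  have "finite_measure (distr N M (\<lambda>x. x))"
    using finite_measure.finite_measure_distr[OF N(1) id] .
  then show thesis
  proof (rule ex_enumeration)
    fix c :: "nat \<Rightarrow> 'x \<Rightarrow> 'g" and D :: "nat \<Rightarrow> 'x set"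
    assume c: "\<And>i. c i \<in> borel_measurable M" "\<And>i. D i \<in> sets M"
      "\<And>i x. x \<in> D i \<Longrightarrow> c i x \<in> hit x"
      and bij: "AE x in distr N M (\<lambda>x. x). bij_betw (\<lambda>i. c i x) {i. x \<in> D i} (hit x)"
    have "AE x in \<nu>. bij_betw (\<lambda>i. c i x) {i. x \<in> D i} (hit x)"
      unfolding N(3)[symmetric] by (rule AE_distrD[OF id bij])
    with c show thesis by (rule that)
  qed simp
qed

section \<open>Additivity and null sets of the tuple measures\<close>

definition fibre_integral :: "nat \<Rightarrow> (nat \<Rightarrow> 'g \<times> 'x) set \<Rightarrow> 'x \<Rightarrow> ennreal" where
  "fibre_integral n A y = (\<integral>\<^sup>+ h. indicator A (tup n y h) \<partial>count_space (hits n y))"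

text \<open>
  The constant \<open>tuple_measure\<close> would be the zero measure if its set function were not countably additive.
  Measurability of the integrand up to null sets excludes this.
\<close>

lemma fibre_integral_AE_measurable:
  assumes n: "0 < n" and A: "A \<in> sets (tuple_measure \<G> n)"
  obtains q where "q \<in> borel_measurable \<nu>" "AE y in \<nu>. fibre_integral n A y = q y"
proof -
  obtain c :: "nat \<Rightarrow> 'x \<Rightarrow> 'g" and D :: "nat \<Rightarrow> 'x set"
    where c[measurable]: "\<And>i. c i \<in> borel_measurable M" and D: "\<And>i. D i \<in> sets M"
    "\<And>i x. x \<in> D i \<Longrightarrow> c i x \<in> hit x"
    "AE x in \<nu>. bij_betw (\<lambda>i. c i x) {i. x \<in> D i} (hit x)"
    by (rule ex_enumeration_\<nu>) (rule that)
  define r where "r i y = (if y \<in> doms D n i \<inter> Y then indicator A (tup n y (pts c n i y)) else 0 :: ennreal)" for i y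
  define q where "q y = (\<integral>\<^sup>+ i. r i y \<partial>count_space (idx n))" for y
  have r: "r i \<in> borel_measurable \<nu>" for i
    unfolding r_def
  proof (rule measurable_pullback_tuples)
    show "indicator A \<in> borel_measurable (tuple_measure \<G> n)" using A by simp
    show "doms D n i \<inter> Y \<in> sets \<nu>"
      using doms_sets[OF D(1)] cross_section_borel by (auto simp: sets_\<nu> sets_restrict_space)
    fix l assume l: "l < n"
    have "(\<lambda>y. (- c (i l) y, act (c (i l) y) y)) \<in> M \<rightarrow>\<^sub>M borel \<Otimes>\<^sub>M M"
      using act_measurable measurable_compose[of "\<lambda>y. (c (i l) y, y)" M "borel \<Otimes>\<^sub>M M" "\<lambda>(g, x). act g x" M]
      by (intro measurable_Pair borel_measurable_uminus_group) auto
    then show "(\<lambda>y. tup n y (pts c n i y) l) \<in> \<nu> \<rightarrow>\<^sub>M borel \<Otimes>\<^sub>M M"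
      using l by (intro measurable_\<nu>) (simp add: tup_def pts_def)
  next
    fix y assume y: "y \<in> doms D n i \<inter> Y"
    show "tup n y (pts c n i y) \<in> tuples \<G> n"
      by (rule tup_in_tuples[OF n _ pts_in_hits[OF D(2)]]) (use y in auto)
  qed
  show thesis
  proof (rule that)
    interpret count: sigma_finite_measure "count_space (idx n)"
      by (rule sigma_finite_measure_count_space_countable[OF countable_idx])
    have "(\<lambda>(i, y). r i y) \<in> borel_measurable (count_space (idx n) \<Otimes>\<^sub>M \<nu>)"
      by (rule measurable_pair_measure_countable1[OF countable_idx]) (simp add: r)
    then have "(\<lambda>(y, i). r i y) \<in> borel_measurable (\<nu> \<Otimes>\<^sub>M count_space (idx n))"
      using measurable_pair_swap by fastforce
    then show "q \<in> borel_measurable \<nu>"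
      unfolding q_def by (rule count.borel_measurable_nn_integral)
    show "AE y in \<nu>. fibre_integral n A y = q y"
      using D(3) AE_space
    proof eventually_elim
      case (elim y)
      then have y: "y \<in> Y" by (simp add: space_\<nu>)
      have "fibre_integral n A y =
          (\<integral>\<^sup>+ i. indicator A (tup n y (pts c n i y)) \<partial>count_space {i \<in> idx n. y \<in> doms D n i})"
        unfolding fibre_integral_def
        by (rule nn_integral_bij_count_space[symmetric]) (rule bij_betw_hits[of y c D, OF Y_space[OF y] elim(1)])
      also have "\<dots> = q y"
        unfolding q_def r_def
        by (subst (1 2) nn_integral_count_space_indicator)
          (auto intro!: nn_integral_cong simp: indicator_def y)
      finally show ?case .
    qed
  qed
qed

lemma emeasure_fibres:
  assumes n: "0 < n" and A: "A \<in> sets (tuple_measure \<G> n)" and y: "y \<in> Y"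
  shows "emeasure (count_space ({..<n} \<rightarrow>\<^sub>E fibre \<G> y)) (A \<inter> ({..<n} \<rightarrow>\<^sub>E fibre \<G> y)) = fibre_integral n A y"
proof -
  have "emeasure (count_space ({..<n} \<rightarrow>\<^sub>E fibre \<G> y)) (A \<inter> ({..<n} \<rightarrow>\<^sub>E fibre \<G> y)) =
      (\<integral>\<^sup>+ \<gamma>. indicator (A \<inter> ({..<n} \<rightarrow>\<^sub>E fibre \<G> y)) \<gamma> \<partial>count_space ({..<n} \<rightarrow>\<^sub>E fibre \<G> y))"
    by (simp del: groupoid_simps)
  also have "\<dots> = (\<integral>\<^sup>+ \<gamma>. indicator A \<gamma> \<partial>count_space ({..<n} \<rightarrow>\<^sub>E fibre \<G> y))"
    by (intro nn_integral_cong) (auto simp: indicator_def)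
  also have "\<dots> = fibre_integral n A y"
    unfolding fibre_integral_def by (rule nn_integral_bij_count_space[OF bij_betw_tup[OF y], symmetric])
  finally show ?thesis .
qed

text \<open>Within each fibre, countable additivity is that of counting. Exchanging sum and outer
  integral needs measurable integrands, so the fibre integrals of the sets \<open>B i\<close> are
  first replaced by measurable versions, at the cost of countably many null sets.\<close>

lemma emeasure_tuple_measure:
  assumes n: "0 < n" and A: "A \<in> sets (tuple_measure \<G> n)"
  shows "emeasure (tuple_measure \<G> n) A = (\<integral>\<^sup>+ y. fibre_integral n A y \<partial>\<nu>)"
proof -
  define S where "S = sets (restrict_space (PiM {..<n} (\<lambda>_. arrows \<G>)) (tuples \<G> n))"
  define \<mu> where "\<mu> A = (\<integral>\<^sup>+ y. emeasure (count_space ({..<n} \<rightarrow>\<^sub>E fibre \<G> y)) (A \<inter> ({..<n} \<rightarrow>\<^sub>E fibre \<G> y)) \<partial>\<nu>)"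
    for A
  have S: "B \<in> S \<Longrightarrow> B \<in> sets (tuple_measure \<G> n)" for B
    by (simp add: S_def sets_tuple_measure)
  have \<mu>: "\<mu> B = (\<integral>\<^sup>+ y. fibre_integral n B y \<partial>\<nu>)" if "B \<in> S" for B
    unfolding \<mu>_def by (intro nn_integral_cong emeasure_fibres[OF n S[OF that]]) (simp add: space_\<nu>)
  have "sigma_algebra (tuples \<G> n) S"
    unfolding S_def using sets.sigma_algebra_axioms space_PiM_tuples by metis
  moreover have "positive S \<mu>" by (simp add: positive_def \<mu>_def)
  moreover have "countably_additive S \<mu>"
  proof (rule countably_additiveI)
    fix B :: "nat \<Rightarrow> _" assume B: "range B \<subseteq> S" "disjoint_family B" "\<Union> (range B) \<in> S"
    have "\<exists>q. q \<in> borel_measurable \<nu> \<and> (AE y in \<nu>. fibre_integral n (B i) y = q y)" for i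
    proof (rule fibre_integral_AE_measurable[OF n S])
      show "B i \<in> S" using B(1) by auto
      show "\<exists>q. q \<in> borel_measurable \<nu> \<and> (AE y in \<nu>. fibre_integral n (B i) y = q y)"
        if "q \<in> borel_measurable \<nu>" "AE y in \<nu>. fibre_integral n (B i) y = q y" for q
        using that by (intro exI[of _ q] conjI)
    qed
    from choice[OF allI[OF this]]
    obtain q where "\<forall>i. q i \<in> borel_measurable \<nu> \<and> (AE y in \<nu>. fibre_integral n (B i) y = q i y)"
      by (rule exE)
    then have q: "q i \<in> borel_measurable \<nu>" "AE y in \<nu>. fibre_integral n (B i) y = q i y" for i
      by simp_all
    have "\<mu> (B i) = (\<integral>\<^sup>+ y. q i y \<partial>\<nu>)" for i
      using \<mu>[of "B i"] B(1) nn_integral_cong_AE[OF q(2)[of i]] by auto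
    then have "(\<Sum>i. \<mu> (B i)) = (\<Sum>i. \<integral>\<^sup>+ y. q i y \<partial>\<nu>)" by simp
    also have "\<dots> = (\<integral>\<^sup>+ y. (\<Sum>i. q i y) \<partial>\<nu>)"
      by (rule nn_integral_suminf[symmetric]) (rule q)
    also have "\<dots> = (\<integral>\<^sup>+ y. fibre_integral n (\<Union> (range B)) y \<partial>\<nu>)"
    proof (rule nn_integral_cong_AE)
      have "AE y in \<nu>. \<forall>i. fibre_integral n (B i) y = q i y" using q(2) by (simp add: AE_all_countable)
      then show "AE y in \<nu>. (\<Sum>i. q i y) = fibre_integral n (\<Union> (range B)) y"
      proof eventually_elim
        case (elim y)
        have "(\<Sum>i. q i y) = (\<Sum>i. fibre_integral n (B i) y)" using elim by simp
        also have "\<dots> = (\<integral>\<^sup>+ h. (\<Sum>i. indicator (B i) (tup n y h)) \<partial>count_space (hits n y))"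
          unfolding fibre_integral_def by (rule nn_integral_suminf[symmetric]) simp
        also have "\<dots> = fibre_integral n (\<Union> (range B)) y"
          unfolding fibre_integral_def by (simp add: suminf_indicator[OF B(2)])
        finally show ?case .
      qed
    qed
    finally show "(\<Sum>i. \<mu> (B i)) = \<mu> (\<Union> (range B))" using \<mu>[OF B(3)] by simp
  qed
  moreover have "A \<in> S" using A by (simp add: S_def sets_tuple_measure)
  ultimately have "emeasure (measure_of (tuples \<G> n) S \<mu>) A = \<mu> A"
    by (rule emeasure_measure_of_sigma)
  moreover have "tuple_measure \<G> n = measure_of (tuples \<G> n) S \<mu>"
    unfolding tuple_measure_def S_def \<mu>_def[abs_def] by simp
  ultimately show ?thesis using \<mu>[OF \<open>A \<in> S\<close>] by simp
qed

text \<open>Counting measure has no nonempty null sets, so over almost every point of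
  \<open>Y\<close> every tuple satisfies the property.\<close>

lemma AE_tuple_measureD:
  assumes n: "0 < n" and P: "AE \<gamma> in tuple_measure \<G> n. P \<gamma>"
  shows "AE y in \<nu>. \<forall>h\<in>hits n y. P (tup n y h)"
proof -
  obtain N where N: "N \<in> null_sets (tuple_measure \<G> n)" "{\<gamma> \<in> tuples \<G> n. \<not> P \<gamma>} \<subseteq> N"
    using P unfolding eventually_ae_filter space_tuple_measure by blast
  have NS: "N \<in> sets (tuple_measure \<G> n)" using N(1) by auto
  obtain q where q: "q \<in> borel_measurable \<nu>" "AE y in \<nu>. fibre_integral n N y = q y"
    using fibre_integral_AE_measurable[OF n NS] by blast
  have "(\<integral>\<^sup>+ y. q y \<partial>\<nu>) = (\<integral>\<^sup>+ y. fibre_integral n N y \<partial>\<nu>)"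
    using q(2) by (intro nn_integral_cong_AE) auto
  also have "\<dots> = 0" using N(1) emeasure_tuple_measure[OF n NS] by (simp add: null_sets_def)
  finally have "AE y in \<nu>. q y = 0" using q(1) by (simp add: nn_integral_0_iff_AE)
  with q(2) show ?thesis
    using AE_space
  proof eventually_elim
    case (elim y)
    then have y: "y \<in> Y" and "fibre_integral n N y = 0" by (simp_all add: space_\<nu>)
    then have "\<forall>h\<in>hits n y. tup n y h \<notin> N"
      by (simp add: fibre_integral_def nn_integral_0_iff_AE AE_count_space indicator_eq_0_iff)
    then show ?case using N(2) tup_in_tuples[OF n y] by blast
  qed
qed

text \<open>The exceptional tuples need not form a measurable set. They are enlarged to all tuples
  with target in a \<open>\<nu>\<close>-null set, which is measurable since the target map
  is.\<close>

lemma AE_tuple_measureI: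
  assumes n: "0 < n" and P: "AE y in \<nu>. \<forall>h\<in>hits n y. P (tup n y h)"
  shows "AE \<gamma> in tuple_measure \<G> n. P \<gamma>"
proof -
  obtain N where N: "N \<in> null_sets \<nu>" "{y \<in> Y. \<not> (\<forall>h\<in>hits n y. P (tup n y h))} \<subseteq> N"
    using P unfolding eventually_ae_filter space_\<nu> by blast
  define B where "B = {\<gamma> \<in> tuples \<G> n. tgt \<G> (\<gamma> 0) \<in> N}"
  have tgt: "tgt \<G> (tup n y h 0) = y" if "y \<in> Y" "h \<in> hits n y" for y h
    using n that act_uminus[OF Y_space] by (simp add: tup_def)
  have "B \<in> sets (tuple_measure \<G> n)"
  proof -
    have "N \<in> sets M"
      using N(1) cross_section_borel by (auto simp: null_sets_def sets_\<nu> sets_restrict_space)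
    moreover have "(\<lambda>(g, x). act g x) \<in> arrows \<G> \<rightarrow>\<^sub>M M"
      unfolding groupoid_simps by (rule measurable_restrict_space1[OF act_measurable])
    then have "(\<lambda>\<gamma>. (\<lambda>(g, x). act g x) (\<gamma> 0)) \<in> PiM {..<n} (\<lambda>_. arrows \<G>) \<rightarrow>\<^sub>M M"
      using n by (intro measurable_compose[OF measurable_component_singleton]) auto
    then have "(\<lambda>\<gamma>. (\<lambda>(g, x). act g x) (\<gamma> 0)) \<in> tuple_measure \<G> n \<rightarrow>\<^sub>M M"
      using measurable_restrict_space1 measurable_cong_sets[OF sets_tuple_measure refl] by blast
    ultimately have "(\<lambda>\<gamma>. (\<lambda>(g, x). act g x) (\<gamma> 0)) -` N \<inter> space (tuple_measure \<G> n) \<in> sets (tuple_measure \<G> n)"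
      by (rule measurable_sets[rotated])
    also have "(\<lambda>\<gamma>. (\<lambda>(g, x). act g x) (\<gamma> 0)) -` N \<inter> space (tuple_measure \<G> n) = B"
      unfolding space_tuple_measure by (auto simp: B_def transverse_groupoid_def)
    finally show ?thesis .
  qed
  moreover have "emeasure (tuple_measure \<G> n) B = 0"
  proof -
    have zero: "fibre_integral n B y = 0" if "y \<in> Y" "y \<notin> N" for y
      using tgt[OF that(1)] that(2)
      by (auto simp: fibre_integral_def nn_integral_0_iff_AE AE_count_space indicator_def B_def)
    have "AE y in \<nu>. fibre_integral n B y = 0"
      using AE_not_in[OF N(1)] AE_space by eventually_elim (simp add: space_\<nu> zero)
    then have "(\<integral>\<^sup>+ y. fibre_integral n B y \<partial>\<nu>) = (\<integral>\<^sup>+ y. 0 \<partial>\<nu>)"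
      by (rule nn_integral_cong_AE)
    then show ?thesis using emeasure_tuple_measure[OF n calculation] by simp
  qed
  ultimately have "B \<in> null_sets (tuple_measure \<G> n)" by auto
  then show ?thesis
  proof (rule AE_I')
    show "{\<gamma> \<in> space (tuple_measure \<G> n). \<not> P \<gamma>} \<subseteq> B"
    proof
      fix \<gamma> assume "\<gamma> \<in> {\<gamma> \<in> space (tuple_measure \<G> n). \<not> P \<gamma>}"
      then have \<gamma>: "\<gamma> \<in> tuples \<G> n" "\<not> P \<gamma>" by (auto simp: space_tuple_measure)
      then obtain y h where yh: "y \<in> Y" "h \<in> hits n y" "\<gamma> = tup n y h" using tuplesE[OF n] by blast
      then have "y \<in> N" using \<gamma>(2) N(2) by blast
      then show "\<gamma> \<in> B" using tgt[OF yh(1,2)] \<gamma>(1) yh(3) by (simp add: B_def)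
    qed
  qed
qed

section \<open>Passing between the cross section and the ambient space\<close>

lemma sigma_finite_m: "sigma_finite_measure m"
proof -
  obtain K :: "nat \<Rightarrow> 'g set" where K: "\<And>n. compact (K n)" "(UNIV :: 'g set) = (\<Union>n. K n)"
    using locally_compact_open_sigma_compact[OF lc open_UNIV] by blast
  show ?thesis
  proof
    have "emeasure m (K n) \<noteq> \<infinity>" for n
      using haar K(1)[of n] unfolding haar_measure_def by (metis less_irrefl infinity_ennreal_def)
    moreover have "K n \<in> sets m" for n using K(1) by (simp add: sets_m borel_compact)
    ultimately show "\<exists>A. countable A \<and> A \<subseteq> sets m \<and> \<Union> A = space m \<and> (\<forall>a\<in>A. emeasure m a \<noteq> \<infinity>)"
      using K(2) by (intro exI[of _ "range K"]) (auto simp: space_m)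
  qed
qed

text \<open>Strict positivity lets the defining formula of the transverse measure detect every point
  of a hitting set. The same weight later gives a probability measure with the null sets of Haar
  measure.\<close>

lemma ex_weight:
  obtains w :: "'g \<Rightarrow> ennreal"
  where "w \<in> borel_measurable borel" "\<And>g. 0 < w g" "(\<integral>\<^sup>+ g. w g \<partial>m) = 1"
proof -
  interpret m: sigma_finite_measure m by (rule sigma_finite_m)
  obtain h where h: "h \<in> borel_measurable m" "(\<integral>\<^sup>+ x. h x \<partial>m) \<noteq> \<infinity>" "\<And>x. 0 < h x" "\<And>x. h x < \<infinity>"
    using m.Ex_finite_integrable_function by (auto simp: space_m)
  define I where "I = (\<integral>\<^sup>+ x. h x \<partial>m)"
  have "I \<noteq> 0"
  proof
    assume "I = 0"
    then have "AE x in m. h x = 0" using h(1) by (simp add: I_def nn_integral_0_iff_AE)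
    moreover have "h x \<noteq> 0" for x using h(3)[of x] by simp
    ultimately have "AE x in m. False" by simp
    then obtain N where "{x \<in> space m. \<not> False} \<subseteq> N" "emeasure m N = 0" by (rule AE_E)
    moreover from this(1) have "N = UNIV" using space_m by auto
    ultimately have "emeasure m UNIV = 0" by simp
    then show False using haar by (simp add: haar_measure_def)
  qed
  show thesis
  proof (rule that)
    show "(\<lambda>x. h x / I) \<in> borel_measurable borel"
      using h(1) measurable_cong_sets[OF sets_m refl] by (intro borel_measurable_divide_ennreal) auto
    show "0 < h x / I" for x
      using h(2) h(3)[of x] \<open>I \<noteq> 0\<close> by (simp add: I_def ennreal_zero_less_divide less_top)
    show "(\<integral>\<^sup>+ x. h x / I \<partial>m) = 1"
      using h(1,2) \<open>I \<noteq> 0\<close> by (simp add: nn_integral_divide I_def[symmetric] ennreal_divide_self less_top)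
  qed
qed

lemma transverse_nn_integral:
  assumes "f \<in> borel_measurable \<nu>" "w \<in> borel_measurable borel" "(\<integral>\<^sup>+ g. w g \<partial>m) = 1"
  shows "(\<integral>\<^sup>+ y. f y \<partial>\<nu>) =
    (\<integral>\<^sup>+ x. (\<integral>\<^sup>+ g. f (act g x) * w g \<partial>count_space (hit x)) \<partial>M)"
proof -
  have "f \<in> borel_measurable (restrict_space M Y)"
    using assms(1) measurable_cong_sets[OF sets_\<nu> refl] by blast
  then show ?thesis using transverse assms(2,3) unfolding transverse_measure_def by blast
qed

lemma sets_\<nu>_M: "N \<in> sets \<nu> \<Longrightarrow> N \<in> sets M"
  using cross_section_borel by (auto simp: sets_\<nu> sets_restrict_space)

text \<open>With the indicator of \<open>N\<close> in the defining formula of \<open>\<nu>\<close>,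
  the inner sum vanishes for almost every \<open>x\<close>.\<close>

lemma AE_\<nu>_if_AE_orbits:
  assumes N: "N \<in> sets \<nu>" and AE: "AE x in M. \<forall>g\<in>hit x. act g x \<notin> N"
  shows "AE y in \<nu>. y \<notin> N"
proof -
  obtain w :: "'g \<Rightarrow> ennreal" where w: "w \<in> borel_measurable borel" "(\<integral>\<^sup>+ g. w g \<partial>m) = 1"
    using ex_weight by metis
  have "emeasure \<nu> N = (\<integral>\<^sup>+ y. indicator N y \<partial>\<nu>)" using N by simp
  also have "\<dots> = (\<integral>\<^sup>+ x. (\<integral>\<^sup>+ g. indicator N (act g x) * w g \<partial>count_space (hit x)) \<partial>M)"
    by (rule transverse_nn_integral[OF _ w]) (use N in simp)
  also have "\<dots> = (\<integral>\<^sup>+ x. 0 \<partial>M)"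
  proof (rule nn_integral_cong_AE)
    show "AE x in M. (\<integral>\<^sup>+ g. indicator N (act g x) * w g \<partial>count_space (hit x)) = 0"
      using AE by eventually_elim (simp add: nn_integral_0_iff_AE AE_count_space indicator_def)
  qed
  finally have "N \<in> null_sets \<nu>" using N by auto
  then show ?thesis by (rule AE_not_in)
qed

lemma AE_orbits_if_AE_\<nu>:
  assumes "AE y in \<nu>. P y"
  shows "AE x in M. \<forall>g\<in>hit x. P (act g x)"
proof -
  obtain N where N: "N \<in> null_sets \<nu>" "{y \<in> Y. \<not> P y} \<subseteq> N"
    using assms unfolding eventually_ae_filter space_\<nu> by blast
  have NM: "N \<in> sets M" "N \<in> sets \<nu>" using N(1) sets_\<nu>_M by auto
  obtain w :: "'g \<Rightarrow> ennreal" where w: "w \<in> borel_measurable borel" "\<And>g. 0 < w g" "(\<integral>\<^sup>+ g. w g \<partial>m) = 1"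
    using ex_weight by metis
  obtain c :: "nat \<Rightarrow> 'x \<Rightarrow> 'g" and D :: "nat \<Rightarrow> 'x set"
    where c: "\<And>i. c i \<in> borel_measurable M" and D: "\<And>i. D i \<in> sets M"
    "\<And>i x. x \<in> D i \<Longrightarrow> c i x \<in> hit x"
    "AE x in M. bij_betw (\<lambda>i. c i x) {i. x \<in> D i} (hit x)"
    by (rule ex_enumeration[OF finite_measure_axioms refl]) (rule that)
  have "AE x in M. x \<in> D i \<longrightarrow> act (c i x) x \<notin> N" for i
  proof -
    \<comment> \<open>A single summand of the inner sum. It is measurable thanks to the enumeration,
      so its vanishing integral yields vanishing almost everywhere; positivity of \<open>w\<close>
      then excludes \<open>N\<close>.\<close>
    define r where "r x = indicator (D i) x * (indicator N (act (c i x) x) * w (c i x))" for x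
    have act_c: "(\<lambda>x. act (c i x) x) \<in> M \<rightarrow>\<^sub>M M"
      using measurable_compose[OF measurable_Pair[OF c measurable_ident_sets[OF refl]] act_measurable] by simp
    have r: "r \<in> borel_measurable M"
      unfolding r_def
      by (intro borel_measurable_times_ennreal borel_measurable_indicator D(1)
          measurable_compose[OF act_c borel_measurable_indicator[OF NM(1)]] measurable_compose[OF c w(1)])
    have "(\<integral>\<^sup>+ x. r x \<partial>M) \<le> (\<integral>\<^sup>+ x. (\<integral>\<^sup>+ g. indicator N (act g x) * w g \<partial>count_space (hit x)) \<partial>M)"
    proof (rule nn_integral_mono)
      fix x
      show "r x \<le> (\<integral>\<^sup>+ g. indicator N (act g x) * w g \<partial>count_space (hit x))"
        using nn_integral_ge_point[of "c i x" "hit x" "\<lambda>g. indicator N (act g x) * w g"] D(2)[of x i]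
        by (cases "x \<in> D i") (auto simp: r_def)
    qed
    also have "\<dots> = (\<integral>\<^sup>+ y. indicator N y \<partial>\<nu>)"
      by (rule transverse_nn_integral[OF _ w(1,3), symmetric]) (use NM in simp)
    also have "\<dots> = 0" using N(1) by (simp add: null_sets_def)
    finally have "AE x in M. r x = 0" using r by (simp add: nn_integral_0_iff_AE)
    moreover have "w g \<noteq> 0" for g using w(2)[of g] by simp
    ultimately show ?thesis
      by (auto elim!: eventually_mono simp: r_def indicator_def split: if_splits)
  qed
  then have "AE x in M. \<forall>i. x \<in> D i \<longrightarrow> act (c i x) x \<notin> N" by (simp add: AE_all_countable)
  with D(3) show ?thesis
  proof eventually_elim
    case (elim x)
    show ?case
    proof
      fix g assume g: "g \<in> hit x"
      then obtain i where "x \<in> D i" "g = c i x" using bij_betw_imp_surj_on[OF elim(1)] by blast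
      then have "act g x \<notin> N" using elim(2) by blast
      moreover have "act g x \<in> Y" using g by (simp add: hit_iff)
      ultimately show "P (act g x)" using N(2) by blast
    qed
  qed
qed

section \<open>Invariant extension of cochains to the ambient space\<close>

abbreviation "grp n \<equiv> PiM {..<n} (\<lambda>_. borel :: 'g measure)"

text \<open>The hitting set of \<open>act a x\<close> consists of the elements \<open>g - a\<close>
  with \<open>g\<close> in the hitting set of \<open>x\<close>, so this is the action on tuples that
  accompanies \<open>act a\<close> on points.\<close>

definition shift :: "nat \<Rightarrow> 'g \<Rightarrow> (nat \<Rightarrow> 'g) \<Rightarrow> nat \<Rightarrow> 'g" where
  "shift n a h = (\<lambda>i\<in>{..<n}. h i - a)"

definition hit_region :: "nat \<Rightarrow> ('x \<times> (nat \<Rightarrow> 'g)) set" where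
  "hit_region n = {(x, h) \<in> space (M \<Otimes>\<^sub>M grp n). \<forall>i<n. act (h i) x \<in> Y}"

text \<open>
  The point \<open>x\<close> need not lie in \<open>Y\<close>, so the tuple is moved to the target \<open>act (h 0) x\<close>, where its first
  arrow becomes a unit.
\<close>

definition based :: "nat \<Rightarrow> 'x \<Rightarrow> (nat \<Rightarrow> 'g) \<Rightarrow> nat \<Rightarrow> 'g \<times> 'x" where
  "based n x h = (\<lambda>i\<in>{..<n}. (h 0 - h i, act (h i) x))"

text \<open>Evaluating \<open>f\<close> on the based tuple makes invariance exact at every point, as
  the differences \<open>h 0 - h i\<close> and the points \<open>act (h i) x\<close> do not change
  under a simultaneous translation. Truncation at an essential bound \<open>C\<close> makes the
  extension bounded everywhere.\<close>

definition orbit_ext :: "((nat \<Rightarrow> 'g \<times> 'x) \<Rightarrow> real) \<Rightarrow> real \<Rightarrow> nat \<Rightarrow> 'x \<Rightarrow> (nat \<Rightarrow> 'g) \<Rightarrow> real" where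
  "orbit_ext f C n x h = (if (x, h) \<in> hit_region n then max (- C) (min C (f (based n x h))) else 0)"

definition shift_invariant :: "nat \<Rightarrow> ('x \<Rightarrow> (nat \<Rightarrow> 'g) \<Rightarrow> real) \<Rightarrow> bool" where
  "shift_invariant n F \<longleftrightarrow>
     (\<forall>x\<in>space M. \<forall>h\<in>{..<n} \<rightarrow>\<^sub>E UNIV. \<forall>a. F (act a x) (shift n a h) = F x h)"

lemma space_grp: "space (grp n) = {..<n} \<rightarrow>\<^sub>E UNIV"
  by (simp add: space_PiM)

lemma hits_space: "h \<in> hits n x \<Longrightarrow> h \<in> {..<n} \<rightarrow>\<^sub>E UNIV"
  by (auto simp: hits_def PiE_iff)

lemma hit_region_iff: "x \<in> space M \<Longrightarrow> (x, h) \<in> hit_region n \<longleftrightarrow> h \<in> hits n x"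
  by (auto simp: hit_region_def space_pair_measure space_grp hits_def hit_iff PiE_iff)

lemma act_component_measurable:
  assumes "i < n"
  shows "(\<lambda>p. act (snd p i) (fst p)) \<in> M \<Otimes>\<^sub>M grp n \<rightarrow>\<^sub>M M"
proof -
  have "(\<lambda>p. (snd p i, fst p)) \<in> M \<Otimes>\<^sub>M grp n \<rightarrow>\<^sub>M borel \<Otimes>\<^sub>M M"
    using assms by (intro measurable_Pair measurable_compose[OF measurable_snd] measurable_component_singleton) auto
  from measurable_compose[OF this act_measurable] show ?thesis by simp
qed

lemma component_measurable: "i < n \<Longrightarrow> (\<lambda>p. snd p i) \<in> borel_measurable (M \<Otimes>\<^sub>M grp n)"
  by (intro measurable_compose[OF measurable_snd] measurable_component_singleton) auto

lemma hit_region_sets: "hit_region n \<in> sets (M \<Otimes>\<^sub>M grp n)"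
proof -
  have "hit_region n = {p \<in> space (M \<Otimes>\<^sub>M grp n). \<forall>i\<in>{..<n}. act (snd p i) (fst p) \<in> Y}"
    by (auto simp: hit_region_def)
  also have "\<dots> \<in> sets (M \<Otimes>\<^sub>M grp n)"
  proof (rule sets.sets_Collect_finite_All)
    fix i assume "i \<in> {..<n}"
    then have "(\<lambda>p. act (snd p i) (fst p)) -` Y \<inter> space (M \<Otimes>\<^sub>M grp n) \<in> sets (M \<Otimes>\<^sub>M grp n)"
      using measurable_sets[OF act_component_measurable cross_section_borel] by simp
    then show "{p \<in> space (M \<Otimes>\<^sub>M grp n). act (snd p i) (fst p) \<in> Y} \<in> sets (M \<Otimes>\<^sub>M grp n)"
      by (simp add: vimage_def Int_def conj_commute)
  qed auto
  finally show ?thesis .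
qed

lemma based_tup:
  assumes "0 < n" "x \<in> space M"
  shows "based n x h = tup n (act (h 0) x) (shift n (h 0) h)"
proof
  fix i
  have "act (h i - h 0) (act (h 0) x) = act (h i) x"
    using act_add[OF assms(2), of "h i - h 0" "h 0"] by simp
  then show "based n x h i = tup n (act (h 0) x) (shift n (h 0) h) i"
    by (simp add: based_def tup_def shift_def)
qed

lemma shift_hits:
  assumes "x \<in> space M" "h \<in> hits n x"
  shows "shift n a h \<in> hits n (act a x)"
proof -
  have "act (h i - a) (act a x) = act (h i) x" for i
    using act_add[OF assms(1), of "h i - a" a] by simp
  then have "act (h i - a) (act a x) \<in> Y" if "i < n" for i
    using assms(2) that by (simp add: hits_def hit_iff PiE_iff)
  then show ?thesis by (auto simp: hits_def shift_def hit_iff)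
qed

lemma shift_shift: "shift n a (shift n b h) = shift n (a + b) h"
  by (auto simp: shift_def diff_conv_add_uminus minus_add add.assoc simp del: add_uminus_conv_diff)

lemma shift_zero: "h \<in> {..<n} \<rightarrow>\<^sub>E UNIV \<Longrightarrow> shift n 0 h = h"
  by (auto simp: shift_def PiE_def extensional_def)

lemma shift_uminus: "h \<in> {..<n} \<rightarrow>\<^sub>E UNIV \<Longrightarrow> shift n (- a) (shift n a h) = h"
  by (simp add: shift_shift shift_zero)

lemma shift_space: "shift n a h \<in> {..<n} \<rightarrow>\<^sub>E UNIV"
  by (simp add: shift_def)

lemma based_in_tuples:
  assumes n: "0 < n" and x: "x \<in> space M" and h: "h \<in> hits n x"
  shows "based n x h \<in> tuples \<G> n"
proof -
  have "act (h 0) x \<in> Y" using h n by (auto simp: hits_def hit_iff PiE_iff)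
  then show ?thesis
    unfolding based_tup[OF n x] by (rule tup_in_tuples[OF n _ shift_hits[OF x h]])
qed

lemma orbit_ext_bounded: "0 \<le> C \<Longrightarrow> \<bar>orbit_ext f C n x h\<bar> \<le> C"
  by (auto simp: orbit_ext_def abs_le_iff min_def max_def)

lemma orbit_ext_measurable:
  assumes n: "0 < n" and f: "f \<in> borel_measurable (tuple_measure \<G> n)"
  shows "(\<lambda>(x, h). orbit_ext f C n x h) \<in> borel_measurable (M \<Otimes>\<^sub>M grp n)"
proof -
  have "(\<lambda>\<gamma>. max (- C) (min C (f \<gamma>))) \<in> borel_measurable (tuple_measure \<G> n)"
    using f by (intro borel_measurable_max borel_measurable_min borel_measurable_const)
  then have "(\<lambda>p. if p \<in> hit_region n then max (- C) (min C (f (based n (fst p) (snd p)))) else 0)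
      \<in> borel_measurable (M \<Otimes>\<^sub>M grp n)"
  proof (rule measurable_pullback_tuples[OF _ hit_region_sets])
    fix i assume i: "i < n"
    then have "(\<lambda>p. (snd p 0 - snd p i, act (snd p i) (fst p))) \<in> M \<Otimes>\<^sub>M grp n \<rightarrow>\<^sub>M borel \<Otimes>\<^sub>M M"
      by (intro measurable_Pair borel_measurable_diff_group act_component_measurable component_measurable) auto
    then show "(\<lambda>p. based n (fst p) (snd p) i) \<in> M \<Otimes>\<^sub>M grp n \<rightarrow>\<^sub>M borel \<Otimes>\<^sub>M M"
      using i by (simp add: based_def)
  next
    fix p assume p: "p \<in> hit_region n"
    then have "fst p \<in> space M" by (auto simp: hit_region_def space_pair_measure)
    with p show "based n (fst p) (snd p) \<in> tuples \<G> n"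
      using based_in_tuples[OF n] hit_region_iff by (metis prod.collapse)
  qed
  then show ?thesis by (simp add: orbit_ext_def case_prod_unfold)
qed

lemma shift_invariant_orbit_ext:
  assumes "0 < n"
  shows "shift_invariant n (orbit_ext f C n)"
  unfolding shift_invariant_def
proof (intro ballI allI)
  fix x :: 'x and h :: "nat \<Rightarrow> 'g" and a :: 'g
  assume x: "x \<in> space M" and h: "h \<in> {..<n} \<rightarrow>\<^sub>E UNIV"
  have act: "act (h i - a) (act a x) = act (h i) x" for i
    using act_add[OF x, of "h i - a" a] by simp
  have "based n (act a x) (shift n a h) = based n x h"
  proof
    fix i
    have "(h 0 - a) - (h i - a) = h 0 - h i"
      by (simp add: diff_conv_add_uminus minus_add add.assoc del: add_uminus_conv_diff)
    then show "based n (act a x) (shift n a h) i = based n x h i"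
      using assms by (simp add: based_def shift_def act)
  qed
  moreover have "(act a x, shift n a h) \<in> hit_region n \<longleftrightarrow> (x, h) \<in> hit_region n"
    using shift_hits[OF x, of h n a] shift_hits[OF act_space[OF x], of "shift n a h" n a "- a"]
      shift_uminus[OF h] act_uminus[OF x] hit_region_iff[OF x] hit_region_iff[OF act_space[OF x]] by metis
  ultimately show "orbit_ext f C n (act a x) (shift n a h) = orbit_ext f C n x h"
    by (simp add: orbit_ext_def)
qed

text \<open>Invariance of \<open>f\<close> under the first arrow of the tuple itself turns the tuple
  into the based one; truncation has no effect off a null set.\<close>

lemma cochain_orbit_ext:
  assumes f: "f \<in> cochains \<G> k" and C: "AE \<gamma> in tuple_measure \<G> (Suc k). \<bar>f \<gamma>\<bar> \<le> C"
  shows "AE y in \<nu>. \<forall>h\<in>hits (Suc k) y. f (tup (Suc k) y h) = orbit_ext f C (Suc k) y h"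
proof -
  have "AE \<gamma>s in tuple_measure \<G> (Suc k).
          \<forall>\<gamma> \<in> space (arrows \<G>). tgt \<G> \<gamma> = tgt \<G> (\<gamma>s 0) \<longrightarrow>
            f (\<lambda>i\<in>{..<Suc k}. comp \<G> (ginv \<G> \<gamma>) (\<gamma>s i)) = f \<gamma>s"
    using f unfolding cochains_def by blast
  from AE_tuple_measureD[OF zero_less_Suc this] AE_tuple_measureD[OF zero_less_Suc C] AE_space
  show ?thesis
  proof eventually_elim
    case (elim y)
    then have y: "y \<in> Y" by (simp add: space_\<nu>)
    show ?case
    proof
      fix h assume h: "h \<in> hits (Suc k) y"
      let ?\<gamma> = "tup (Suc k) y h 0"
      have \<gamma>: "?\<gamma> = (- h 0, act (h 0) y)" by (simp add: tup_def)
      have "act (h 0) y \<in> Y" using h by (auto simp: hits_def hit_iff PiE_iff)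
      then have "?\<gamma> \<in> space (arrows \<G>)"
        unfolding space_arrows \<gamma> using y act_uminus[OF Y_space[OF y]] by simp
      with elim(1) h have "f (\<lambda>i\<in>{..<Suc k}. comp \<G> (ginv \<G> ?\<gamma>) (tup (Suc k) y h i)) = f (tup (Suc k) y h)"
        by blast
      moreover have "(\<lambda>i\<in>{..<Suc k}. comp \<G> (ginv \<G> ?\<gamma>) (tup (Suc k) y h i)) = based (Suc k) y h"
        by (auto simp: \<gamma> tup_def based_def)
      ultimately have "f (based (Suc k) y h) = f (tup (Suc k) y h)" by simp
      moreover have "\<bar>f (tup (Suc k) y h)\<bar> \<le> C" using elim(2) h by blast
      ultimately show "f (tup (Suc k) y h) = orbit_ext f C (Suc k) y h"
        using hit_region_iff[OF Y_space[OF y]] h by (auto simp: orbit_ext_def abs_le_iff)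
    qed
  qed
qed

lemma omit_tup: "j \<le> n \<Longrightarrow> omit n j (tup (Suc n) y h) = tup n y (omit n j h)"
  by (auto simp: omit_def tup_def)

lemma omit_hits: "j \<le> n \<Longrightarrow> h \<in> hits (Suc n) x \<Longrightarrow> omit n j h \<in> hits n x"
  by (auto simp: omit_def hits_def PiE_iff)

lemma omit_shift: "j \<le> n \<Longrightarrow> omit n j (shift (Suc n) a h) = shift n a (omit n j h)"
  by (auto simp: omit_def shift_def)

lemma hit_nonempty:
  assumes "x \<in> space M"
  obtains g where "g \<in> hit x"
proof -
  obtain g y where "y \<in> Y" "x = act g y" using assms cross_section_full by blast
  then have "- g \<in> hit x" using act_uminus[OF Y_space] by (simp add: hit_iff)
  then show thesis by (rule that)
qed

text \<open>Over the cross section this is the cocycle relation of \<open>f\<close>. Every point of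
  the ambient space is moved into \<open>Y\<close> by some \<open>g\<close>, and strict invariance
  of the extension carries the relation back.\<close>

lemma cocycle_orbit_ext:
  assumes f: "f \<in> cocycles \<G> k" and C: "AE \<gamma> in tuple_measure \<G> (Suc k). \<bar>f \<gamma>\<bar> \<le> C"
  shows "AE x in M. \<forall>h\<in>hits (Suc (Suc k)) x.
    (\<Sum>j\<le>Suc k. (- 1) ^ j * orbit_ext f C (Suc k) x (omit (Suc k) j h)) = 0"
proof -
  have fc: "f \<in> cochains \<G> k" and "AE \<gamma> in tuple_measure \<G> (Suc (Suc k)). differential k f \<gamma> = 0"
    using f by (auto simp: cocycles_def)
  from AE_tuple_measureD[OF zero_less_Suc this(2)] cochain_orbit_ext[OF fc C]
  have "AE y in \<nu>. \<forall>h\<in>hits (Suc (Suc k)) y.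
      (\<Sum>j\<le>Suc k. (- 1) ^ j * orbit_ext f C (Suc k) y (omit (Suc k) j h)) = 0"
  proof eventually_elim
    case (elim y)
    show ?case
    proof
      fix h assume h: "h \<in> hits (Suc (Suc k)) y"
      have "(\<Sum>j\<le>Suc k. (- 1) ^ j * orbit_ext f C (Suc k) y (omit (Suc k) j h)) =
          differential k f (tup (Suc (Suc k)) y h)"
        unfolding differential_def
      proof (rule sum.cong[OF refl])
        fix j assume "j \<in> {..Suc k}"
        then show "(- 1) ^ j * orbit_ext f C (Suc k) y (omit (Suc k) j h) =
            (- 1) ^ j * f (omit (Suc k) j (tup (Suc (Suc k)) y h))"
          using elim(2) omit_hits[OF _ h, of j] omit_tup[of j "Suc k" y h] by simp
      qed
      then show "(\<Sum>j\<le>Suc k. (- 1) ^ j * orbit_ext f C (Suc k) y (omit (Suc k) j h)) = 0"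
        using elim(1) h by simp
    qed
  qed
  from AE_orbits_if_AE_\<nu>[OF this] AE_space show ?thesis
  proof eventually_elim
    case (elim x)
    obtain g where g: "g \<in> hit x" using hit_nonempty[OF elim(2)] .
    show ?case
    proof
      fix h assume h: "h \<in> hits (Suc (Suc k)) x"
      have "orbit_ext f C (Suc k) x (omit (Suc k) j h) =
          orbit_ext f C (Suc k) (act g x) (omit (Suc k) j (shift (Suc (Suc k)) g h))" if "j \<le> Suc k" for j
        using shift_invariant_orbit_ext[of "Suc k" f C] hits_space[OF omit_hits[OF that h]] elim(2)
        unfolding shift_invariant_def omit_shift[OF that] by simp
      then have "(\<Sum>j\<le>Suc k. (- 1) ^ j * orbit_ext f C (Suc k) x (omit (Suc k) j h)) =
          (\<Sum>j\<le>Suc k. (- 1) ^ j * orbit_ext f C (Suc k) (act g x) (omit (Suc k) j (shift (Suc (Suc k)) g h)))"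
        by (intro sum.cong) auto
      then show "(\<Sum>j\<le>Suc k. (- 1) ^ j * orbit_ext f C (Suc k) x (omit (Suc k) j h)) = 0"
        using elim(1) g shift_hits[OF elim(2) h] by simp
    qed
  qed
qed

section \<open>Averaging a cocycle\<close>

definition cons :: "nat \<Rightarrow> 'g \<Rightarrow> (nat \<Rightarrow> 'g) \<Rightarrow> nat \<Rightarrow> 'g" where
  "cons n g h = (\<lambda>i\<in>{..<Suc n}. if i = 0 then g else h (i - 1))"

lemma cons_space: "cons n g h \<in> {..<Suc n} \<rightarrow>\<^sub>E UNIV"
  by (simp add: cons_def)

lemma cons_hits: "g \<in> hit x \<Longrightarrow> h \<in> hits n x \<Longrightarrow> cons n g h \<in> hits (Suc n) x"
  by (auto simp: cons_def hits_def PiE_iff)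

lemma omit_zero_cons: "h \<in> {..<n} \<rightarrow>\<^sub>E UNIV \<Longrightarrow> omit n 0 (cons n g h) = h"
  by (auto simp: omit_def cons_def PiE_def extensional_def)

lemma omit_Suc_cons: "j \<le> n \<Longrightarrow> omit (Suc n) (Suc j) (cons (Suc n) g h) = cons n g (omit n j h)"
proof
  fix i assume "j \<le> n"
  then show "omit (Suc n) (Suc j) (cons (Suc n) g h) i = cons n g (omit n j h) i"
    by (cases i) (auto simp: omit_def cons_def)
qed

lemma shift_cons: "shift (Suc n) a (cons n g h) = cons n (g - a) (shift n a h)"
proof
  fix i show "shift (Suc n) a (cons n g h) i = cons n (g - a) (shift n a h) i"
    by (cases i) (auto simp: shift_def cons_def)
qed

lemma pts_omit: "j \<le> n \<Longrightarrow> pts c n (omit n j i) x = omit n j (pts c (Suc n) i x)"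
  by (auto simp: pts_def omit_def)

lemma omit_idx: "omit n j i \<in> idx n"
  by (simp add: idx_def omit_def)

lemma doms_omit: "j \<le> n \<Longrightarrow> x \<in> doms D (Suc n) i \<Longrightarrow> x \<in> doms D n (omit n j i)"
  by (auto simp: doms_def omit_def)

lemma act_diff:
  assumes "x \<in> space M"
  shows "act (s - g) x = act s (act (- g) x)"
  using act_add[OF assms, of s "- g"] by simp

text \<open>The inverse of the enumeration by \<open>pts\<close>. Taking least indices defines it
  for all pairs of a point and a tuple, including tuples outside the hitting set, and keeps it
  measurable.\<close>

definition index :: "(nat \<Rightarrow> 'x \<Rightarrow> 'g) \<Rightarrow> (nat \<Rightarrow> 'x set) \<Rightarrow> nat \<Rightarrow> 'x \<Rightarrow> (nat \<Rightarrow> 'g) \<Rightarrow> nat \<Rightarrow> nat" where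
  "index c D n x h = (\<lambda>l\<in>{..<n}. LEAST j. x \<in> D j \<and> c j x = h l)"

lemma index_pts:
  assumes inj: "inj_on (\<lambda>i. c i x) {i. x \<in> D i}" and i: "i \<in> idx n" "x \<in> doms D n i"
  shows "index c D n x (pts c n i x) = i"
proof
  fix l show "index c D n x (pts c n i x) l = i l"
  proof (cases "l < n")
    case True
    then have "x \<in> D (i l)" using i by (simp add: doms_def)
    then have "(LEAST j. x \<in> D j \<and> c j x = c (i l) x) = i l"
      using inj by (intro Least_equality) (auto dest: inj_onD)
    then show ?thesis using True by (simp add: index_def pts_def)
  next
    case False
    then show ?thesis using i by (auto simp: index_def idx_def PiE_def extensional_def)
  qed
qed

lemma index_measurable:
  assumes c: "\<And>i. c i \<in> borel_measurable M" and D: "\<And>i. D i \<in> sets M"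
  shows "(\<lambda>p. index c D n (fst p) (snd p)) \<in> M \<Otimes>\<^sub>M grp n \<rightarrow>\<^sub>M count_space (idx n)"
proof -
  have L: "(\<lambda>p. LEAST j. fst p \<in> D j \<and> c j (fst p) = snd p l) \<in> M \<Otimes>\<^sub>M grp n \<rightarrow>\<^sub>M count_space UNIV"
    if l: "l < n" for l
  proof (rule measurable_Least)
    fix j
    have "{p \<in> space (M \<Otimes>\<^sub>M grp n). c j (fst p) = snd p l} \<in> sets (M \<Otimes>\<^sub>M grp n)"
      by (intro measurable_equality_set measurable_compose[OF measurable_fst c] component_measurable l)
    moreover have "{p \<in> space (M \<Otimes>\<^sub>M grp n). fst p \<in> D j} \<in> sets (M \<Otimes>\<^sub>M grp n)"
      using measurable_sets[OF measurable_fst[of M "grp n"] D[of j]] by (simp add: vimage_def Int_def conj_commute)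
    ultimately have "{p \<in> space (M \<Otimes>\<^sub>M grp n). fst p \<in> D j \<and> c j (fst p) = snd p l} \<in> sets (M \<Otimes>\<^sub>M grp n)"
      by (intro sets.sets_Collect_conj)
    then show "(\<lambda>p. fst p \<in> D j \<and> c j (fst p) = snd p l) \<in> M \<Otimes>\<^sub>M grp n \<rightarrow>\<^sub>M count_space UNIV"
      by (simp add: pred_def)
  qed
  show ?thesis
    unfolding measurable_count_space_eq_countable[OF countable_idx]
  proof (intro conjI ballI)
    show "(\<lambda>p. index c D n (fst p) (snd p)) \<in> space (M \<Otimes>\<^sub>M grp n) \<rightarrow> idx n"
      by (simp add: index_def idx_def)
    fix i assume i: "i \<in> idx n"
    have "index c D n (fst p) (snd p) = i \<longleftrightarrow>
        (\<forall>l\<in>{..<n}. (LEAST j. fst p \<in> D j \<and> c j (fst p) = snd p l) = i l)" for p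
    proof
      assume "index c D n (fst p) (snd p) = i"
      then show "\<forall>l\<in>{..<n}. (LEAST j. fst p \<in> D j \<and> c j (fst p) = snd p l) = i l"
        by (auto simp: index_def)
    next
      assume "\<forall>l\<in>{..<n}. (LEAST j. fst p \<in> D j \<and> c j (fst p) = snd p l) = i l"
      then show "index c D n (fst p) (snd p) = i"
        using i by (intro ext) (auto simp: index_def idx_def PiE_def extensional_def)
    qed
    then have "(\<lambda>p. index c D n (fst p) (snd p)) -` {i} \<inter> space (M \<Otimes>\<^sub>M grp n) =
        {p \<in> space (M \<Otimes>\<^sub>M grp n). \<forall>l\<in>{..<n}. (LEAST j. fst p \<in> D j \<and> c j (fst p) = snd p l) = i l}"
      by auto
    also have "\<dots> \<in> sets (M \<Otimes>\<^sub>M grp n)"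
    proof (rule sets.sets_Collect_finite_All)
      fix l assume "l \<in> {..<n}"
      then show "{p \<in> space (M \<Otimes>\<^sub>M grp n). (LEAST j. fst p \<in> D j \<and> c j (fst p) = snd p l) = i l} \<in> sets (M \<Otimes>\<^sub>M grp n)"
        using measurable_sets[OF L, of l "{i l}"] by (simp add: vimage_def Int_def conj_commute)
    qed simp
    finally show "(\<lambda>p. index c D n (fst p) (snd p)) -` {i} \<inter> space (M \<Otimes>\<^sub>M grp n) \<in> sets (M \<Otimes>\<^sub>M grp n)" .
  qed
qed

text \<open>For each multi-index the kernel has its own conditional mean, and \<open>H\<close> finds
  the right one through \<open>index\<close>. Invariance and the homotopy formula are linear
  relations between finitely many kernels, so both pass to the conditional means for each choice of
  indices, and there are countably many choices.\<close>

lemma averaged_cochain: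
  assumes F: "(\<lambda>(x, h). F x h) \<in> borel_measurable (M \<Otimes>\<^sub>M grp (Suc n))"
    and C: "\<And>x h. \<bar>F x h\<bar> \<le> C" and inv: "shift_invariant (Suc n) F"
    and cocycle: "AE x in M. \<forall>h\<in>hits (Suc (Suc n)) x. (\<Sum>j\<le>Suc n. (- 1) ^ j * F x (omit (Suc n) j h)) = 0"
  obtains H where "(\<lambda>(x, h). H x h) \<in> borel_measurable (M \<Otimes>\<^sub>M grp n)" "\<And>x h. \<bar>H x h\<bar> \<le> C"
    "\<And>a. AE x in M. \<forall>h\<in>hits n x. H (act a x) (shift n a h) = H x h"
    "AE x in M. \<forall>h\<in>hits (Suc n) x. F x h = (\<Sum>j\<le>n. (- 1) ^ j * H x (omit n j h))"
proof -
  obtain c :: "nat \<Rightarrow> 'x \<Rightarrow> 'g" and D :: "nat \<Rightarrow> 'x set"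
    where c: "\<And>i. c i \<in> borel_measurable M" and D: "\<And>i. D i \<in> sets M"
    and cD: "\<And>i x. x \<in> D i \<Longrightarrow> c i x \<in> hit x"
    and bij: "AE x in M. bij_betw (\<lambda>i. c i x) {i. x \<in> D i} (hit x)"
    by (rule ex_enumeration[OF finite_measure_axioms refl]) (rule that)
  define s where "s x = c (LEAST i. x \<in> D i) x" for x
  have s[measurable]: "s \<in> borel_measurable M"
  proof -
    have "(\<lambda>x. LEAST i. x \<in> D i) \<in> M \<rightarrow>\<^sub>M count_space UNIV"
      using D by (intro measurable_Least) (auto simp: pred_def)
    from measurable_compose_countable[of c M borel, OF c this] show ?thesis unfolding s_def .
  qed
  have s_hit: "AE x in M. s x \<in> hit x"
    using bij AE_space
  proof eventually_elim
    case (elim x)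
    obtain g where "g \<in> hit x" using hit_nonempty[OF elim(2)] .
    then have "\<exists>i. x \<in> D i" using bij_betw_imp_surj_on[OF elim(1)] by blast
    then have "x \<in> D (LEAST i. x \<in> D i)" by (rule LeastI_ex)
    then show ?case unfolding s_def by (rule cD)
  qed
  \<comment> \<open>With the multi-index \<open>i\<close> fixed, the tuple is a measurable function
    of \<open>x\<close> alone, as the conditional mean requires.\<close>
  define \<Psi> where "\<Psi> i g x = F x (cons n (s (act (- g) x) - g) (pts c n i x))" for i g x
  have \<Psi>: "bounded_kernel (\<Psi> i)" for i
    unfolding bounded_kernel_def
  proof
    have sg: "(\<lambda>p. s (act (- fst p) (snd p)) - fst p) \<in> borel_measurable (borel \<Otimes>\<^sub>M M)"
    proof (intro borel_measurable_diff_group measurable_compose[OF _ s] measurable_fst)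
      have "(\<lambda>p. (- fst p, snd p)) \<in> (borel :: 'g measure) \<Otimes>\<^sub>M M \<rightarrow>\<^sub>M borel \<Otimes>\<^sub>M M"
        by (intro measurable_Pair borel_measurable_uminus_group measurable_fst measurable_snd)
      from measurable_compose[OF this act_measurable]
      show "(\<lambda>p. act (- fst p) (snd p)) \<in> borel \<Otimes>\<^sub>M M \<rightarrow>\<^sub>M M" by simp
    qed
    have "(\<lambda>p. (snd p, cons n (s (act (- fst p) (snd p)) - fst p) (pts c n i (snd p))))
        \<in> borel \<Otimes>\<^sub>M M \<rightarrow>\<^sub>M M \<Otimes>\<^sub>M grp (Suc n)"
    proof (intro measurable_Pair measurable_snd)
      show "(\<lambda>p. cons n (s (act (- fst p) (snd p)) - fst p) (pts c n i (snd p))) \<in> borel \<Otimes>\<^sub>M M \<rightarrow>\<^sub>M grp (Suc n)"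
        unfolding cons_def
      proof (rule measurable_restrict)
        fix l assume l: "l \<in> {..<Suc n}"
        show "(\<lambda>p. if l = 0 then s (act (- fst p) (snd p)) - fst p else pts c n i (snd p) (l - 1)) \<in> borel_measurable (borel \<Otimes>\<^sub>M M)"
        proof (cases "l = 0")
          case False
          then have "(\<lambda>p. c (i (l - 1)) (snd p)) \<in> borel_measurable (borel \<Otimes>\<^sub>M M)"
            by (intro measurable_compose[OF measurable_snd c])
          then show ?thesis using False l by (simp add: pts_def less_diff_conv2)
        qed (use sg in simp)
      qed
    qed
    from measurable_compose[OF this F]
    show "(\<lambda>(g, x). \<Psi> i g x) \<in> borel_measurable (borel \<Otimes>\<^sub>M M)"
      by (simp add: \<Psi>_def case_prod_unfold)
    show "\<exists>C. \<forall>g x. \<bar>\<Psi> i g x\<bar> \<le> C" using C by (auto simp: \<Psi>_def)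
  qed
  have "\<exists>\<psi>. cond_mean (\<Psi> i) \<psi> \<and> (\<forall>x. \<bar>\<psi> x\<bar> \<le> C)" for i
    by (rule ex_cond_mean[OF \<Psi>]) (simp add: \<Psi>_def C)
  from choice[OF allI[OF this]] obtain \<psi> where "\<forall>i. cond_mean (\<Psi> i) (\<psi> i) \<and> (\<forall>x. \<bar>\<psi> i x\<bar> \<le> C)"
    by (rule exE)
  then have \<psi>: "cond_mean (\<Psi> i) (\<psi> i)" and \<psi>_le: "\<bar>\<psi> i x\<bar> \<le> C" for i x by simp_all
  define H where "H x h = \<psi> (index c D n x h) x" for x h
  have H_pts: "H x (pts c n i x) = \<psi> i x"
    if "bij_betw (\<lambda>i. c i x) {i. x \<in> D i} (hit x)" "i \<in> idx n" "x \<in> doms D n i" for x i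
    unfolding H_def index_pts[of c x D, OF bij_betw_imp_inj_on[OF that(1)] that(2,3)] ..
  show thesis
  proof (rule that)
    have "(\<lambda>p. \<psi> (index c D n (fst p) (snd p)) (fst p)) \<in> borel_measurable (M \<Otimes>\<^sub>M grp n)"
    proof (rule measurable_compose_countable'[OF _ index_measurable[OF c D] countable_idx])
      show "(\<lambda>p. \<psi> i (fst p)) \<in> borel_measurable (M \<Otimes>\<^sub>M grp n)" for i
        using \<psi>[of i] by (intro measurable_compose[OF measurable_fst]) (simp add: cond_mean_def)
    qed
    then show "(\<lambda>(x, h). H x h) \<in> borel_measurable (M \<Otimes>\<^sub>M grp n)"
      by (simp add: H_def case_prod_unfold)
    show "\<bar>H x h\<bar> \<le> C" for x h by (simp add: H_def \<psi>_le)
  next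
    fix a
    \<comment> \<open>The enumeration is not equivariant: the shifted tuple at
      \<open>act a x\<close> has another multi-index \<open>i'\<close>, which depends on
      \<open>x\<close>. All pairs are treated, each on the set \<open>E\<close> where the two tuples
      correspond.\<close>
    have "AE x in M. x \<in> doms D n i \<and> act a x \<in> doms D n i' \<and> (\<forall>l\<in>{..<n}. c (i' l) (act a x) = c (i l) x - a) \<longrightarrow>
        \<psi> i' (act a x) = \<psi> i x" for i i'
    proof -
      define E where "E = {x \<in> space M. x \<in> doms D n i \<and> act a x \<in> doms D n i' \<and>
        (\<forall>l\<in>{..<n}. c (i' l) (act a x) = c (i l) x - a)}"
      have "E \<in> sets M"
      proof -
        have "{x \<in> space M. x \<in> doms D n i} \<in> sets M" using doms_sets[of D n i, OF D] by simp
        moreover have "{x \<in> space M. act a x \<in> doms D n i'} \<in> sets M"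
          using measurable_sets[OF act_measurable1[of a] doms_sets[of D n i', OF D]]
          by (simp add: vimage_def Int_def conj_commute)
        moreover have "{x \<in> space M. \<forall>l\<in>{..<n}. c (i' l) (act a x) = c (i l) x - a} \<in> sets M"
          by (intro sets.sets_Collect_finite_All measurable_equality_set borel_measurable_diff_group
              measurable_compose[OF act_measurable1 c] c) auto
        ultimately show ?thesis unfolding E_def by (intro sets.sets_Collect_conj)
      qed
      let ?\<Psi> = "\<lambda>b g x. if b then \<Psi> i' (a + g) (act a x) else \<Psi> i g x"
      let ?\<psi> = "\<lambda>b x. if b then \<psi> i' (act a x) else \<psi> i x"
      \<comment> \<open>Equality of two conditional means, written as a relation with coefficients 1
        and -1 over the index set \<open>bool\<close>.\<close>
      have "AE x in M. x \<in> E \<longrightarrow> (\<Sum>b\<in>UNIV. (if b then 1 else - 1) * ?\<psi> b x) = 0"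
      proof (rule cond_mean_sum_AE[of UNIV ?\<Psi> ?\<psi> E "\<lambda>_. 0" 0 "\<lambda>b. if b then 1 else - 1"])
        fix b :: bool
        show "bounded_kernel (?\<Psi> b)"
          by (cases b) (simp_all add: \<Psi> bounded_kernel_translate)
        show "cond_mean (?\<Psi> b) (?\<psi> b)"
          by (cases b) (simp_all add: \<psi> cond_mean_translate[OF \<Psi> \<psi>])
      next
        fix g
        have "\<Psi> i' (a + g) (act a x) = \<Psi> i g x" if x: "x \<in> E" for x
        proof -
          have xM: "x \<in> space M" using x by (simp add: E_def)
          \<comment> \<open>The selection \<open>s\<close> is read at the same point before and
            after the translation, so the inserted element changes by \<open>- a\<close> only, as do
            the other entries.\<close>
          have "act (- (a + g)) (act a x) = act (- g) x"
            using act_add[OF xM, of "- (a + g)" a] by (simp add: minus_add add.assoc)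
          moreover have "pts c n i' (act a x) = shift n a (pts c n i x)"
            using x by (auto simp: E_def pts_def shift_def)
          moreover have "s (act (- g) x) - (a + g) = s (act (- g) x) - g - a"
            by (simp add: diff_conv_add_uminus minus_add add.assoc del: add_uminus_conv_diff)
          ultimately have "\<Psi> i' (a + g) (act a x) =
              F (act a x) (shift (Suc n) a (cons n (s (act (- g) x) - g) (pts c n i x)))"
            by (simp add: \<Psi>_def shift_cons)
          also have "\<dots> = \<Psi> i g x"
            using inv xM cons_space unfolding shift_invariant_def \<Psi>_def by blast
          finally show ?thesis .
        qed
        then show "AE x in M. x \<in> E \<longrightarrow> (\<Sum>b\<in>UNIV. (if b then 1 else - 1) * ?\<Psi> b g x) = 0"
          by (intro AE_I2) (simp add: UNIV_bool)
      qed (use \<open>E \<in> sets M\<close> in auto)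
      with AE_space show ?thesis
        by eventually_elim (simp add: E_def UNIV_bool)
    qed
    then have "AE x in M. \<forall>i\<in>idx n. \<forall>i'\<in>idx n. x \<in> doms D n i \<and> act a x \<in> doms D n i' \<and>
        (\<forall>l\<in>{..<n}. c (i' l) (act a x) = c (i l) x - a) \<longrightarrow> \<psi> i' (act a x) = \<psi> i x"
      by (simp only: AE_ball_countable[OF countable_idx]) simp
    with bij AE_act[OF bij, of a] AE_space
    show "AE x in M. \<forall>h\<in>hits n x. H (act a x) (shift n a h) = H x h"
    proof eventually_elim
      case (elim x)
      show ?case
      proof
        fix h assume h: "h \<in> hits n x"
        obtain i where i: "i \<in> idx n" "x \<in> doms D n i" "h = pts c n i x"
          using bij_betw_imp_surj_on[OF bij_betw_hits[of x c D, OF elim(3,1)]] h by blast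
        obtain i' where i': "i' \<in> idx n" "act a x \<in> doms D n i'" "shift n a h = pts c n i' (act a x)"
          using bij_betw_imp_surj_on[OF bij_betw_hits[of "act a x" c D, OF act_space[OF elim(3)] elim(2)]]
            shift_hits[OF elim(3) h, of a] by blast
        have "c (i' l) (act a x) = c (i l) x - a" if "l < n" for l
          using fun_cong[OF i'(3), of l] i(3) that by (simp add: pts_def shift_def)
        then have "\<psi> i' (act a x) = \<psi> i x" using elim(4) i i' by simp
        then show "H (act a x) (shift n a h) = H x h"
          using H_pts[OF elim(1) i(1,2)] H_pts[OF elim(2) i'(1,2)] i(3) i'(3) by simp
      qed
    qed
  next
    have "AE x in M. x \<in> doms D (Suc n) i \<longrightarrow>
        (\<Sum>j\<le>n. (- 1) ^ j * \<psi> (omit n j i) x) = F x (pts c (Suc n) i x)" for i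
    proof (rule cond_mean_sum_AE[of "{..n}" "\<lambda>j. \<Psi> (omit n j i)" "\<lambda>j. \<psi> (omit n j i)" _ _ C])
      have "(\<lambda>x. (x, pts c (Suc n) i x)) \<in> M \<rightarrow>\<^sub>M M \<Otimes>\<^sub>M grp (Suc n)"
        by (intro measurable_Pair measurable_ident_sets[OF refl] pts_measurable c)
      from measurable_compose[OF this F]
      show "(\<lambda>x. F x (pts c (Suc n) i x)) \<in> borel_measurable M" by simp
      show "\<bar>F x (pts c (Suc n) i x)\<bar> \<le> C" for x by (rule C)
      fix g
      show "AE x in M. x \<in> doms D (Suc n) i \<longrightarrow>
          (\<Sum>j\<le>n. (- 1) ^ j * \<Psi> (omit n j i) g x) = F x (pts c (Suc n) i x)"
        \<comment> \<open>The selection is a hitting element only almost everywhere. For a fixed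
          \<open>g\<close> the measure-preserving action keeps this property at
          \<open>act (- g) x\<close>.\<close>
        using cocycle AE_act[OF s_hit, of "- g"] AE_space
      proof eventually_elim
        case (elim x)
        show ?case
        proof
          assume x: "x \<in> doms D (Suc n) i"
          define h where "h = pts c (Suc n) i x"
          define u where "u = s (act (- g) x) - g"
          have h: "h \<in> hits (Suc n) x" unfolding h_def by (rule pts_in_hits[OF cD x])
          have "u \<in> hit x" using elim(2) act_diff[OF elim(3)] by (simp add: hit_iff u_def)
          then have "0 = (\<Sum>j\<le>Suc n. (- 1) ^ j * F x (omit (Suc n) j (cons (Suc n) u h)))"
            using elim(1) cons_hits[OF _ h] by simp
          \<comment> \<open>Omitting the inserted entry gives \<open>h\<close> back; every other
            omission is moved past it, which raises its position by one and changes the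
            sign.\<close>
          also have "\<dots> = F x h - (\<Sum>j\<le>n. (- 1) ^ j * F x (cons n u (omit n j h)))"
            unfolding sum.atMost_Suc_shift
            by (simp add: omit_zero_cons[OF hits_space[OF h]] omit_Suc_cons sum_negf)
          also have "(\<Sum>j\<le>n. (- 1) ^ j * F x (cons n u (omit n j h))) = (\<Sum>j\<le>n. (- 1) ^ j * \<Psi> (omit n j i) g x)"
            by (intro sum.cong) (simp_all add: \<Psi>_def h_def u_def pts_omit)
          finally show "(\<Sum>j\<le>n. (- 1) ^ j * \<Psi> (omit n j i) g x) = F x (pts c (Suc n) i x)"
            by (simp add: h_def)
        qed
      qed
    qed (use \<Psi> \<psi> doms_sets[OF D] in auto)
    then have "AE x in M. \<forall>i\<in>idx (Suc n). x \<in> doms D (Suc n) i \<longrightarrow>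
        (\<Sum>j\<le>n. (- 1) ^ j * \<psi> (omit n j i) x) = F x (pts c (Suc n) i x)"
      by (simp only: AE_ball_countable[OF countable_idx]) simp
    with bij AE_space
    show "AE x in M. \<forall>h\<in>hits (Suc n) x. F x h = (\<Sum>j\<le>n. (- 1) ^ j * H x (omit n j h))"
    proof eventually_elim
      case (elim x)
      show ?case
      proof
        fix h assume h: "h \<in> hits (Suc n) x"
        obtain i where i: "i \<in> idx (Suc n)" "x \<in> doms D (Suc n) i" "h = pts c (Suc n) i x"
          using bij_betw_imp_surj_on[OF bij_betw_hits[of x c D, OF elim(2,1)]] h by blast
        have "H x (omit n j h) = \<psi> (omit n j i) x" if "j \<le> n" for j
          using H_pts[OF elim(1) omit_idx doms_omit[OF that i(2)]] pts_omit[OF that] i(3) by metis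
        then have "(\<Sum>j\<le>n. (- 1) ^ j * H x (omit n j h)) = (\<Sum>j\<le>n. (- 1) ^ j * \<psi> (omit n j i) x)"
          by (intro sum.cong) auto
        then show "F x h = (\<Sum>j\<le>n. (- 1) ^ j * H x (omit n j h))"
          using elim(3) i by simp
      qed
    qed
  qed
qed

section \<open>Strictly invariant versions\<close>

text \<open>A probability measure makes averages along an orbit finite. It has the null sets of Haar
  measure, and \<open>unimodular\<close> makes these invariant under right translations.\<close>

lemma ex_probability:
  obtains P :: "'g measure" where "prob_space P" "sets P = sets borel"
    "\<And>Q b. (AE a in P. Q a) \<Longrightarrow> (AE a in P. Q (a + b))"
proof -
  obtain w :: "'g \<Rightarrow> ennreal" where w: "w \<in> borel_measurable borel" "\<And>g. 0 < w g" "(\<integral>\<^sup>+ g. w g \<partial>m) = 1"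
    using ex_weight by metis
  have wm: "w \<in> borel_measurable m" using w(1) measurable_cong_sets[OF sets_m refl] by blast
  define P where "P = density m w"
  have AE_P: "(AE a in P. Q a) \<longleftrightarrow> (AE a in m. Q a)" for Q
    unfolding P_def AE_density[OF wm] using w(2) by simp
  show thesis
  proof (rule that)
    have "emeasure P UNIV = 1"
      using emeasure_density[OF wm sets.top] w(3) by (simp add: P_def space_m)
    then show "prob_space P"
      by (intro prob_spaceI) (simp add: P_def space_m)
    show "sets P = sets borel" by (simp add: P_def sets_m)
    fix Q :: "'g \<Rightarrow> bool" and b
    assume "AE a in P. Q a"
    moreover have "distr m borel (\<lambda>a. a + b) = m" using unimod by (simp add: unimodular_def)
    ultimately have "AE a in distr m borel (\<lambda>a. a + b). Q a" unfolding AE_P by (simp only:)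
    moreover have "(\<lambda>a. a + b) \<in> m \<rightarrow>\<^sub>M borel"
    proof -
      have "continuous_on UNIV (\<lambda>a::'g. a + b)" by (intro continuous_intros)
      then show ?thesis
        using borel_measurable_continuous_onI measurable_cong_sets[OF sets_m refl] by blast
    qed
    ultimately show "AE a in P. Q (a + b)" unfolding AE_P by (rule AE_distrD[rotated])
  qed
qed

lemma shift_act_measurable:
  "(\<lambda>p. (act (snd p) (fst (fst p)), shift n (snd p) (snd (fst p))))
    \<in> (M \<Otimes>\<^sub>M grp n) \<Otimes>\<^sub>M borel \<rightarrow>\<^sub>M M \<Otimes>\<^sub>M grp n"
proof (rule measurable_Pair)
  have "(\<lambda>p. (snd p, fst (fst p))) \<in> (M \<Otimes>\<^sub>M grp n) \<Otimes>\<^sub>M borel \<rightarrow>\<^sub>M (borel :: 'g measure) \<Otimes>\<^sub>M M"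
    by (intro measurable_Pair measurable_snd measurable_compose[OF measurable_fst measurable_fst])
  from measurable_compose[OF this act_measurable]
  show "(\<lambda>p. act (snd p) (fst (fst p))) \<in> (M \<Otimes>\<^sub>M grp n) \<Otimes>\<^sub>M borel \<rightarrow>\<^sub>M M" by simp
  show "(\<lambda>p. shift n (snd p) (snd (fst p))) \<in> (M \<Otimes>\<^sub>M grp n) \<Otimes>\<^sub>M borel \<rightarrow>\<^sub>M grp n"
    unfolding shift_def
    by (intro measurable_restrict borel_measurable_diff_group measurable_snd
        measurable_compose[OF measurable_fst component_measurable]) auto
qed

text \<open>
  The invariant version takes the almost sure value of \<open>H\<close> along the orbit where there is one. As right
  translations preserve null sets, this condition is itself invariant.
\<close>

lemma invariant_version:
  assumes H: "(\<lambda>(x, h). H x h) \<in> borel_measurable (M \<Otimes>\<^sub>M grp n)" and C: "\<And>x h. \<bar>H x h\<bar> \<le> C"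
    and inv: "\<And>a. AE x in M. \<forall>h\<in>hits n x. H (act a x) (shift n a h) = H x h"
  obtains H' where "(\<lambda>(x, h). H' x h) \<in> borel_measurable (M \<Otimes>\<^sub>M grp n)" "\<And>x h. \<bar>H' x h\<bar> \<le> C"
    "shift_invariant n H'" "AE x in M. \<forall>h\<in>hits n x. H' x h = H x h"
proof -
  obtain P :: "'g measure" where P: "prob_space P" "sets P = sets borel"
    and translate: "\<And>Q b. (AE a in P. Q a) \<Longrightarrow> (AE a in P. Q (a + b))"
    by (rule ex_probability) (rule that)
  interpret P: prob_space P by (rule P)
  interpret PM: pair_sigma_finite P M ..
  have "0 \<le> C" using order_trans[OF abs_ge_zero C] .
  define K where "K x h a = H (act a x) (shift n a h)" for x h a
  have K: "(\<lambda>(p, a). K (fst p) (snd p) a) \<in> borel_measurable ((M \<Otimes>\<^sub>M grp n) \<Otimes>\<^sub>M P)"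
  proof -
    have "(\<lambda>(p, a). K (fst p) (snd p) a) \<in> borel_measurable ((M \<Otimes>\<^sub>M grp n) \<Otimes>\<^sub>M borel)"
      using measurable_compose[OF shift_act_measurable H] by (simp add: K_def case_prod_unfold)
    then show ?thesis
      using measurable_cong_sets[OF sets_pair_measure_cong[OF refl P(2)] refl] by blast
  qed
  \<comment> \<open>If \<open>K x h\<close> is almost surely constant, its integral is that
    constant, so the almost sure value becomes measurable in \<open>x\<close> and
    \<open>h\<close>.\<close>
  define I where "I x h = (\<integral>a. K x h a \<partial>P)" for x h
  define const where "const x h \<longleftrightarrow> (AE a in P. K x h a = I x h)" for x h
  define H' where "H' x h = (if const x h then I x h else 0)" for x h
  have I: "(\<lambda>p. I (fst p) (snd p)) \<in> borel_measurable (M \<Otimes>\<^sub>M grp n)"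
    unfolding I_def using K by (intro P.borel_measurable_lebesgue_integral) simp
  have K_section: "K x h \<in> borel_measurable P" if "x \<in> space M" "h \<in> space (grp n)" for x h
    using measurable_compose[OF measurable_Pair1'[of "(x, h)" "M \<Otimes>\<^sub>M grp n" P] K] that
    by (simp add: space_pair_measure)
  have I_eq: "I x h = r" and const: "const x h"
    if xh: "x \<in> space M" "h \<in> space (grp n)" and r: "AE a in P. K x h a = r" for x h r
  proof -
    have "I x h = (\<integral>a. r \<partial>P)"
      unfolding I_def using K_section[OF xh] r by (intro integral_cong_AE) auto
    then show "I x h = r" by (simp add: P.prob_space)
    then show "const x h" using r by (simp add: const_def)
  qed
  have translate_K: "K (act b x) (shift n b h) a = K x h (a + b)" if "x \<in> space M" for x h a b
    by (simp add: K_def shift_shift act_add[OF that])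
  have const_translate: "const (act b x) (shift n b h) \<and> I (act b x) (shift n b h) = I x h"
    if xh: "x \<in> space M" "h \<in> space (grp n)" "const x h" for x h b
  proof -
    have "AE a in P. K x h (a + b) = I x h"
      using translate that(3) unfolding const_def by blast
    then have "AE a in P. K (act b x) (shift n b h) a = I x h"
      unfolding translate_K[OF xh(1)] .
    moreover have "shift n b h \<in> space (grp n)" by (simp add: space_grp shift_space)
    ultimately show ?thesis using I_eq const act_space[OF xh(1)] by blast
  qed
  show thesis
  proof (rule that)
    \<comment> \<open>Almost sure constancy means that the integral of the distance between
      \<open>K\<close> and \<open>I\<close> is zero, and this integral is measurable in the
      pair.\<close>
    have "{p \<in> space (M \<Otimes>\<^sub>M grp n). const (fst p) (snd p)} \<in> sets (M \<Otimes>\<^sub>M grp n)"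
    proof -
      have "(\<lambda>(p, a). ennreal \<bar>K (fst p) (snd p) a - I (fst p) (snd p)\<bar>) \<in> borel_measurable ((M \<Otimes>\<^sub>M grp n) \<Otimes>\<^sub>M P)"
      proof -
        have [measurable]: "(\<lambda>p. K (fst (fst p)) (snd (fst p)) (snd p)) \<in> borel_measurable ((M \<Otimes>\<^sub>M grp n) \<Otimes>\<^sub>M P)"
          "(\<lambda>p. I (fst (fst p)) (snd (fst p))) \<in> borel_measurable ((M \<Otimes>\<^sub>M grp n) \<Otimes>\<^sub>M P)"
          using K measurable_compose[OF measurable_fst I] by (simp_all add: case_prod_unfold)
        show ?thesis unfolding case_prod_unfold by measurable
      qed
      then have "(\<lambda>p. \<integral>\<^sup>+ a. ennreal \<bar>K (fst p) (snd p) a - I (fst p) (snd p)\<bar> \<partial>P) \<in> borel_measurable (M \<Otimes>\<^sub>M grp n)"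
        by (rule P.borel_measurable_nn_integral)
      then have "{p \<in> space (M \<Otimes>\<^sub>M grp n). (\<integral>\<^sup>+ a. ennreal \<bar>K (fst p) (snd p) a - I (fst p) (snd p)\<bar> \<partial>P) = 0}
          \<in> sets (M \<Otimes>\<^sub>M grp n)"
        by (intro measurable_equality_set) auto
      moreover have "(\<integral>\<^sup>+ a. ennreal \<bar>K (fst p) (snd p) a - I (fst p) (snd p)\<bar> \<partial>P) = 0 \<longleftrightarrow> const (fst p) (snd p)"
        if "p \<in> space (M \<Otimes>\<^sub>M grp n)" for p
      proof -
        have "K (fst p) (snd p) \<in> borel_measurable P"
          using that by (intro K_section) (auto simp: space_pair_measure)
        then show ?thesis by (simp add: nn_integral_0_iff_AE const_def)
      qed
      ultimately show ?thesis by (simp cong: conj_cong)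
    qed
    then have "(\<lambda>p. if const (fst p) (snd p) then I (fst p) (snd p) else 0) \<in> borel_measurable (M \<Otimes>\<^sub>M grp n)"
      by (intro measurable_If I) auto
    then show "(\<lambda>(x, h). H' x h) \<in> borel_measurable (M \<Otimes>\<^sub>M grp n)"
      by (simp add: H'_def case_prod_unfold)
    show "\<bar>H' x h\<bar> \<le> C" for x h
    proof -
      have "\<bar>I x h\<bar> \<le> C"
      proof (cases "integrable P (K x h)")
        case True
        have "\<bar>K x h a\<bar> \<le> C" for a unfolding K_def by (rule C)
        with True have "(\<integral>a. \<bar>K x h a\<bar> \<partial>P) \<le> (\<integral>a. C \<partial>P)"
          by (intro integral_mono integrable_abs) auto
        then show ?thesis
          unfolding I_def by (intro order_trans[OF integral_abs_bound]) (simp add: P.prob_space)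
      qed (use \<open>0 \<le> C\<close> in \<open>simp add: I_def not_integrable_integral_eq\<close>)
      then show ?thesis using \<open>0 \<le> C\<close> by (simp add: H'_def)
    qed
    show "shift_invariant n H'"
      unfolding shift_invariant_def
    proof (intro ballI allI)
      fix x :: 'x and h :: "nat \<Rightarrow> 'g" and b :: 'g
      assume xh: "x \<in> space M" "h \<in> {..<n} \<rightarrow>\<^sub>E UNIV"
      then have h: "h \<in> space (grp n)" by (simp add: space_grp)
      have "const x h" if "const (act b x) (shift n b h)"
        using const_translate[OF act_space[OF xh(1)] _ that, of "- b"] act_uminus[OF xh(1)] shift_uminus[OF xh(2)]
        by (simp add: space_grp shift_space)
      then show "H' (act b x) (shift n b h) = H' x h"
        using const_translate[OF xh(1) h, of b] by (auto simp: H'_def)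
    qed
    obtain c :: "nat \<Rightarrow> 'x \<Rightarrow> 'g" and D :: "nat \<Rightarrow> 'x set"
      where c: "\<And>i. c i \<in> borel_measurable M" and D: "\<And>i. D i \<in> sets M"
      and cD: "\<And>i x. x \<in> D i \<Longrightarrow> c i x \<in> hit x"
      and bij: "AE x in M. bij_betw (\<lambda>i. c i x) {i. x \<in> D i} (hit x)"
      by (rule ex_enumeration[OF finite_measure_axioms refl]) (rule that)
    have "AE x in M. x \<in> doms D n i \<longrightarrow> H' x (pts c n i x) = H x (pts c n i x)" for i
    proof -
      define Q where "Q a x \<longleftrightarrow> x \<in> doms D n i \<longrightarrow> K x (pts c n i x) a = H x (pts c n i x)" for a x
      have Q: "AE x in M. Q a x" for a
        using inv[of a]
      proof eventually_elim
        case (elim x)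
        then show ?case using pts_in_hits[where c = c and D = D, OF cD] by (auto simp: Q_def K_def)
      qed
      have xc: "(\<lambda>x. (x, pts c n i x)) \<in> M \<rightarrow>\<^sub>M M \<Otimes>\<^sub>M grp n"
        by (intro measurable_Pair measurable_ident_sets[OF refl] pts_measurable c)
      have "{p \<in> space (P \<Otimes>\<^sub>M M). Q (fst p) (snd p)} \<in> sets (P \<Otimes>\<^sub>M M)"
      proof -
        have "(\<lambda>p. ((snd p, pts c n i (snd p)), fst p)) \<in> P \<Otimes>\<^sub>M M \<rightarrow>\<^sub>M (M \<Otimes>\<^sub>M grp n) \<Otimes>\<^sub>M P"
          by (intro measurable_Pair measurable_fst measurable_compose[OF measurable_snd xc])
        from measurable_compose[OF this K]
        have 1: "(\<lambda>p. K (snd p) (pts c n i (snd p)) (fst p)) \<in> borel_measurable (P \<Otimes>\<^sub>M M)" by simp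
        have 2: "(\<lambda>p. H (snd p) (pts c n i (snd p))) \<in> borel_measurable (P \<Otimes>\<^sub>M M)"
          using measurable_compose[OF measurable_compose[OF measurable_snd xc] H] by simp
        have 3: "{p \<in> space (P \<Otimes>\<^sub>M M). snd p \<in> doms D n i} \<in> sets (P \<Otimes>\<^sub>M M)"
          using measurable_sets[OF measurable_snd[of P M] doms_sets[of D n i, OF D]]
          by (simp add: vimage_def Int_def conj_commute)
        show ?thesis
          unfolding Q_def by (intro sets.sets_Collect_imp 3 measurable_equality_set 1 2)
      qed
      \<comment> \<open>The relation holds for every \<open>a\<close> at almost every
        \<open>x\<close>; Fubini gives it at almost every \<open>x\<close> for almost every
        \<open>a\<close>, so there the orbit function is constant with value
        \<open>H\<close>.\<close>
      from PM.AE_commute[OF this] Q have "AE x in M. AE a in P. Q a x" by simp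
      with AE_space show ?thesis
      proof eventually_elim
        case (elim x)
        show ?case
        proof
          assume x: "x \<in> doms D n i"
          then have *: "AE a in P. K x (pts c n i x) a = H x (pts c n i x)"
            using elim(2) by (simp add: Q_def)
          have "pts c n i x \<in> space (grp n)" by (simp add: pts_def space_grp)
          from I_eq[OF elim(1) this *] const[OF elim(1) this *]
          show "H' x (pts c n i x) = H x (pts c n i x)" by (simp add: H'_def)
        qed
      qed
    qed
    then have "AE x in M. \<forall>i\<in>idx n. x \<in> doms D n i \<longrightarrow> H' x (pts c n i x) = H x (pts c n i x)"
      by (simp only: AE_ball_countable[OF countable_idx]) simp
    with bij AE_space show "AE x in M. \<forall>h\<in>hits n x. H' x h = H x h"
    proof eventually_elim
      case (elim x)
      show ?case
      proof
        fix h assume h: "h \<in> hits n x"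
        obtain i where "i \<in> idx n" "x \<in> doms D n i" "h = pts c n i x"
          using bij_betw_imp_surj_on[OF bij_betw_hits[of x c D, OF elim(2,1)]] h by blast
        then show "H' x h = H x h" using elim(3) by blast
      qed
    qed
  qed
qed

section \<open>The cocycles are coboundaries\<close>

text \<open>A failure of vanishing at a point \<open>act g x\<close> of the cross section would be
  carried by invariance to a failure at \<open>x\<close>, for every \<open>g\<close> in the hitting
  set. Hence almost no orbit meets the set of failures, which is measurable for each
  multi-index.\<close>

lemma AE_\<nu>_shift_invariant:
  assumes E: "(\<lambda>(x, h). E x h) \<in> borel_measurable (M \<Otimes>\<^sub>M grp n)" and inv: "shift_invariant n E"
    and AE: "AE x in M. \<forall>h\<in>hits n x. E x h = 0"
  shows "AE y in \<nu>. \<forall>h\<in>hits n y. E y h = 0"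
proof -
  obtain c :: "nat \<Rightarrow> 'x \<Rightarrow> 'g" and D :: "nat \<Rightarrow> 'x set"
    where c: "\<And>i. c i \<in> borel_measurable M" and D: "\<And>i. D i \<in> sets M"
    and cD: "\<And>i x. x \<in> D i \<Longrightarrow> c i x \<in> hit x"
    and bij: "AE x in \<nu>. bij_betw (\<lambda>i. c i x) {i. x \<in> D i} (hit x)"
    by (rule ex_enumeration_\<nu>) (rule that)
  have "AE y in \<nu>. y \<in> doms D n i \<longrightarrow> E y (pts c n i y) = 0" for i
  proof -
    define N where "N = {x \<in> space M. x \<in> doms D n i \<and> E x (pts c n i x) \<noteq> 0}"
    have "(\<lambda>x. (x, pts c n i x)) \<in> M \<rightarrow>\<^sub>M M \<Otimes>\<^sub>M grp n"
      by (intro measurable_Pair measurable_ident_sets[OF refl] pts_measurable c)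
    from measurable_compose[OF this E] have "(\<lambda>x. E x (pts c n i x)) \<in> borel_measurable M" by simp
    then have "{x \<in> space M. \<not> E x (pts c n i x) = 0} \<in> sets M"
      by (intro sets.sets_Collect_neg measurable_equality_set) auto
    moreover have "{x \<in> space M. x \<in> doms D n i} \<in> sets M" using doms_sets[of D n i, OF D] by simp
    ultimately have "N \<in> sets M" unfolding N_def by (intro sets.sets_Collect_conj)
    then have N: "N \<inter> Y \<in> sets \<nu>" by (auto simp: sets_\<nu> sets_restrict_space)
    have "AE x in M. \<forall>g\<in>hit x. act g x \<notin> N \<inter> Y"
      using AE AE_space
    proof eventually_elim
      case (elim x)
      show ?case
      proof (intro ballI notI)
        fix g assume "g \<in> hit x" and gN: "act g x \<in> N \<inter> Y"
        define h where "h = pts c n i (act g x)"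
        have h: "h \<in> hits n (act g x)"
          unfolding h_def by (rule pts_in_hits[where c = c and D = D, OF cD]) (use gN in \<open>auto simp: N_def\<close>)
        have "shift n (- g) h \<in> hits n x"
          using shift_hits[OF act_space[OF elim(2)] h, of "- g"] act_uminus[OF elim(2)] by simp
        moreover have "E (act (- g) (act g x)) (shift n (- g) h) = E (act g x) h"
          using inv act_space[OF elim(2)] hits_space[OF h] unfolding shift_invariant_def by blast
        ultimately have "E (act g x) h = 0" using elim(1) act_uminus[OF elim(2)] by simp
        then show False using gN by (simp add: N_def h_def)
      qed
    qed
    from AE_\<nu>_if_AE_orbits[OF N this] AE_space show ?thesis
      by eventually_elim (auto simp: N_def space_\<nu> Y_space)
  qed
  then have "AE y in \<nu>. \<forall>i\<in>idx n. y \<in> doms D n i \<longrightarrow> E y (pts c n i y) = 0"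
    by (simp only: AE_ball_countable[OF countable_idx]) simp
  with bij AE_space show ?thesis
  proof eventually_elim
    case (elim y)
    then have y: "y \<in> space M" using Y_space by (simp add: space_\<nu>)
    show ?case
    proof
      fix h assume h: "h \<in> hits n y"
      obtain i where "i \<in> idx n" "y \<in> doms D n i" "h = pts c n i y"
        using bij_betw_imp_surj_on[OF bij_betw_hits[of y c D, OF y elim(1)]] h by blast
      then show "E y h = 0" using elim(3) by blast
    qed
  qed
qed

section \<open>From invariant functions back to cochains\<close>

definition cochain_of :: "('x \<Rightarrow> (nat \<Rightarrow> 'g) \<Rightarrow> real) \<Rightarrow> nat \<Rightarrow> (nat \<Rightarrow> 'g \<times> 'x) \<Rightarrow> real" where
  "cochain_of H n \<gamma> = H (tgt \<G> (\<gamma> 0)) (\<lambda>i\<in>{..<n}. - fst (\<gamma> i))"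

lemma cochain_of_tup:
  assumes "0 < n" "y \<in> Y" "h \<in> hits n y"
  shows "cochain_of H n (tup n y h) = H y h"
proof -
  have "(\<lambda>i\<in>{..<n}. - fst (tup n y h i)) = h"
    using hits_space[OF assms(3)] by (auto simp: tup_def PiE_def extensional_def)
  then show ?thesis
    using assms(1) act_uminus[OF Y_space[OF assms(2)]] by (simp add: cochain_of_def tup_def)
qed

text \<open>Composition with the inverse of an arrow with group element \<open>g\<close> moves the
  target from \<open>y\<close> to \<open>act (- g) y\<close> and shifts the tuple by
  \<open>- g\<close>. Strict invariance therefore handles every tuple and every arrow with the same
  target, without exceptional sets.\<close>

lemma cochain_of_cochain:
  assumes H: "(\<lambda>(x, h). H x h) \<in> borel_measurable (M \<Otimes>\<^sub>M grp (Suc k))"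
    and C: "\<And>x h. \<bar>H x h\<bar> \<le> C" and inv: "shift_invariant (Suc k) H"
  shows "cochain_of H (Suc k) \<in> cochains \<G> k"
proof -
  let ?n = "Suc k"
  have comp_meas: "(\<lambda>\<gamma>. \<gamma> i) \<in> PiM {..<?n} (\<lambda>_. arrows \<G>) \<rightarrow>\<^sub>M borel \<Otimes>\<^sub>M M" if "i < ?n" for i
  proof -
    have "(\<lambda>a. a) \<in> arrows \<G> \<rightarrow>\<^sub>M borel \<Otimes>\<^sub>M M"
      unfolding groupoid_simps by (rule measurable_restrict_space1[OF measurable_ident_sets[OF refl]])
    from measurable_compose[OF measurable_component_singleton[of i "{..<?n}"] this] that
    show ?thesis by simp
  qed
  have "(\<lambda>\<gamma>. (act (fst (\<gamma> 0)) (snd (\<gamma> 0)), \<lambda>i\<in>{..<?n}. - fst (\<gamma> i))) \<in>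
      PiM {..<?n} (\<lambda>_. arrows \<G>) \<rightarrow>\<^sub>M M \<Otimes>\<^sub>M grp ?n"
  proof (rule measurable_Pair)
    from measurable_compose[OF comp_meas[OF zero_less_Suc] act_measurable]
    show "(\<lambda>\<gamma>. act (fst (\<gamma> 0)) (snd (\<gamma> 0))) \<in> PiM {..<?n} (\<lambda>_. arrows \<G>) \<rightarrow>\<^sub>M M"
      by (simp add: case_prod_unfold)
    show "(\<lambda>\<gamma>. \<lambda>i\<in>{..<?n}. - fst (\<gamma> i)) \<in> PiM {..<?n} (\<lambda>_. arrows \<G>) \<rightarrow>\<^sub>M grp ?n"
      by (intro measurable_restrict borel_measurable_uminus_group
          measurable_compose[OF comp_meas measurable_fst]) auto
  qed
  from measurable_compose[OF this H]
  have "cochain_of H ?n \<in> borel_measurable (PiM {..<?n} (\<lambda>_. arrows \<G>))"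
    by (simp add: cochain_of_def[abs_def] transverse_groupoid_def case_prod_unfold)
  then have "cochain_of H ?n \<in> borel_measurable (tuple_measure \<G> ?n)"
    using measurable_restrict_space1 measurable_cong_sets[OF sets_tuple_measure refl] by blast
  then have "cochain_of H ?n \<in> ess_bounded (tuple_measure \<G> ?n)"
    unfolding ess_bounded_def by (intro CollectI conjI exI[of _ C] AE_I2) (simp_all add: cochain_of_def C)
  moreover have "cochain_of H ?n (\<lambda>i\<in>{..<?n}. comp \<G> (ginv \<G> \<gamma>) (\<gamma>s i)) = cochain_of H ?n \<gamma>s"
    if \<gamma>s: "\<gamma>s \<in> tuples \<G> ?n" and \<gamma>: "\<gamma> \<in> space (arrows \<G>)" "tgt \<G> \<gamma> = tgt \<G> (\<gamma>s 0)" for \<gamma>s \<gamma>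
  proof -
    obtain y h where yh: "y \<in> Y" "h \<in> hits ?n y" "\<gamma>s = tup ?n y h"
      using tuplesE[OF zero_less_Suc \<gamma>s] by blast
    note yM = Y_space[OF yh(1)]
    obtain g z where gz: "\<gamma> = (g, z)" by (cases \<gamma>)
    have "act g z = y"
      using \<gamma>(2) act_uminus[OF yM] by (simp add: gz yh(3) tup_def)
    then have "comp \<G> (ginv \<G> \<gamma>) (\<gamma>s i) = (- g + - h i, act (h i) y)" if "i < ?n" for i
      using that by (simp add: gz yh(3) tup_def)
    then have "(\<lambda>i\<in>{..<?n}. comp \<G> (ginv \<G> \<gamma>) (\<gamma>s i)) = (\<lambda>i\<in>{..<?n}. (- g + - h i, act (h i) y))"
      by (intro restrict_ext) simp
    moreover have "act (- g + - h 0) (act (h 0) y) = act (- g) y"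
      using act_add[OF act_space[OF yM], of "- g" "- h 0" "h 0"] act_uminus[OF yM] by simp
    moreover have "(\<lambda>i\<in>{..<?n}. - fst ((\<lambda>i\<in>{..<?n}. (- g + - h i, act (h i) y)) i)) = shift ?n (- g) h"
      by (auto simp: shift_def minus_add)
    ultimately have "cochain_of H ?n (\<lambda>i\<in>{..<?n}. comp \<G> (ginv \<G> \<gamma>) (\<gamma>s i)) = H (act (- g) y) (shift ?n (- g) h)"
      by (simp add: cochain_of_def)
    also have "\<dots> = H y h"
      using inv yM hits_space[OF yh(2)] unfolding shift_invariant_def by blast
    also have "\<dots> = cochain_of H ?n \<gamma>s"
      using cochain_of_tup[OF zero_less_Suc yh(1,2)] yh(3) by simp
    finally show ?thesis .
  qed
  ultimately show ?thesis
    unfolding cochains_def by (intro CollectI conjI AE_I2 ballI impI) (simp_all only: space_tuple_measure)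
qed

lemma cocycle_is_coboundary:
  assumes f: "f \<in> cocycles \<G> (Suc k)"
  shows "f \<in> coboundaries \<G> (Suc k)"
proof -
  let ?n = "Suc k"
  have fc: "f \<in> cochains \<G> ?n" and f_meas: "f \<in> borel_measurable (tuple_measure \<G> (Suc ?n))"
    using f by (auto simp: cocycles_def cochains_def ess_bounded_def)
  obtain C0 where "AE \<gamma> in tuple_measure \<G> (Suc ?n). \<bar>f \<gamma>\<bar> \<le> C0"
    using fc by (auto simp: cochains_def ess_bounded_def)
  then have C: "AE \<gamma> in tuple_measure \<G> (Suc ?n). \<bar>f \<gamma>\<bar> \<le> \<bar>C0\<bar>"
    by eventually_elim simp
  define F where "F = orbit_ext f \<bar>C0\<bar> (Suc ?n)"
  have F: "(\<lambda>(x, h). F x h) \<in> borel_measurable (M \<Otimes>\<^sub>M grp (Suc ?n))"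
    unfolding F_def by (rule orbit_ext_measurable[OF zero_less_Suc f_meas])
  have F_inv: "shift_invariant (Suc ?n) F"
    unfolding F_def by (rule shift_invariant_orbit_ext) simp
  obtain H0 where H0: "(\<lambda>(x, h). H0 x h) \<in> borel_measurable (M \<Otimes>\<^sub>M grp ?n)" "\<And>x h. \<bar>H0 x h\<bar> \<le> \<bar>C0\<bar>"
    "\<And>a. AE x in M. \<forall>h\<in>hits ?n x. H0 (act a x) (shift ?n a h) = H0 x h"
    and F_H0: "AE x in M. \<forall>h\<in>hits (Suc ?n) x. F x h = (\<Sum>j\<le>?n. (- 1) ^ j * H0 x (omit ?n j h))"
  proof (rule averaged_cochain[OF F _ F_inv])
    show "\<bar>F x h\<bar> \<le> \<bar>C0\<bar>" for x h unfolding F_def by (rule orbit_ext_bounded) simp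
    show "AE x in M. \<forall>h\<in>hits (Suc (Suc ?n)) x. (\<Sum>j\<le>Suc ?n. (- 1) ^ j * F x (omit (Suc ?n) j h)) = 0"
      unfolding F_def by (rule cocycle_orbit_ext[OF f C])
  qed (rule that)
  obtain H where H: "(\<lambda>(x, h). H x h) \<in> borel_measurable (M \<Otimes>\<^sub>M grp ?n)" "\<And>x h. \<bar>H x h\<bar> \<le> \<bar>C0\<bar>"
    "shift_invariant ?n H" and H_H0: "AE x in M. \<forall>h\<in>hits ?n x. H x h = H0 x h"
    by (rule invariant_version[OF H0]) (rule that)
  \<comment> \<open>The defect of the homotopy formula. Since \<open>F\<close> and \<open>H\<close>
    are strictly invariant, so is \<open>E\<close>, which is what allows its vanishing to descend
    from the ambient space to \<open>\<nu>\<close>.\<close>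
  define E where "E x h = F x h - (\<Sum>j\<le>?n. (- 1) ^ j * H x (omit ?n j h))" for x h
  have "AE y in \<nu>. \<forall>h\<in>hits (Suc ?n) y. E y h = 0"
  proof (rule AE_\<nu>_shift_invariant)
    have "(\<lambda>p. H (fst p) (omit ?n j (snd p))) \<in> borel_measurable (M \<Otimes>\<^sub>M grp (Suc ?n))" if "j \<le> ?n" for j
    proof -
      have "(\<lambda>p. (fst p, omit ?n j (snd p))) \<in> M \<Otimes>\<^sub>M grp (Suc ?n) \<rightarrow>\<^sub>M M \<Otimes>\<^sub>M grp ?n"
        unfolding omit_def
        by (intro measurable_Pair measurable_fst measurable_restrict component_measurable) auto
      from measurable_compose[OF this H(1)] show ?thesis by simp
    qed
    then have "(\<lambda>p. \<Sum>j\<le>?n. (- 1) ^ j * H (fst p) (omit ?n j (snd p))) \<in> borel_measurable (M \<Otimes>\<^sub>M grp (Suc ?n))"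
      by (intro borel_measurable_sum borel_measurable_times borel_measurable_const) auto
    with F show "(\<lambda>(x, h). E x h) \<in> borel_measurable (M \<Otimes>\<^sub>M grp (Suc ?n))"
      unfolding E_def case_prod_unfold by (rule borel_measurable_diff)
    show "shift_invariant (Suc ?n) E"
      unfolding shift_invariant_def
    proof (intro ballI allI)
      fix x :: 'x and h :: "nat \<Rightarrow> 'g" and a :: 'g
      assume xh: "x \<in> space M" "h \<in> {..<Suc ?n} \<rightarrow>\<^sub>E UNIV"
      have "H (act a x) (omit ?n j (shift (Suc ?n) a h)) = H x (omit ?n j h)" if "j \<le> ?n" for j
      proof -
        have "omit ?n j h \<in> {..<?n} \<rightarrow>\<^sub>E UNIV" by (simp add: omit_def)
        then show ?thesis
          using H(3) xh(1) unfolding shift_invariant_def omit_shift[OF that] by blast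
      qed
      moreover have "F (act a x) (shift (Suc ?n) a h) = F x h"
        using F_inv xh unfolding shift_invariant_def by blast
      ultimately show "E (act a x) (shift (Suc ?n) a h) = E x h"
        unfolding E_def by (intro arg_cong2[of _ _ _ _ minus] sum.cong) auto
    qed
    show "AE x in M. \<forall>h\<in>hits (Suc ?n) x. E x h = 0"
      using F_H0 H_H0
    proof eventually_elim
      case (elim x)
      show ?case
      proof
        fix h assume h: "h \<in> hits (Suc ?n) x"
        have "(\<Sum>j\<le>?n. (- 1) ^ j * H x (omit ?n j h)) = (\<Sum>j\<le>?n. (- 1) ^ j * H0 x (omit ?n j h))"
          using elim(2) omit_hits[OF _ h] by (intro sum.cong) auto
        then show "E x h = 0" using elim(1) h by (simp add: E_def)
      qed
    qed
  qed
  with cochain_orbit_ext[OF fc C] AE_space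
  have "AE y in \<nu>. \<forall>h\<in>hits (Suc ?n) y. f (tup (Suc ?n) y h) = differential k (cochain_of H ?n) (tup (Suc ?n) y h)"
  proof eventually_elim
    case (elim y)
    then have y: "y \<in> Y" by (simp add: space_\<nu>)
    show ?case
    proof
      fix h assume h: "h \<in> hits (Suc ?n) y"
      have "f (tup (Suc ?n) y h) = (\<Sum>j\<le>?n. (- 1) ^ j * H y (omit ?n j h))"
        using elim(1,3) h by (simp add: F_def E_def)
      also have "\<dots> = differential k (cochain_of H ?n) (tup (Suc ?n) y h)"
        unfolding differential_def
      proof (rule sum.cong[OF refl])
        fix j assume "j \<in> {..?n}"
        then have j: "j \<le> ?n" by simp
        show "(- 1) ^ j * H y (omit ?n j h) = (- 1) ^ j * cochain_of H ?n (omit ?n j (tup (Suc ?n) y h))"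
          unfolding omit_tup[OF j] cochain_of_tup[OF zero_less_Suc y omit_hits[OF j h]] ..
      qed
      finally show "f (tup (Suc ?n) y h) = differential k (cochain_of H ?n) (tup (Suc ?n) y h)" .
    qed
  qed
  from AE_tuple_measureI[OF zero_less_Suc this]
  show ?thesis using fc cochain_of_cochain[OF H] by auto
qed

end

theorem corollary2:
  fixes m :: "'g::{topological_group_add, t2_space, second_countable_topology} measure"
    and M :: "'x measure"
    and act :: "'g \<Rightarrow> 'x \<Rightarrow> 'x"
    and Y :: "'x set"
    and \<nu> :: "'x measure"
  assumes "locally_compact_space (euclidean :: 'g topology)"
    and "haar_measure m"
    and "unimodular m"
    and "transverse_system M act Y"
    and "integrable_system M act Y"
    and "transverse_measure m M act Y \<nu>"
    and "amenable m"
  shows "boundedly_acyclic (transverse_groupoid M act Y \<nu>)"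
proof -
  interpret transverse_system M act Y by fact
  obtain \<Lambda> where "invariant_mean m \<Lambda>"
    using \<open>amenable m\<close> unfolding amenable_def invariant_mean_def by blast
  then interpret amenable_transverse M act Y m \<Lambda> \<nu>
    using assms by unfold_locales auto
  have "cocycles \<G> k \<subseteq> coboundaries \<G> k" if "0 < k" for k
    using cocycle_is_coboundary[of _ "k - 1"] that by auto
  then show ?thesis
    unfolding boundedly_acyclic_def cohomology_zero_iff by blast
qed

end
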